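(* Let $p_1=(v_1,w_1)$ and $p_2=(v_2,w_2)$ be points of $P^{Q}=[0,1]^2$ such that $h(q_{w_1}\circ q_{v_1})\neq h(q_{w_2}\circ q_{v_2})$. Then any (continuous) path in $P^{Q}$ from $p_1$ to $p_2$ crosses (i.e. meets) infinitely many bones.
   Context: For $v\in[0,1]$ let $q_v(x)=4vx(1-x)$. The parameter space is $P^{Q}=[0,1]^2$, the point $(v,w)$ corresponding to the pair $(q_v,q_w)$, viewed as $q_v:I_1\to I_2$ and $q_w:I_2\to I_1$, where $I_1,I_2$ are two disjoint copies of $[0,1]$, with critical points $\gamma_1=\frac12\in I_1$ and $\gamma_2=\frac12\in I_2$. $h(f)$ denotes the topological entropy of a continuous map $f:[0,1]\to[0,1]$. Orbits under a pair $(h_1,h_2)$, $h_1:I_1\to I_2$, $h_2:I_2\to I_1$, are obtained by applying $h_1$ and $h_2$ alternately. A point $x\in I_1$ (resp. $y\in I_2$) is periodic of period $2n$ if $n$ is the least positive integer with $(h_2\circ h_1)^{\circ n}(x)=x$ (resp. $(h_1\circ h_2)^{\circ n}(y)=y$). Such an orbit has $n$ points $x_1<\dots<x_n$ in $I_1$ and $n$ points $y_1<\dots<y_n$ in $I_2$; its order-data is the pair of permutations $(\sigma,\tau)\in S_n^2$ with $h_1(x_i)=y_{\sigma(i)}$ and $h_2(y_j)=x_{\tau(j)}$. A boundary anchored $(+,-)$ unimodal map is a map $h:[0,1]\to[0,1]$ with $h(0)=h(1)=0$, increasing on $(0,\gamma)$ and decreasing on $(\gamma,1)$ for some $\gamma\in(0,1)$.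 The order-data $(\sigma,\tau)$ is admissible if it is realized by a periodic orbit of some pair of such maps. For admissible $(\sigma,\tau)\in S_n^2$, the left bone $B^Q_L(\sigma,\tau)$ is the set of $(v,w)\in P^{Q}$ such that $\gamma_1$ is periodic of period $2n$ under $(q_v,q_w)$ with order-data $(\sigma,\tau)$; the right bone $B^Q_R(\sigma,\tau)$ is the set of $(v,w)\in P^{Q}$ such that $\gamma_2$ is periodic of period $2n$ with order-data $(\sigma,\tau)$. A bone is a left bone or a right bone. *)

theory Defs
  imports "HOL-Analysis.Analysis" "HOL-Combinatorics.Permutations"
begin

section \<open>Topological entropy\<close>

definition dyn_separated :: "('a::metric_space \<Rightarrow> 'a) \<Rightarrow> nat \<Rightarrow> real \<Rightarrow> 'a set \<Rightarrow> bool" where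
  "dyn_separated f n \<epsilon> E \<longleftrightarrow>
     (\<forall>x\<in>E. \<forall>y\<in>E. x \<noteq> y \<longrightarrow> (\<exists>k<n. dist ((f ^^ k) x) ((f ^^ k) y) > \<epsilon>))"

text \<open>Bowen's definition for \<open>f : K \<rightarrow> K\<close>. The logarithm is taken inside the supremum
  over the finite separated sets, so that no maximal cardinality needs to exist for the definition
  to make sense. The terms for \<open>n = 0\<close> and for empty \<open>E\<close> are \<open>0\<close>
  because \<open>x / 0 = 0\<close> and \<open>ln 0 = 0\<close>; they do not affect the value for nonempty \<open>K\<close>.\<close>

definition topological_entropy :: "'a::metric_space set \<Rightarrow> ('a \<Rightarrow> 'a) \<Rightarrow> ereal" where
  "topological_entropy K f =
     (SUP \<epsilon>\<in>{0<..}. limsup (\<lambda>n.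
        SUP E\<in>{E. finite E \<and> E \<subseteq> K \<and> dyn_separated f n \<epsilon> E}.
          ereal (ln (real (card E)) / real n)))"


section \<open>Periodic orbits of pairs of interval maps and their order-data\<close>

text \<open>The intervals \<open>I\<^sub>1\<close> and \<open>I\<^sub>2\<close> are both represented by \<open>{0..1}\<close>. They are kept
  disjoint by treating the two parts of an orbit as two separate sets of reals, and by having
  separate notions for orbits starting in \<open>I\<^sub>1\<close> and orbits starting in \<open>I\<^sub>2\<close>.\<close>

definition least_period :: "('a \<Rightarrow> 'a) \<Rightarrow> nat \<Rightarrow> 'a \<Rightarrow> bool" where
  "least_period f n x \<longleftrightarrow>
     0 < n \<and> (f ^^ n) x = x \<and> (\<forall>m. 0 < m \<and> m < n \<longrightarrow> (f ^^ m) x \<noteq> x)"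

text \<open>\<open>S\<^sub>n\<close> is the set of functions that permute \<open>{1..n}\<close> and fix every other number.\<close>

definition order_data ::
    "(real \<Rightarrow> real) \<Rightarrow> (real \<Rightarrow> real) \<Rightarrow> nat \<Rightarrow> real set \<Rightarrow> real set \<Rightarrow>
      (nat \<Rightarrow> nat) \<Rightarrow> (nat \<Rightarrow> nat) \<Rightarrow> bool" where
  "order_data h1 h2 n X Y \<sigma> \<tau> \<longleftrightarrow>
     \<sigma> permutes {1..n} \<and> \<tau> permutes {1..n} \<and>
     (\<exists>x y. strict_mono_on {1..n} x \<and> x ` {1..n} = X \<and>
            strict_mono_on {1..n} y \<and> y ` {1..n} = Y \<and>
            (\<forall>i\<in>{1..n}. h1 (x i) = y (\<sigma> i)) \<and>
            (\<forall>j\<in>{1..n}. h2 (y j) = x (\<tau> j)))"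

definition periodic_in_I1 ::
    "(real \<Rightarrow> real) \<Rightarrow> (real \<Rightarrow> real) \<Rightarrow> nat \<Rightarrow> (nat \<Rightarrow> nat) \<Rightarrow> (nat \<Rightarrow> nat) \<Rightarrow> real \<Rightarrow> bool" where
  "periodic_in_I1 h1 h2 n \<sigma> \<tau> x \<longleftrightarrow>
     x \<in> {0..1} \<and> least_period (h2 \<circ> h1) n x \<and>
     order_data h1 h2 n
       (range (\<lambda>k. ((h2 \<circ> h1) ^^ k) x))
       (range (\<lambda>k. h1 (((h2 \<circ> h1) ^^ k) x))) \<sigma> \<tau>"

definition periodic_in_I2 ::
    "(real \<Rightarrow> real) \<Rightarrow> (real \<Rightarrow> real) \<Rightarrow> nat \<Rightarrow> (nat \<Rightarrow> nat) \<Rightarrow> (nat \<Rightarrow> nat) \<Rightarrow> real \<Rightarrow> bool" where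
  "periodic_in_I2 h1 h2 n \<sigma> \<tau> y \<longleftrightarrow>
     y \<in> {0..1} \<and> least_period (h1 \<circ> h2) n y \<and>
     order_data h1 h2 n
       (range (\<lambda>k. h2 (((h1 \<circ> h2) ^^ k) y)))
       (range (\<lambda>k. ((h1 \<circ> h2) ^^ k) y)) \<sigma> \<tau>"

definition unimodal_map :: "(real \<Rightarrow> real) \<Rightarrow> bool" where
  "unimodal_map h \<longleftrightarrow>
     continuous_on {0..1} h \<and> h ` {0..1} \<subseteq> {0..1} \<and> h 0 = 0 \<and> h 1 = 0 \<and>
     (\<exists>\<gamma>. 0 < \<gamma> \<and> \<gamma> < 1 \<and> strict_mono_on {0<..<\<gamma>} h \<and> strict_antimono_on {\<gamma><..<1} h)"

definition admissible :: "nat \<Rightarrow> (nat \<Rightarrow> nat) \<Rightarrow> (nat \<Rightarrow> nat) \<Rightarrow> bool" where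
  "admissible n \<sigma> \<tau> \<longleftrightarrow>
     (\<exists>h1 h2. unimodal_map h1 \<and> unimodal_map h2 \<and>
        ((\<exists>x. periodic_in_I1 h1 h2 n \<sigma> \<tau> x) \<or> (\<exists>y. periodic_in_I2 h1 h2 n \<sigma> \<tau> y)))"


section \<open>The quadratic family and its bones\<close>

definition quad :: "real \<Rightarrow> real \<Rightarrow> real" where
  "quad v x = 4 * v * x * (1 - x)"

definition PQ :: "(real \<times> real) set" where
  "PQ = {0..1} \<times> {0..1}"

definition left_bone :: "nat \<Rightarrow> (nat \<Rightarrow> nat) \<Rightarrow> (nat \<Rightarrow> nat) \<Rightarrow> (real \<times> real) set" where
  "left_bone n \<sigma> \<tau> = {(v, w) \<in> PQ. periodic_in_I1 (quad v) (quad w) n \<sigma> \<tau> (1/2)}"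

definition right_bone :: "nat \<Rightarrow> (nat \<Rightarrow> nat) \<Rightarrow> (nat \<Rightarrow> nat) \<Rightarrow> (real \<times> real) set" where
  "right_bone n \<sigma> \<tau> = {(v, w) \<in> PQ. periodic_in_I2 (quad v) (quad w) n \<sigma> \<tau> (1/2)}"

definition bones :: "(real \<times> real) set set" where
  "bones = {B. \<exists>n \<sigma> \<tau>. admissible n \<sigma> \<tau> \<and> (B = left_bone n \<sigma> \<tau> \<or> B = right_bone n \<sigma> \<tau>)}"

end

theory Submission
  imports Defs
begin

text \<open>
  Write \<open>f = q\<^sub>w \<circ> q\<^sub>v\<close> and suppose that a path meets only finitely many bones; let \<open>P\<close> consist of \<open>1\<close> and
  of the finitely many half-periods \<open>n\<close> of these bones. For each \<open>k\<close> count the fixed points of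
  \<open>f\<^sup>k\<close> with nonpositive multiplier that are not fixed by \<open>f\<^sup>j\<close> for any \<open>j \<in> P\<close> dividing \<open>k\<close>.
  Multiplier \<open>0\<close> would put a critical point on a periodic orbit, hence the parameter on a bone, so
  the multipliers of the counted points are negative; such points can neither vanish nor merge, and
  the count is constant along the path.
  On the other hand the exponential growth rate in \<open>k\<close> of this count is the entropy. It is not larger, because
  two such points are separated by a turning point of \<open>f\<^sup>k\<close> and an \<open>(n, \<epsilon>)\<close>-ball of
  \<open>f\<^sup>m\<close> meets at most \<open>2\<^sup>n\<close> of the resulting intervals of monotonicity. It is not smaller, because by Misiurewicz's
  theorem positive entropy yields horseshoes carrying almost all of it, and the symmetry \<open>y \<mapsto> 1 - y\<close> of the
  quadratic maps provides branches of either orientation.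
\<close>

subsection \<open>Bowen entropy and separated sets\<close>

text \<open>An interior fixed point of \<open>f^k\<close> can disappear only at multiplier 1. For
  nonpositive multipliers the slope of \<open>f^k - id\<close> is at most -1, so persistence is
  elementary; the price is that points may enter or leave the count when the multiplier passes
  through 0, which forces a critical point to be periodic. If finitely many bones are met, only
  finitely many half-periods \<open>n\<close> occur there. Dropping the points fixed by these
  \<open>f^n\<close> removes all such exchanges and costs, at each parameter, a finite number of
  points independent of \<open>k\<close>. Period 1 is dropped too, to remove the fixed point 0 on
  the boundary of the interval; for \<open>v = 0\<close> or \<open>w = 0\<close> nothing is then
  left to count. Both growth estimates lose a factor 2 per step: a cylinder has up to two children
  that partially cover a lap, and a turning point near an orbit has two sides. They are therefore
  carried out for \<open>f^m\<close>, with \<open>m\<close> so large that a factor 2 per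
  \<open>m\<close> steps of \<open>f\<close> is affordable.\<close>

lemma topological_entropy_nonneg: "0 \<le> topological_entropy K f"
proof -
  define S where "S n = (SUP E\<in>{E. finite E \<and> E \<subseteq> K \<and> dyn_separated f n 1 E}. ereal (ln (real (card E)) / real n))" for n
  have "0 \<le> S n" for n
    unfolding S_def by (rule SUP_upper2[of "{}"]) (auto simp: dyn_separated_def)
  hence "0 \<le> limsup S"
    by (intro le_Limsup) auto
  also have "limsup S \<le> topological_entropy K f"
    unfolding topological_entropy_def S_def by (rule SUP_upper) simp
  finally show ?thesis .
qed

lemma topological_entropy_less_separated:
  assumes "topological_entropy K f < ereal a" "0 < \<epsilon>"
  shows "\<exists>n0. \<forall>n\<ge>n0. \<forall>E. finite E \<longrightarrow> E \<subseteq> K \<longrightarrow> dyn_separated f n \<epsilon> E \<longrightarrow>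
           real (card E) \<le> exp (a * real n)"
proof -
  define S where "S n = (SUP E\<in>{E. finite E \<and> E \<subseteq> K \<and> dyn_separated f n \<epsilon> E}. ereal (ln (real (card E)) / real n))" for n
  have "limsup S \<le> topological_entropy K f"
    unfolding topological_entropy_def S_def by (rule SUP_upper) (use assms in simp)
  hence "limsup S < ereal a" using assms by simp
  hence "eventually (\<lambda>n. S n < ereal a) sequentially" by (rule Limsup_lessD)
  then obtain n0 where n0: "\<And>n. n \<ge> n0 \<Longrightarrow> S n < ereal a"
    by (auto simp: eventually_sequentially)
  show ?thesis
  proof (intro exI[of _ "max n0 1"] allI impI)
    fix n E assume n: "max n0 1 \<le> n" and E: "finite E" "E \<subseteq> K" "dyn_separated f n \<epsilon> E"
    have "ereal (ln (real (card E)) / real n) \<le> S n"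
      unfolding S_def by (rule SUP_upper) (use E in simp)
    hence "ereal (ln (real (card E)) / real n) < ereal a" using n0[of n] n by (meson max.boundedE order.strict_trans1)
    hence *: "ln (real (card E)) \<le> a * real n" using n by (simp add: field_simps)
    show "real (card E) \<le> exp (a * real n)"
    proof (cases "card E = 0")
      case False
      thus ?thesis using * by (metis exp_le_cancel_iff exp_ln of_nat_0_less_iff gr0I)
    qed simp
  qed
qed

lemma less_topological_entropy_separated:
  assumes "ereal a < topological_entropy K f" "0 \<le> a"
  shows "\<exists>\<epsilon>>0. \<forall>n0. \<exists>n\<ge>n0. \<exists>E. finite E \<and> E \<subseteq> K \<and> dyn_separated f n \<epsilon> E \<and>
           exp (a * real n) < real (card E)"
proof -
  define S where "S \<epsilon> n = (SUP E\<in>{E. finite E \<and> E \<subseteq> K \<and> dyn_separated f n \<epsilon> E}. ereal (ln (real (card E)) / real n))" for \<epsilon> n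
  obtain \<epsilon> where e: "\<epsilon> > 0" "ereal a < limsup (S \<epsilon>)"
    using assms unfolding topological_entropy_def S_def by (auto simp: less_SUP_iff)
  have ne: "\<not> eventually (\<lambda>n. S \<epsilon> n \<le> ereal a) sequentially"
    using e(2) Limsup_bounded[of "S \<epsilon>" "ereal a" sequentially] by auto
  show ?thesis
  proof (intro exI[of _ \<epsilon>] conjI allI)
    show "0 < \<epsilon>" by fact
    fix n0
    obtain n where n: "n \<ge> max 1 n0" "S \<epsilon> n > ereal a"
      using ne unfolding eventually_sequentially by (meson not_le)
    obtain E where E: "finite E" "E \<subseteq> K" "dyn_separated f n \<epsilon> E" "ereal a < ereal (ln (real (card E)) / real n)"
      using n(2) unfolding S_def less_SUP_iff by auto
    have l: "a * real n < ln (real (card E))" using E(4) n by (simp add: field_simps)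
    \<comment> \<open>The default \<open>ln 0 = 0\<close> would let the empty set through for
      negative \<open>a\<close>; \<open>0 \<le> a\<close> rules it out.\<close>
    have "card E \<noteq> 0" using l assms(2) by (metis ln_0 mult_nonneg_nonneg not_le of_nat_0 of_nat_0_le_iff)
    hence "exp (a * real n) < real (card E)" using l by (metis exp_less_cancel_iff exp_ln gr0I of_nat_0_less_iff)
    thus "\<exists>n\<ge>n0. \<exists>E. finite E \<and> E \<subseteq> K \<and> dyn_separated f n \<epsilon> E \<and> exp (a * real n) < real (card E)"
      using n E by auto
  qed
qed

subsection \<open>Strictly monotone maps with a sign\<close>

text \<open>The orientation is a factor \<open>s\<close>, 1 or -1, so that both cases share one
  inequality and signs multiply under composition.\<close>

definition mono_dir :: "real \<Rightarrow> (real \<Rightarrow> real) \<Rightarrow> real set \<Rightarrow> bool" where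
  "mono_dir s g A \<longleftrightarrow> (\<forall>x\<in>A. \<forall>y\<in>A. x < y \<longrightarrow> 0 < s * (g y - g x))"

definition strictly_monotone :: "(real \<Rightarrow> real) \<Rightarrow> real set \<Rightarrow> bool" where
  "strictly_monotone g A \<longleftrightarrow> (\<exists>s\<in>{1,-1}. mono_dir s g A)"

lemma mono_dir_subset: "mono_dir s g A \<Longrightarrow> B \<subseteq> A \<Longrightarrow> mono_dir s g B"
  unfolding mono_dir_def by blast

lemma strictly_monotone_subset: "strictly_monotone g A \<Longrightarrow> B \<subseteq> A \<Longrightarrow> strictly_monotone g B"
  unfolding strictly_monotone_def using mono_dir_subset by blast

lemma strictly_monotoneI: "mono_dir s g A \<Longrightarrow> s \<in> {1,-1} \<Longrightarrow> strictly_monotone g A"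
  unfolding strictly_monotone_def by blast

lemma mono_dir_comp:
  assumes "mono_dir s g A" "mono_dir t h (g ` A)" "s \<in> {1,-1}"
  shows "mono_dir (s * t) (\<lambda>x. h (g x)) A"
  unfolding mono_dir_def
proof (intro ballI impI)
  fix x y assume xy: "x \<in> A" "y \<in> A" "x < y"
  have g: "0 < s * (g y - g x)" using assms(1) xy unfolding mono_dir_def by blast
  have h1: "g x < g y \<Longrightarrow> 0 < t * (h (g y) - h (g x))"
    and h2: "g y < g x \<Longrightarrow> 0 < t * (h (g x) - h (g y))"
    using assms(2) xy unfolding mono_dir_def by blast+
  show "0 < s * t * (h (g y) - h (g x))"
  proof (cases "s = 1")
    case True thus ?thesis using g h1 by simp
  next
    case False
    hence "s = -1" using assms(3) by simp
    thus ?thesis using g h2 by (simp add: algebra_simps)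
  qed
qed

lemma strictly_monotone_comp:
  assumes "strictly_monotone g A" "strictly_monotone h (g ` A)"
  shows "strictly_monotone (\<lambda>x. h (g x)) A"
proof -
  obtain s t where st: "s \<in> {1,-1}" "t \<in> {1,-1}" "mono_dir s g A" "mono_dir t h (g ` A)"
    using assms unfolding strictly_monotone_def by blast
  have "s * t \<in> {1,-1}" using st by auto
  thus ?thesis using mono_dir_comp[OF st(3,4,1)] strictly_monotoneI by blast
qed

lemma strictly_monotone_inj: "strictly_monotone g A \<Longrightarrow> inj_on g A"
  unfolding strictly_monotone_def mono_dir_def inj_on_def
  by (metis diff_self less_irrefl mult_zero_right not_less_iff_gr_or_eq)

lemma strictly_monotone_between:
  assumes "strictly_monotone g A" "x \<in> A" "y \<in> A" "z \<in> A" "x \<le> z" "z \<le> y" "is_interval I" "g x \<in> I" "g y \<in> I"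
  shows "g z \<in> I"
proof (cases "x = z \<or> z = y")
  case False
  hence "x < z" "z < y" using assms by auto
  then obtain s where s: "s = 1 \<or> s = -1" "0 < s * (g z - g x)" "0 < s * (g y - g z)"
    using assms unfolding strictly_monotone_def mono_dir_def by (metis insertE singletonD)
  hence "(g x \<le> g z \<and> g z \<le> g y) \<or> (g y \<le> g z \<and> g z \<le> g x)" by auto
  thus ?thesis using assms(7,8,9) unfolding is_interval_1 by blast
qed (use assms in auto)

lemma is_interval_strictly_monotone_vimage:
  assumes "strictly_monotone g A" "is_interval A" "is_interval I"
  shows "is_interval {x \<in> A. g x \<in> I}"
  unfolding is_interval_1
proof (intro ballI allI impI)
  fix a b x assume *: "a \<in> {x \<in> A. g x \<in> I}" "b \<in> {x \<in> A. g x \<in> I}" "a \<le> x \<and> x \<le> b"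
  hence "x \<in> A" using assms(2) unfolding is_interval_1 by blast
  with * show "x \<in> {x \<in> A. g x \<in> I}"
    using strictly_monotone_between[OF assms(1), of a b x I] assms(3) by auto
qed

lemma is_interval_continuous_image:
  fixes g :: "real \<Rightarrow> real"
  assumes "continuous_on A g" "is_interval A"
  shows "is_interval (g ` A)"
  using assms connected_continuous_image is_interval_connected_1 by blast

lemma is_interval_one_sided:
  fixes A :: "real set"
  assumes "is_interval A" "c \<notin> A" shows "A \<subseteq> {..<c} \<or> A \<subseteq> {c<..}"
proof (rule ccontr)
  assume "\<not> ?thesis"
  then obtain x y where xy: "x \<in> A" "y \<in> A" "c \<le> x" "y \<le> c" by (meson greaterThan_iff lessThan_iff not_less subsetI)
  thus False using assms unfolding is_interval_1 by blast
qed

subsection \<open>Alternating compositions of the two quadratic maps\<close>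

text \<open>Half-steps: index \<open>2 * k\<close> gives the \<open>k\<close>-th iterate of
  \<open>quad w \<circ> quad v\<close>, odd indices give points of the second interval. Both
  critical points then appear in the single condition \<open>alt_comp v w i x = 1/2\<close>.\<close>

fun alt_comp :: "real \<Rightarrow> real \<Rightarrow> nat \<Rightarrow> real \<Rightarrow> real" where
  "alt_comp v w 0 x = x"
| "alt_comp v w (Suc n) x = quad (if even n then v else w) (alt_comp v w n x)"

lemma alt_comp_even: "alt_comp v w (2 * k) x = ((quad w \<circ> quad v) ^^ k) x"
  by (induction k) auto

text \<open>The shift is even, so that the alternation starts again with
  \<open>quad v\<close>.\<close>

lemma alt_comp_add: "alt_comp v w (n + 2 * k) x = alt_comp v w n (alt_comp v w (2 * k) x)"
  by (induction n) auto

lemma alt_comp_split: "i \<le> n \<Longrightarrow> alt_comp v w i x = alt_comp v w i y \<Longrightarrow> alt_comp v w n x = alt_comp v w n y"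
  by (induction n) (auto simp: le_Suc_eq)

lemma quad_reflect: "quad v (1 - x) = quad v x"
  unfolding quad_def by (simp add: algebra_simps)

lemma quad_range:
  assumes "v \<in> {0..1}" "x \<in> {0..1}" shows "quad v x \<in> {0..1}"
proof -
  have "4 * x * (1 - x) \<le> 1" using zero_le_power2[of "2*x-1"] by (simp add: power2_eq_square algebra_simps)
  hence "v * (4 * x * (1 - x)) \<le> 1 * 1" using assms by (intro mult_mono) auto
  moreover have "0 \<le> v * (4 * x * (1 - x))" using assms by simp
  ultimately show ?thesis unfolding quad_def by (simp add: algebra_simps)
qed

lemma alt_comp_range: "v \<in> {0..1} \<Longrightarrow> w \<in> {0..1} \<Longrightarrow> x \<in> {0..1} \<Longrightarrow> alt_comp v w n x \<in> {0..1}"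
  by (induction n) (auto simp del: atLeastAtMost_iff intro!: quad_range)

lemma continuous_on_alt_comp: "continuous_on A (alt_comp v w n)"
proof (induction n)
  case (Suc n)
  thus ?case unfolding alt_comp.simps quad_def by (intro continuous_intros)
qed (simp add: continuous_on_id)

lemma mono_dir_quad_left: "0 < v \<Longrightarrow> mono_dir 1 (quad v) {..1/2}"
proof -
  assume v: "0 < v"
  have "quad v y - quad v x = 4 * v * ((y - x) * (1 - x - y))" for x y
    unfolding quad_def by (simp add: algebra_simps)
  moreover have "0 < 4 * v * p" if "0 < p" for p using v that by simp
  ultimately show ?thesis unfolding mono_dir_def by simp
qed

lemma mono_dir_quad_right: "0 < v \<Longrightarrow> mono_dir (-1) (quad v) {1/2..}"
  unfolding mono_dir_def
proof (intro ballI impI)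
  fix x y :: real assume *: "0 < v" "x \<in> {1/2..}" "y \<in> {1/2..}" "x < y"
  have "-1 * (quad v y - quad v x) = 4 * v * ((y - x) * (x + y - 1))"
    unfolding quad_def by (simp add: algebra_simps)
  moreover have "0 < 4 * v * ((y - x) * (x + y - 1))" using * by (intro mult_pos_pos) auto
  ultimately show "0 < -1 * (quad v y - quad v x)" by simp
qed

lemma strictly_monotone_quad:
  "0 < v \<Longrightarrow> A \<subseteq> {..1/2} \<or> A \<subseteq> {1/2..} \<Longrightarrow> strictly_monotone (quad v) A"
  using mono_dir_quad_left[of v] mono_dir_quad_right[of v] mono_dir_subset[of _ "quad v" _ A]
    strictly_monotoneI[of 1] strictly_monotoneI[of "-1"] by fastforce

text \<open>The image of the open interval is connected and misses 1/2, so it lies on one side of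
  the critical point; passing to closures adds the endpoints. They may themselves hit 1/2, as the
  ends of a lap do.\<close>

lemma alt_comp_strictly_monotone_closed:
  assumes v: "0 < v" "0 < w" and ab: "a < b"
    and "\<And>i z. i < n \<Longrightarrow> a < z \<Longrightarrow> z < b \<Longrightarrow> alt_comp v w i z \<noteq> 1/2"
  shows "strictly_monotone (alt_comp v w n) {a..b}"
  using assms(4)
proof (induction n)
  case 0
  show ?case by (rule strictly_monotoneI[of 1]) (auto simp: mono_dir_def)
next
  case (Suc n)
  have IH: "strictly_monotone (alt_comp v w n) {a..b}" using Suc by simp
  have iv: "is_interval (alt_comp v w n ` {a<..<b})"
    by (intro is_interval_continuous_image continuous_on_alt_comp) (simp add: is_interval_oo)
  have nh: "1/2 \<notin> alt_comp v w n ` {a<..<b}" using Suc.prems[of n] by force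
  have side: "alt_comp v w n ` {a<..<b} \<subseteq> {..1/2} \<or> alt_comp v w n ` {a<..<b} \<subseteq> {1/2..}"
    using is_interval_one_sided[OF iv nh] by force
  have cl: "alt_comp v w n ` {a..b} \<subseteq> closure (alt_comp v w n ` {a<..<b})"
    using image_closure_subset[OF continuous_on_alt_comp closed_closure closure_subset, where S="{a<..<b}"] ab
    by simp
  have "alt_comp v w n ` {a..b} \<subseteq> {..1/2} \<or> alt_comp v w n ` {a..b} \<subseteq> {1/2..}"
    using side cl closure_minimal[OF _ closed_atMost[of "1/2"]] closure_minimal[OF _ closed_atLeast[of "1/2"]]
    by (meson subset_trans)
  hence "strictly_monotone (quad (if even n then v else w)) (alt_comp v w n ` {a..b})"
    using strictly_monotone_quad v by simp
  from strictly_monotone_comp[OF IH this] show ?case by (simp cong: if_cong)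
qed

lemma alt_comp_strictly_monotone:
  assumes v: "0 < v" "0 < w" and A: "is_interval A"
    and nz: "\<And>i z. i < n \<Longrightarrow> z \<in> A \<Longrightarrow> alt_comp v w i z \<noteq> 1/2"
  shows "strictly_monotone (alt_comp v w n) A"
  using nz
proof (induction n)
  case 0
  show ?case by (rule strictly_monotoneI[of 1]) (auto simp: mono_dir_def)
next
  case (Suc n)
  have IH: "strictly_monotone (alt_comp v w n) A" using Suc by simp
  have iv: "is_interval (alt_comp v w n ` A)"
    by (intro is_interval_continuous_image continuous_on_alt_comp A)
  have nh: "1/2 \<notin> alt_comp v w n ` A" using Suc.prems[of n] by force
  have "alt_comp v w n ` A \<subseteq> {..1/2} \<or> alt_comp v w n ` A \<subseteq> {1/2..}"
    using is_interval_one_sided[OF iv nh] by force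
  hence "strictly_monotone (quad (if even n then v else w)) (alt_comp v w n ` A)"
    using strictly_monotone_quad v by simp
  from strictly_monotone_comp[OF IH this] show ?case by (simp cong: if_cong)
qed

lemma finite_quad_vimage: "0 < v \<Longrightarrow> finite {x. quad v x = y}"
proof -
  assume v: "0 < v"
  have "{x. quad v x = y} \<subseteq> {x. poly [:- y, 4 * v, - 4 * v:] x = 0}"
    unfolding quad_def by (auto simp: algebra_simps)
  moreover have "finite {x. poly [:- y, 4 * v, - 4 * v:] x = 0}"
    using v by (intro poly_roots_finite) auto
  ultimately show ?thesis by (rule finite_subset)
qed

lemma finite_alt_comp_vimage: "0 < v \<Longrightarrow> 0 < w \<Longrightarrow> finite {x. alt_comp v w n x = y}"
proof (induction n arbitrary: y)
  case (Suc n)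
  let ?u = "if even n then v else w"
  have "{x. alt_comp v w (Suc n) x = y} = (\<Union>z\<in>{z. quad ?u z = y}. {x. alt_comp v w n x = z})" by auto
  moreover have "finite {z. quad ?u z = y}" using Suc.prems by (intro finite_quad_vimage) auto
  ultimately show ?case using Suc by auto
qed simp

subsection \<open>Renewal argument for piecewise monotone maps\<close>

text \<open>\<open>C\<close> may be larger than the set of turning points; it only has to cut the
  interval into pieces of monotonicity.\<close>

locale piecewise_monotone =
  fixes G :: "real \<Rightarrow> real" and C :: "real set"
  assumes cont: "continuous_on {0..1} G" and maps: "G ` {0..1} \<subseteq> {0..1}"
    and finite_C: "finite C" and C01: "0 \<in> C" "1 \<in> C" "C \<subseteq> {0..1}"
    and mono: "\<And>a b. 0 \<le> a \<Longrightarrow> a < b \<Longrightarrow> b \<le> 1 \<Longrightarrow> {a<..<b} \<inter> C = {} \<Longrightarrow> strictly_monotone G {a..b}"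
begin

definition laps :: "real set set" where
  "laps = {{a<..<b} | a b. a \<in> C \<and> b \<in> C \<and> a < b \<and> {a<..<b} \<inter> C = {}}"

text \<open>Partition points for the \<open>n\<close>-th iterate of \<open>G\<close>, which is
  monotone between neighbours. The growth of \<open>card (T n)\<close> stands in for that of the lap
  number.\<close>

definition T :: "nat \<Rightarrow> real set" where
  "T n = {x \<in> {0..1}. \<exists>i<n. (G ^^ i) x \<in> C}"

lemma finite_laps: "finite laps"
proof -
  have "laps \<subseteq> (\<lambda>(a,b). {a<..<b}) ` (C \<times> C)" unfolding laps_def by auto
  thus ?thesis using finite_C by (meson finite_SigmaI finite_imageI finite_subset)
qed

lemma lapD:
  assumes "M \<in> laps"
  shows "is_interval M" "M \<noteq> {}" "M \<subseteq> {0..1}" "M \<inter> C = {}" "strictly_monotone G M"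
proof -
  obtain a b where ab: "M = {a<..<b}" "a \<in> C" "b \<in> C" "a < b" "{a<..<b} \<inter> C = {}"
    using assms unfolding laps_def by blast
  have ab01: "0 \<le> a" "b \<le> 1" using ab C01(3) by auto
  show "is_interval M" "M \<noteq> {}" "M \<subseteq> {0..1}" "M \<inter> C = {}"
    using ab ab01 by (auto simp: is_interval_oo)
  show "strictly_monotone G M"
    using strictly_monotone_subset[OF mono[OF ab01(1) ab(4) ab01(2) ab(5)], of M] unfolding ab(1)
    by force
qed

lemma laps_disjoint: "M \<in> laps \<Longrightarrow> M' \<in> laps \<Longrightarrow> M \<noteq> M' \<Longrightarrow> M \<inter> M' = {}"
proof (rule ccontr)
  assume M: "M \<in> laps" "M' \<in> laps" "M \<noteq> M'" "M \<inter> M' \<noteq> {}"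
  obtain a b where ab: "M = {a<..<b}" "a \<in> C" "b \<in> C" "{a<..<b} \<inter> C = {}"
    using M unfolding laps_def by blast
  obtain a' b' where ab': "M' = {a'<..<b'}" "a' \<in> C" "b' \<in> C" "{a'<..<b'} \<inter> C = {}"
    using M unfolding laps_def by blast
  obtain x where "x \<in> M" "x \<in> M'" using M(4) by blast
  hence x: "a < x" "x < b" "a' < x" "x < b'" using ab(1) ab'(1) by auto
  have "a \<notin> {a'<..<b'}" "b \<notin> {a'<..<b'}" "a' \<notin> {a<..<b}" "b' \<notin> {a<..<b}"
    using ab ab' by blast+
  hence "a = a' \<and> b = b'" using x unfolding greaterThanLessThan_iff by linarith
  thus False using M(3) ab(1) ab'(1) by simp
qed

lemma laps_cover:
  assumes "x \<in> {0..1}" "x \<notin> C" shows "\<exists>M\<in>laps. x \<in> M"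
proof -
  let ?A = "{c \<in> C. c < x}" and ?B = "{c \<in> C. x < c}"
  have f: "finite ?A" "finite ?B" using finite_C by auto
  have "0 \<noteq> x" "1 \<noteq> x" using assms C01 by auto
  hence n: "?A \<noteq> {}" "?B \<noteq> {}" using assms C01 by auto
  have a: "Max ?A \<in> ?A" and b: "Min ?B \<in> ?B" using f n Max_in Min_in by blast+
  have "c \<notin> {Max ?A<..<Min ?B}" if "c \<in> C" for c
  proof (cases "c < x")
    case True
    hence "c \<le> Max ?A" using f that by (intro Max_ge) auto
    thus ?thesis by auto
  next
    case False
    hence "x < c" using assms that by (metis linorder_neqE_linordered_idom)
    hence "Min ?B \<le> c" using f that by (intro Min_le) auto
    thus ?thesis by auto
  qed
  hence "{Max ?A<..<Min ?B} \<in> laps" unfolding laps_def using a b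
    by (intro CollectI exI[of _ "Max ?A"] exI[of _ "Min ?B"]) auto
  moreover have "x \<in> {Max ?A<..<Min ?B}" using a b by auto
  ultimately show ?thesis by blast
qed

lemma maps_unit: "x \<in> {0..1} \<Longrightarrow> G x \<in> {0..1}"
  using maps by blast

lemma iterate_maps: "x \<in> {0..1} \<Longrightarrow> (G ^^ n) x \<in> {0..1}"
  by (induction n) (simp_all add: maps_unit del: atLeastAtMost_iff)

lemma iterate_continuous: "continuous_on {0..1} (G ^^ n)"
proof (induction n)
  case (Suc n)
  have "continuous_on ((G ^^ n) ` {0..1}) G"
    using iterate_maps by (intro continuous_on_subset[OF cont]) blast
  from continuous_on_compose[OF Suc this] show ?case by simp
qed (simp add: continuous_on_id id_def)

lemma T_Suc: "T (Suc n) = C \<union> {x \<in> {0..1}. G x \<in> T n}"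
proof -
  have "(\<exists>i<Suc n. (G ^^ i) x \<in> C) \<longleftrightarrow> x \<in> C \<or> (\<exists>i<n. (G ^^ i) (G x) \<in> C)" for x
    by (simp add: Ex_less_Suc2 funpow_swap1)
  thus ?thesis unfolding T_def using C01(3) maps_unit by blast
qed

lemma finite_T: "finite (T n)"
proof (induction n)
  case 0 thus ?case by (simp add: T_def)
next
  case (Suc n)
  have "finite (\<Union>M\<in>laps. G -` T n \<inter> M)"
    using finite_laps lapD(5) Suc
    by (intro finite_UN_I finite_vimage_IntI strictly_monotone_inj) auto
  moreover have "T (Suc n) \<subseteq> C \<union> (\<Union>M\<in>laps. G -` T n \<inter> M)"
    unfolding T_Suc using laps_cover by blast
  ultimately show ?case using finite_C by (meson finite_UnI finite_subset)
qed

text \<open>Cylinder sets inside \<open>J\<close> on which the first \<open>k\<close> iterates stay in laps, where a cylinder is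
  abandoned as soon as its image is a whole lap outside \<open>B\<close>.\<close>

primrec active :: "real set set \<Rightarrow> real set \<Rightarrow> nat \<Rightarrow> real set set" where
  "active B J 0 = {J}"
| "active B J (Suc k) = {A'. \<exists>A\<in>active B J k. \<exists>M\<in>laps. A' = {x \<in> A. (G ^^ Suc k) x \<in> M} \<and>
     A' \<noteq> {} \<and> ((G ^^ Suc k) ` A' = M \<longrightarrow> M \<in> B)}"

lemma active_next:
  assumes "A \<subseteq> {0..1}" "strictly_monotone (G ^^ k) A" "M \<in> laps" "(G ^^ k) ` A \<subseteq> M"
  shows "strictly_monotone (G ^^ Suc k) A"
  using strictly_monotone_comp[OF assms(2) strictly_monotone_subset[OF lapD(5)[OF assms(3)] assms(4)]]
  by (simp add: comp_def)

lemma activeD: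
  assumes "J \<in> laps" "A \<in> active B J k"
  shows "A \<subseteq> J \<and> A \<noteq> {} \<and> is_interval A \<and> strictly_monotone (G ^^ k) A \<and> (\<exists>M\<in>laps. (G ^^ k) ` A \<subseteq> M)"
  using assms(2)
proof (induction k arbitrary: A)
  case 0
  have "strictly_monotone (\<lambda>x. x) J" by (rule strictly_monotoneI[of 1]) (auto simp: mono_dir_def)
  thus ?case using 0 assms(1) lapD[OF assms(1)] by (auto simp: id_def)
next
  case (Suc k)
  then obtain A0 M where A: "A0 \<in> active B J k" "M \<in> laps" "A = {x \<in> A0. (G ^^ Suc k) x \<in> M}" "A \<noteq> {}"
    by auto
  note IH = Suc.IH[OF A(1)]
  have "A0 \<subseteq> {0..1}" using IH lapD(3)[OF assms(1)] by blast
  hence sm: "strictly_monotone (G ^^ Suc k) A0" using IH active_next by blast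
  have "is_interval A" unfolding A(3)
    using is_interval_strictly_monotone_vimage[OF sm _ lapD(1)[OF A(2)]] IH by blast
  moreover have "A \<subseteq> A0" "(G ^^ Suc k) ` A \<subseteq> M" using A(3) by auto
  moreover have "strictly_monotone (G ^^ Suc k) A" using sm \<open>A \<subseteq> A0\<close> strictly_monotone_subset by blast
  ultimately show ?case using IH A(2,4) by blast
qed

lemma active_disjoint:
  assumes "A \<in> active B J k" "A' \<in> active B J k" "A \<noteq> A'" shows "A \<inter> A' = {}"
  using assms
proof (induction k arbitrary: A A')
  case (Suc k)
  then obtain A0 M where A: "A0 \<in> active B J k" "M \<in> laps" "A = {x \<in> A0. (G ^^ Suc k) x \<in> M}"
    by auto
  obtain A0' M' where A': "A0' \<in> active B J k" "M' \<in> laps" "A' = {x \<in> A0'. (G ^^ Suc k) x \<in> M'}"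
    using Suc.prems by auto
  show ?case
  proof (cases "A0 = A0'")
    case True
    hence "M \<noteq> M'" using A A' Suc.prems by auto
    thus ?thesis using laps_disjoint A A' by blast
  qed (use A A' Suc.IH in blast)
qed simp

lemma finite_active: "finite (active B J k)"
proof (induction k)
  case (Suc k)
  have "active B J (Suc k) \<subseteq> (\<lambda>(A,M). {x \<in> A. (G ^^ Suc k) x \<in> M}) ` (active B J k \<times> laps)" by auto
  thus ?case using Suc finite_laps by (meson finite_SigmaI finite_imageI finite_subset)
qed simp

text \<open>A lap that meets \<open>I\<close> without being contained in it has a point to the left
  of all of \<open>I\<close> or to the right of all of \<open>I\<close>. Two different laps of the
  same kind would overlap, so each kind occurs at most once.\<close>

lemma card_partial_laps:
  assumes "is_interval I"
  shows "card {M \<in> laps. I \<inter> M \<noteq> {} \<and> \<not> M \<subseteq> I} \<le> 2"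
proof -
  define Lo where "Lo = {M \<in> laps. I \<inter> M \<noteq> {} \<and> (\<exists>z\<in>M. \<forall>x\<in>I. z < x)}"
  define Hi where "Hi = {M \<in> laps. I \<inter> M \<noteq> {} \<and> (\<exists>z\<in>M. \<forall>x\<in>I. x < z)}"
  have sub: "{M \<in> laps. I \<inter> M \<noteq> {} \<and> \<not> M \<subseteq> I} \<subseteq> Lo \<union> Hi"
  proof
    fix M assume M: "M \<in> {M \<in> laps. I \<inter> M \<noteq> {} \<and> \<not> M \<subseteq> I}"
    then obtain z where z: "z \<in> M" "z \<notin> I" by blast
    show "M \<in> Lo \<union> Hi" using is_interval_one_sided[OF assms z(2)] M z unfolding Lo_def Hi_def by auto
  qed
  have lap_mem: "x \<in> M" if "M \<in> laps" "y \<in> M" "z \<in> M" "y \<le> x" "x \<le> z" for M x y z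
    using lapD(1)[OF that(1)] that unfolding is_interval_1 by blast
  have eq: "M = M'" if "M \<in> laps" "M' \<in> laps" "x \<in> M" "x \<in> M'" for M M' x
    using laps_disjoint that by blast
  have lo: "M = M'" if "M \<in> Lo" "M' \<in> Lo" for M M'
  proof -
    obtain z x z' x' where *: "z \<in> M" "z' \<in> M'" "x \<in> I" "x' \<in> I" "x \<in> M" "x' \<in> M'"
      "\<forall>x\<in>I. z < x" "\<forall>x\<in>I. z' < x" "M \<in> laps" "M' \<in> laps"
      using \<open>M \<in> Lo\<close> \<open>M' \<in> Lo\<close> unfolding Lo_def by blast
    have o: "z < x'" "z' < x" using * by blast+
    show ?thesis
    proof (cases "z \<le> z'")
      case True
      have "z' \<in> M" using lap_mem[of M z x z'] *(1,5,9) o True by simp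
      thus ?thesis using eq[of M M' z'] *(2,9,10) by blast
    next
      case False
      have "z \<in> M'" using lap_mem[of M' z' x' z] *(2,6,10) o False by simp
      thus ?thesis using eq[of M M' z] *(1,9,10) by blast
    qed
  qed
  have hi: "M = M'" if "M \<in> Hi" "M' \<in> Hi" for M M'
  proof -
    obtain z x z' x' where *: "z \<in> M" "z' \<in> M'" "x \<in> I" "x' \<in> I" "x \<in> M" "x' \<in> M'"
      "\<forall>x\<in>I. x < z" "\<forall>x\<in>I. x < z'" "M \<in> laps" "M' \<in> laps"
      using \<open>M \<in> Hi\<close> \<open>M' \<in> Hi\<close> unfolding Hi_def by blast
    have o: "x' < z" "x < z'" using * by blast+
    show ?thesis
    proof (cases "z' \<le> z")
      case True
      have "z' \<in> M" using lap_mem[of M x z z'] *(1,5,9) o True by simp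
      thus ?thesis using eq[of M M' z'] *(2,9,10) by blast
    next
      case False
      have "z \<in> M'" using lap_mem[of M' x' z' z] *(2,6,10) o False by simp
      thus ?thesis using eq[of M M' z] *(1,9,10) by blast
    qed
  qed
  have "finite Lo" "finite Hi" using finite_laps unfolding Lo_def Hi_def by auto
  hence "card Lo \<le> 1" "card Hi \<le> 1" using lo hi by (simp_all add: card_le_Suc0_iff_eq)
  moreover have "card {M \<in> laps. I \<inter> M \<noteq> {} \<and> \<not> M \<subseteq> I} \<le> card (Lo \<union> Hi)"
    using sub \<open>finite Lo\<close> \<open>finite Hi\<close> by (intro card_mono) auto
  moreover have "card (Lo \<union> Hi) \<le> card Lo + card Hi" by (rule card_Un_le)
  ultimately show ?thesis by linarith
qed

text \<open>A child that fills its lap only partly comes from a lap that the image of the parent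
  meets but does not contain; there are at most two of these per parent. Every other child fills a
  lap, which must be in \<open>B\<close> for the child to be active.\<close>

lemma card_active_Suc:
  assumes J: "J \<in> laps"
  shows "card (active B J (Suc k)) \<le> 2 * card (active B J k) + (\<Sum>M\<in>laps \<inter> B. card {A \<in> active B J (Suc k). (G ^^ Suc k) ` A = M})"
proof -
  let ?P = "\<lambda>A. {M \<in> laps. (G ^^ Suc k) ` A \<inter> M \<noteq> {} \<and> \<not> M \<subseteq> (G ^^ Suc k) ` A}"
  let ?child = "\<lambda>A M. {x \<in> A. (G ^^ Suc k) x \<in> M}"
  let ?par = "\<Union>A\<in>active B J k. ?child A ` ?P A"
  let ?full = "\<Union>M\<in>laps \<inter> B. {A \<in> active B J (Suc k). (G ^^ Suc k) ` A = M}"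
  have "active B J (Suc k) \<subseteq> ?par \<union> ?full"
  proof
    fix A' assume A': "A' \<in> active B J (Suc k)"
    then obtain A M where A: "A \<in> active B J k" "M \<in> laps" "A' = ?child A M" "A' \<noteq> {}"
      "(G ^^ Suc k) ` A' = M \<longrightarrow> M \<in> B" by auto
    have ne: "(G ^^ Suc k) ` A \<inter> M \<noteq> {}" using A by blast
    show "A' \<in> ?par \<union> ?full"
    proof (cases "M \<subseteq> (G ^^ Suc k) ` A")
      case True
      hence "(G ^^ Suc k) ` A' = M" using A(3) by blast
      thus ?thesis using A A' by blast
    next
      case False thus ?thesis using A ne by blast
    qed
  qed
  moreover have fin: "finite ?par" "finite ?full" using finite_active finite_laps by auto
  ultimately have "card (active B J (Suc k)) \<le> card (?par \<union> ?full)" by (intro card_mono) auto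
  also have "\<dots> \<le> card ?par + card ?full" by (rule card_Un_le)
  also have "card ?full \<le> (\<Sum>M\<in>laps \<inter> B. card {A \<in> active B J (Suc k). (G ^^ Suc k) ` A = M})"
    using finite_laps by (intro card_UN_le) auto
  also have "card ?par \<le> (\<Sum>A\<in>active B J k. card (?child A ` ?P A))"
    using finite_active by (intro card_UN_le) auto
  also have "\<dots> \<le> (\<Sum>A\<in>active B J k. 2)"
  proof (intro sum_mono)
    fix A assume A: "A \<in> active B J k"
    have "is_interval ((G ^^ Suc k) ` A)"
      using activeD[OF J A] lapD(3)[OF J] continuous_on_subset[OF iterate_continuous]
      by (intro is_interval_continuous_image) (auto simp del: funpow.simps)
    from card_partial_laps[OF this] show "card (?child A ` ?P A) \<le> 2"
      using card_image_le[of "?P A" "?child A"] finite_laps by (simp del: funpow.simps)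
  qed
  finally show ?thesis by (simp del: funpow.simps active.simps add: mult.commute)
qed

text \<open>On the image of a cylinder \<open>G\<close> is injective and carries
  \<open>T (Suc n)\<close> into \<open>T n\<close>. The values fall into \<open>C\<close> or into
  the images of the children: an abandoned child fills a lap outside \<open>B\<close> and costs at
  most \<open>R\<close>, an active one is counted in the next sum.\<close>

lemma card_T_active:
  assumes J: "J \<in> laps" and K: "\<And>M. M \<in> laps - B \<Longrightarrow> real (card (M \<inter> T n)) \<le> R" and R: "0 \<le> R"
  shows "(\<Sum>A\<in>active B J k. real (card ((G ^^ k) ` A \<inter> T (Suc n)))) \<le>
     (\<Sum>A\<in>active B J (Suc k). real (card ((G ^^ Suc k) ` A \<inter> T n))) +
     real (card (active B J k)) * (real (card C) + real (card laps) * R)"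
proof -
  let ?child = "\<lambda>A M. {x \<in> A. (G ^^ Suc k) x \<in> M}"
  define h where "h A = real (card ((G ^^ Suc k) ` A \<inter> T n))" for A
  \<comment> \<open>The pairs whose child remains active. Their children are nonempty, hence
    distinct for distinct pairs, which permits the reindexing below.\<close>
  define S where "S = {(A, M) \<in> active B J k \<times> laps. ?child A M \<in> active B J (Suc k)}"
  have S_sub: "S \<subseteq> active B J k \<times> laps" unfolding S_def by blast
  have imc: "(G ^^ Suc k) ` ?child A M = (G ^^ Suc k) ` A \<inter> M" for A M by auto
  have one: "real (card ((G ^^ k) ` A \<inter> T (Suc n))) \<le> real (card C) + (\<Sum>M\<in>laps. h (?child A M))"
    if A: "A \<in> active B J k" for A
  proof -
    obtain M0 where M0: "M0 \<in> laps" "(G ^^ k) ` A \<subseteq> M0" using activeD[OF J A] by blast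
    have inj: "inj_on G ((G ^^ k) ` A \<inter> T (Suc n))"
      using strictly_monotone_inj[OF lapD(5)[OF M0(1)]] M0(2) by (meson inj_on_subset inf.coboundedI1)
    have "G ` ((G ^^ k) ` A \<inter> T (Suc n)) \<subseteq> (G ^^ Suc k) ` A \<inter> T n"
      using M0 lapD(4)[OF M0(1)] unfolding T_Suc by auto
    also have "\<dots> \<subseteq> C \<union> (\<Union>M\<in>laps. (G ^^ Suc k) ` ?child A M \<inter> T n)"
    proof
      fix y assume y: "y \<in> (G ^^ Suc k) ` A \<inter> T n"
      hence "y \<in> {0..1}" unfolding T_def by simp
      thus "y \<in> C \<union> (\<Union>M\<in>laps. (G ^^ Suc k) ` ?child A M \<inter> T n)"
        using laps_cover[of y] y unfolding imc by blast
    qed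
    finally have "card (G ` ((G ^^ k) ` A \<inter> T (Suc n))) \<le> card (C \<union> (\<Union>M\<in>laps. (G ^^ Suc k) ` ?child A M \<inter> T n))"
      using finite_C finite_T finite_laps by (intro card_mono) auto
    also have "\<dots> \<le> card C + card (\<Union>M\<in>laps. (G ^^ Suc k) ` ?child A M \<inter> T n)" by (rule card_Un_le)
    also have "card (\<Union>M\<in>laps. (G ^^ Suc k) ` ?child A M \<inter> T n) \<le> (\<Sum>M\<in>laps. card ((G ^^ Suc k) ` ?child A M \<inter> T n))"
      using finite_laps by (rule card_UN_le)
    finally have "card ((G ^^ k) ` A \<inter> T (Suc n)) \<le> card C + (\<Sum>M\<in>laps. card ((G ^^ Suc k) ` ?child A M \<inter> T n))"
      unfolding card_image[OF inj] by simp
    hence "real (card ((G ^^ k) ` A \<inter> T (Suc n))) \<le> real (card C + (\<Sum>M\<in>laps. card ((G ^^ Suc k) ` ?child A M \<inter> T n)))"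
      by (rule of_nat_mono)
    thus ?thesis unfolding h_def by simp
  qed
  have bound: "h (?child A M) \<le> (if (A, M) \<in> S then h (?child A M) else 0) + R"
    if "A \<in> active B J k" "M \<in> laps" for A M
  proof (cases "(A, M) \<in> S")
    case False
    hence "?child A M = {} \<or> ((G ^^ Suc k) ` ?child A M = M \<and> M \<notin> B)"
      using that unfolding S_def by auto
    thus ?thesis
    proof
      assume "?child A M = {}"
      hence "h (?child A M) = h {}" by (rule arg_cong)
      thus ?thesis using R False by (simp add: h_def del: funpow.simps)
    next
      assume "(G ^^ Suc k) ` ?child A M = M \<and> M \<notin> B"
      thus ?thesis using K[of M] that False unfolding h_def by simp
    qed
  qed (use R in simp)
  have "(\<Sum>A\<in>active B J k. real (card ((G ^^ k) ` A \<inter> T (Suc n)))) \<le>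
      (\<Sum>A\<in>active B J k. real (card C) + (\<Sum>M\<in>laps. (if (A, M) \<in> S then h (?child A M) else 0) + R))"
    by (intro sum_mono order_trans[OF one] add_left_mono bound) auto
  also have "\<dots> = (\<Sum>A\<in>active B J k. \<Sum>M\<in>laps. (if (A, M) \<in> S then h (?child A M) else 0)) +
       real (card (active B J k)) * (real (card C) + real (card laps) * R)"
    by (simp add: sum.distrib algebra_simps)
  also have "(\<Sum>A\<in>active B J k. \<Sum>M\<in>laps. (if (A, M) \<in> S then h (?child A M) else 0)) =
      (\<Sum>(A,M)\<in>active B J k \<times> laps. (if (A, M) \<in> S then h (?child A M) else 0))"
    by (rule sum.cartesian_product)
  also have "\<dots> = (\<Sum>(A,M)\<in>S. h (?child A M))"
    using finite_active finite_laps S_sub by (intro sum.mono_neutral_cong_right) auto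
  also have "\<dots> = (\<Sum>p\<in>S. h ((\<lambda>(A,M). ?child A M) p))" by (simp add: case_prod_unfold)
  also have "\<dots> = sum h ((\<lambda>(A,M). ?child A M) ` S)"
  proof (subst sum.reindex)
    show "inj_on (\<lambda>(A,M). ?child A M) S"
    proof (rule inj_onI, clarify)
      fix A M A' M' assume S: "(A, M) \<in> S" "(A', M') \<in> S" and eq: "?child A M = ?child A' M'"
      have "?child A M \<noteq> {}" using S activeD[OF J, of "?child A M" B "Suc k"] unfolding S_def by blast
      then obtain x where x: "x \<in> ?child A M" by blast
      hence "x \<in> ?child A' M'" using eq by blast
      hence "x \<in> A" "x \<in> A'" "(G ^^ Suc k) x \<in> M" "(G ^^ Suc k) x \<in> M'" using x by blast+
      thus "A = A' \<and> M = M'" using S active_disjoint[of A B J k A'] laps_disjoint[of M M'] unfolding S_def by blast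
    qed
  qed simp
  also have "\<dots> \<le> sum h (active B J (Suc k))"
    using finite_active by (intro sum_mono2) (auto simp: S_def h_def simp del: active.simps)
  finally show ?thesis unfolding h_def by simp
qed

text \<open>If few cylinders in \<open>J\<close> map onto a lap in \<open>B\<close>, then the number of active cylinders grows
  no faster than \<open>\<mu>\<^sup>k\<close>, since each of them has at most two children that only partially cover
  a lap; unfolding the turning points of \<open>J\<close> along these cylinders costs at most a geometric sum.\<close>

lemma renewal_bound:
  assumes J: "J \<in> laps" and mu: "2 < \<mu>" "\<mu> < \<Lambda>" and K: "0 \<le> K"
    and small: "\<And>M n. M \<in> laps - B \<Longrightarrow> real (card (M \<inter> T n)) \<le> K * \<Lambda> ^ n"
    and few: "\<And>k M. M \<in> laps \<inter> B \<Longrightarrow> 1 \<le> k \<Longrightarrow> real (card {A \<in> active B J k. (G ^^ k) ` A = M}) \<le> \<mu> ^ k"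
  shows "\<exists>Q. \<forall>n. real (card (J \<inter> T n)) \<le> Q * \<Lambda> ^ n"
proof -
  define L where "L = real (card laps)"
  \<comment> \<open>The quotient is the least solution of
    \<open>2 * D + L * \<mu> \<le> D * \<mu>\<close>, the recursion for the number of active
    cylinders; it exists because \<open>2 < \<mu>\<close>. The 1 covers the initial cylinder
    \<open>J\<close>.\<close>
  define D where "D = max 1 (L * \<mu> / (\<mu> - 2))"
  have L: "0 \<le> L" unfolding L_def by simp
  have D: "1 \<le> D" unfolding D_def by simp
  have D2: "2 * D + L * \<mu> \<le> D * \<mu>"
  proof -
    have "L * \<mu> / (\<mu> - 2) \<le> D" unfolding D_def by simp
    thus ?thesis using mu by (simp add: field_simps)
  qed
  have a: "real (card (active B J k)) \<le> D * \<mu> ^ k" for k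
  proof (induction k)
    case 0 show ?case using D by simp
  next
    case (Suc k)
    have "real (card (active B J (Suc k))) \<le> real (2 * card (active B J k) + (\<Sum>M\<in>laps \<inter> B. card {A \<in> active B J (Suc k). (G ^^ Suc k) ` A = M}))"
      using card_active_Suc[OF J] by (rule of_nat_mono)
    also have "\<dots> = 2 * real (card (active B J k)) + (\<Sum>M\<in>laps \<inter> B. real (card {A \<in> active B J (Suc k). (G ^^ Suc k) ` A = M}))"
      by (simp del: active.simps funpow.simps)
    also have "(\<Sum>M\<in>laps \<inter> B. real (card {A \<in> active B J (Suc k). (G ^^ Suc k) ` A = M})) \<le> (\<Sum>M\<in>laps \<inter> B. \<mu> ^ Suc k)"
      by (intro sum_mono few) auto
    also have "\<dots> \<le> L * \<mu> ^ Suc k"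
      unfolding L_def using mu finite_laps by (simp add: card_mono mult_right_mono)
    also have "2 * real (card (active B J k)) \<le> 2 * (D * \<mu> ^ k)" using Suc by simp
    finally have "real (card (active B J (Suc k))) \<le> (2 * D + L * \<mu>) * \<mu> ^ k" by (simp add: algebra_simps)
    also have "\<dots> \<le> (D * \<mu>) * \<mu> ^ k" using D2 mu by (intro mult_right_mono) auto
    finally show ?case by (simp add: algebra_simps)
  qed
  define K' where "K' = real (card C) + L * K"
  have K': "0 \<le> K'" unfolding K'_def using L K by simp
  \<comment> \<open>Solves \<open>Q * \<mu> + D * K' = Q * \<Lambda>\<close>, which closes the
    induction on \<open>n\<close>; \<open>D * K'\<close> comes from the cost of one
    unfolding.\<close>
  define Q where "Q = D * K' / (\<Lambda> - \<mu>)"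
  have Q0: "0 \<le> Q" unfolding Q_def using D K' mu by simp
  have Q: "Q * \<mu> + D * K' = Q * \<Lambda>"
  proof -
    have "Q * (\<Lambda> - \<mu>) = D * K'" unfolding Q_def using mu by simp
    thus ?thesis by (simp add: algebra_simps)
  qed
  have S: "(\<Sum>A\<in>active B J k. real (card ((G ^^ k) ` A \<inter> T n))) \<le> Q * \<mu> ^ k * \<Lambda> ^ n" for k n
  proof (induction n arbitrary: k)
    case 0
    show ?case using Q0 mu by (simp add: T_def)
  next
    case (Suc n)
    have l1: "1 \<le> \<Lambda> ^ n" using mu by (intro one_le_power) auto
    have "(\<Sum>A\<in>active B J k. real (card ((G ^^ k) ` A \<inter> T (Suc n)))) \<le>
       (\<Sum>A\<in>active B J (Suc k). real (card ((G ^^ Suc k) ` A \<inter> T n))) +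
       real (card (active B J k)) * (real (card C) + real (card laps) * (K * \<Lambda> ^ n))"
      by (rule card_T_active[OF J small]) (use K mu in auto)
    also have "\<dots> \<le> Q * \<mu> ^ Suc k * \<Lambda> ^ n + (D * \<mu> ^ k) * (K' * \<Lambda> ^ n)"
    proof (intro add_mono mult_mono Suc a)
      show "real (card C) + real (card laps) * (K * \<Lambda> ^ n) \<le> K' * \<Lambda> ^ n"
        using mult_left_mono[OF l1, of "real (card C)"] unfolding K'_def L_def by (simp add: algebra_simps)
    qed (use D mu K in auto)
    also have "\<dots> = (Q * \<mu> + D * K') * \<mu> ^ k * \<Lambda> ^ n" by (simp add: algebra_simps)
    also have "\<dots> = Q * \<mu> ^ k * \<Lambda> ^ Suc n" unfolding Q by (simp add: algebra_simps)
    finally show ?case .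
  qed
  have "real (card (J \<inter> T n)) \<le> Q * \<Lambda> ^ n" for n using S[of 0 n] by simp
  thus ?thesis by blast
qed

end

subsection \<open>Horseshoes\<close>

definition branch :: "(real \<Rightarrow> real) \<Rightarrow> real set \<Rightarrow> real set \<Rightarrow> real set \<Rightarrow> bool" where
  "branch g J J' A \<longleftrightarrow> A \<subseteq> J \<and> is_interval A \<and> strictly_monotone g A \<and> g ` A = J'"

text \<open>With \<open>J' = J\<close> and at least two members this is a horseshoe.\<close>

definition branches :: "(real \<Rightarrow> real) \<Rightarrow> real set \<Rightarrow> real set \<Rightarrow> real set set \<Rightarrow> bool" where
  "branches g J J' \<A> \<longleftrightarrow> finite \<A> \<and> (\<forall>A\<in>\<A>. branch g J J' A) \<and> (\<forall>A\<in>\<A>. \<forall>A'\<in>\<A>. A \<noteq> A' \<longrightarrow> A \<inter> A' = {})"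

lemma branch_comp:
  assumes "branch g J J' A" "branch h J' J'' B"
  shows "branch (h \<circ> g) J J'' {x \<in> A. g x \<in> B}" "g ` {x \<in> A. g x \<in> B} = B"
proof -
  let ?D = "{x \<in> A. g x \<in> B}"
  show im: "g ` ?D = B" using assms unfolding branch_def by blast
  have "is_interval ?D"
    using assms unfolding branch_def by (intro is_interval_strictly_monotone_vimage) auto
  moreover have "strictly_monotone g ?D"
    using assms strictly_monotone_subset[of g A ?D] unfolding branch_def by blast
  hence "strictly_monotone (h \<circ> g) ?D"
    using strictly_monotone_comp[of g ?D h] assms im unfolding branch_def comp_def by auto
  moreover have "(h \<circ> g) ` ?D = J''" using im assms unfolding branch_def image_comp[symmetric] by simp
  ultimately show "branch (h \<circ> g) J J'' ?D" using assms unfolding branch_def by blast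
qed

text \<open>Pairs of branches give the branches of the composition, so the numbers multiply.
  \<open>J'' \<noteq> {}\<close> keeps the pulled-back pieces nonempty, hence distinct for distinct
  pairs.\<close>

lemma branches_comp:
  assumes a: "branches g J J' \<A>" and b: "branches h J' J'' \<B>" and ne: "J'' \<noteq> {}"
  shows "\<exists>\<D>. branches (h \<circ> g) J J'' \<D> \<and> card \<D> = card \<A> * card \<B>"
proof -
  define \<phi> where "\<phi> = (\<lambda>(A, B). {x \<in> A. g x \<in> B})"
  have br: "branch (h \<circ> g) J J'' (\<phi> p)" if "p \<in> \<A> \<times> \<B>" for p
    using branch_comp(1) a b that unfolding branches_def \<phi>_def by auto
  have ne': "\<phi> p \<noteq> {}" if "p \<in> \<A> \<times> \<B>" for p
    using br[OF that] ne unfolding branch_def by auto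
  have disj: "p = q" if "p \<in> \<A> \<times> \<B>" "q \<in> \<A> \<times> \<B>" "\<phi> p \<inter> \<phi> q \<noteq> {}" for p q
  proof -
    obtain A B A' B' where pq: "p = (A,B)" "q = (A',B')" by (cases p, cases q)
    obtain x where "x \<in> \<phi> p" "x \<in> \<phi> q" using \<open>\<phi> p \<inter> \<phi> q \<noteq> {}\<close> by blast
    hence "x \<in> A" "x \<in> A'" "g x \<in> B" "g x \<in> B'" unfolding pq \<phi>_def by auto
    thus ?thesis using that(1,2) a b unfolding branches_def pq by blast
  qed
  have "inj_on \<phi> (\<A> \<times> \<B>)"
    using disj ne' by (intro inj_onI) (metis Int_absorb)
  hence "card (\<phi> ` (\<A> \<times> \<B>)) = card \<A> * card \<B>" by (simp add: card_image card_cartesian_product)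
  moreover have "branches (h \<circ> g) J J'' (\<phi> ` (\<A> \<times> \<B>))"
    unfolding branches_def
  proof (intro conjI)
    show "finite (\<phi> ` (\<A> \<times> \<B>))" using a b unfolding branches_def by auto
    show "\<forall>A\<in>\<phi> ` (\<A> \<times> \<B>). branch (h \<circ> g) J J'' A" using br by blast
    show "\<forall>A\<in>\<phi> ` (\<A> \<times> \<B>). \<forall>A'\<in>\<phi> ` (\<A> \<times> \<B>). A \<noteq> A' \<longrightarrow> A \<inter> A' = {}"
      using disj by blast
  qed
  ultimately show ?thesis by blast
qed

context piecewise_monotone
begin

text \<open>Call a lap big if it contains too many turning points for growth rate \<open>\<Lambda>\<close>. The renewal bound
  gives from each big lap many branches onto another big lap; composing them around a cycle of big
  laps gives a horseshoe.\<close>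

lemma horseshoe_exists:
  assumes mu: "2 < \<mu>" "\<mu> < \<Lambda>"
    and big: "\<And>Q. \<exists>n. Q * \<Lambda> ^ n < real (card (T n))"
  shows "\<exists>J\<in>laps. \<exists>k\<ge>1. \<exists>\<A>. branches (G ^^ k) J J \<A> \<and> \<mu> ^ k \<le> real (card \<A>)"
proof -
  define B where "B = {M \<in> laps. \<forall>Q. \<exists>n. Q * \<Lambda> ^ n < real (card (M \<inter> T n))}"
  \<comment> \<open>An edge records a rate of at least \<open>ln \<mu>\<close> per step; composing
    branches preserves this rate, which makes \<open>R\<close> transitive on big laps.\<close>
  define R where "R J J' \<longleftrightarrow> (\<exists>k\<ge>1. \<exists>\<A>. branches (G ^^ k) J J' \<A> \<and> \<mu> ^ k \<le> real (card \<A>))" for J J'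
  have "\<forall>M\<in>laps - B. \<exists>Q. \<forall>n. real (card (M \<inter> T n)) \<le> Q * \<Lambda> ^ n"
    unfolding B_def using not_less by blast
  then obtain q where q: "\<And>M n. M \<in> laps - B \<Longrightarrow> real (card (M \<inter> T n)) \<le> q M * \<Lambda> ^ n" by metis
  define K where "K = (\<Sum>M\<in>laps. \<bar>q M\<bar>)"
  have K: "0 \<le> K" unfolding K_def by (simp add: sum_nonneg)
  have qK: "q M \<le> K" if "M \<in> laps" for M
    using member_le_sum[OF that, of "\<lambda>M. \<bar>q M\<bar>"] finite_laps unfolding K_def by auto
  have small: "real (card (M \<inter> T n)) \<le> K * \<Lambda> ^ n" if "M \<in> laps - B" for M n
  proof -
    have "q M * \<Lambda> ^ n \<le> K * \<Lambda> ^ n" using qK[of M] that mu by (intro mult_right_mono) auto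
    thus ?thesis using q[OF that, of n] by linarith
  qed
  \<comment> \<open>Without such an edge the hypothesis \<open>few\<close> of the renewal bound
    would hold at \<open>J\<close>, and \<open>J\<close> would not be big.\<close>
  have step: "\<exists>J'\<in>B. R J J'" if J: "J \<in> B" for J
  proof (rule ccontr)
    assume neg: "\<not> ?thesis"
    have Jl: "J \<in> laps" using J unfolding B_def by blast
    have "\<exists>Q. \<forall>n. real (card (J \<inter> T n)) \<le> Q * \<Lambda> ^ n"
    proof (rule renewal_bound[OF Jl mu K small])
      fix k M assume M: "M \<in> laps \<inter> B" and k: "1 \<le> (k::nat)"
      let ?A = "{A \<in> active B J k. (G ^^ k) ` A = M}"
      have "branches (G ^^ k) J M ?A"
        unfolding branches_def branch_def
      proof (intro conjI ballI impI)
        show "finite ?A" using finite_active by simp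
        fix A assume A: "A \<in> ?A"
        show "A \<subseteq> J" "is_interval A" "strictly_monotone (G ^^ k) A" "(G ^^ k) ` A = M"
          using activeD[OF Jl, of A B k] A by blast+
        fix A' assume "A' \<in> ?A" "A \<noteq> A'"
        thus "A \<inter> A' = {}" using active_disjoint[of A B J k A'] A by blast
      qed
      hence "\<not> \<mu> ^ k \<le> real (card ?A)" using neg M k unfolding R_def by blast
      thus "real (card ?A) \<le> \<mu> ^ k" by simp
    qed
    then obtain Q where Q: "\<And>n. real (card (J \<inter> T n)) \<le> Q * \<Lambda> ^ n" by blast
    obtain n where "Q * \<Lambda> ^ n < real (card (J \<inter> T n))" using J unfolding B_def by blast
    thus False using Q[of n] by simp
  qed
  have trans: "R x z" if "R x y" "R y z" "z \<in> B" for x y z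
  proof -
    obtain k \<A> where 1: "k \<ge> 1" "branches (G ^^ k) x y \<A>" "\<mu> ^ k \<le> real (card \<A>)" using \<open>R x y\<close> unfolding R_def by blast
    obtain l \<B> where 2: "l \<ge> 1" "branches (G ^^ l) y z \<B>" "\<mu> ^ l \<le> real (card \<B>)" using \<open>R y z\<close> unfolding R_def by blast
    have "z \<noteq> {}" using that(3) lapD(2) unfolding B_def by blast
    from branches_comp[OF 1(2) 2(2) this] obtain \<D> where
      D: "branches (G ^^ (l + k)) x z \<D>" "card \<D> = card \<A> * card \<B>" by (auto simp: funpow_add)
    have "\<mu> ^ (l + k) \<le> real (card \<D>)"
      using mult_mono[OF 1(3) 2(3)] mu unfolding D(2) by (simp add: power_add mult.commute)
    thus ?thesis unfolding R_def using D(1) 1(1) by (intro exI[of _ "l + k"]) auto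
  qed
  have "B \<noteq> {}"
  proof
    assume "B = {}"
    have "real (card (T n)) \<le> (real (card C) + real (card laps) * K) * \<Lambda> ^ n" for n
    proof -
      have "T n \<subseteq> C \<union> (\<Union>M\<in>laps. M \<inter> T n)" using laps_cover unfolding T_def by blast
      hence "card (T n) \<le> card (C \<union> (\<Union>M\<in>laps. M \<inter> T n))"
        using finite_C finite_laps finite_T by (intro card_mono) auto
      also have "\<dots> \<le> card C + card (\<Union>M\<in>laps. M \<inter> T n)" by (rule card_Un_le)
      also have "card (\<Union>M\<in>laps. M \<inter> T n) \<le> (\<Sum>M\<in>laps. card (M \<inter> T n))"
        using finite_laps by (rule card_UN_le)
      finally have "real (card (T n)) \<le> real (card C + (\<Sum>M\<in>laps. card (M \<inter> T n)))" by (rule of_nat_mono) simp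
      also have "\<dots> = real (card C) + (\<Sum>M\<in>laps. real (card (M \<inter> T n)))" by simp
      also have "\<dots> \<le> real (card C) * \<Lambda> ^ n + (\<Sum>M\<in>laps. K * \<Lambda> ^ n)"
      proof (intro add_mono sum_mono small)
        have "1 \<le> \<Lambda> ^ n" using mu by (intro one_le_power) auto
        thus "real (card C) \<le> real (card C) * \<Lambda> ^ n" by (simp add: mult_le_cancel_left1)
      qed (simp add: \<open>B = {}\<close>)
      finally show ?thesis by (simp add: algebra_simps)
    qed
    thus False using big not_less by blast
  qed
  \<comment> \<open>A transitive relation on a nonempty finite set in which every element has a
    successor cannot be irreflexive.\<close>
  have "\<exists>J\<in>B. R J J"
  proof (rule ccontr)
    assume neg: "\<not> ?thesis"
    define r where "r x y \<longleftrightarrow> x \<in> B \<and> y \<in> B \<and> R x y" for x y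
    have "finite B" unfolding B_def using finite_laps by auto
    hence "B = {}"
    proof (rule finite_transitivity_chain[where R = r])
      show "\<And>x. \<not> r x x" using neg unfolding r_def by blast
      show "\<And>x y z. r x y \<Longrightarrow> r y z \<Longrightarrow> r x z" using trans unfolding r_def by blast
      show "\<And>x. x \<in> B \<Longrightarrow> \<exists>y. y \<in> B \<and> r x y" using step unfolding r_def by blast
    qed
    thus False using \<open>B \<noteq> {}\<close> by blast
  qed
  thus ?thesis unfolding B_def R_def by blast
qed

end

subsection \<open>Turning points and separated sets\<close>

text \<open>For positive \<open>v\<close> and \<open>w\<close>: the endpoints and the critical
  points of \<open>f^m\<close>. Each step of \<open>f\<close> is two half-steps, hence the bound
  \<open>2 * m\<close>.\<close>

definition turning :: "real \<Rightarrow> real \<Rightarrow> nat \<Rightarrow> real set" where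
  "turning v w m = {x \<in> {0..1}. x = 0 \<or> x = 1 \<or> (\<exists>i<2 * m. alt_comp v w i x = 1/2)}"

lemma piecewise_monotone_iterate:
  assumes v: "v \<in> {0<..1}" "w \<in> {0<..1}"
  shows "piecewise_monotone ((quad w \<circ> quad v) ^^ m) (turning v w m)"
proof
  have G: "(quad w \<circ> quad v) ^^ m = alt_comp v w (2 * m)" by (simp add: alt_comp_even fun_eq_iff)
  show "continuous_on {0..1} ((quad w \<circ> quad v) ^^ m)" unfolding G by (rule continuous_on_alt_comp)
  show "((quad w \<circ> quad v) ^^ m) ` {0..1} \<subseteq> {0..1}"
    unfolding G using alt_comp_range[of v w] v by (auto simp del: atLeastAtMost_iff) (auto)
  have "turning v w m \<subseteq> {0, 1} \<union> (\<Union>i<2*m. {x. alt_comp v w i x = 1/2})" unfolding turning_def by auto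
  moreover have "finite \<dots>" using v by (intro finite_UnI finite_UN_I finite_alt_comp_vimage) auto
  ultimately show "finite (turning v w m)" by (rule finite_subset)
  show "0 \<in> turning v w m" "1 \<in> turning v w m" "turning v w m \<subseteq> {0..1}"
    unfolding turning_def by auto
  fix a b :: real assume ab: "0 \<le> a" "a < b" "b \<le> 1" "{a<..<b} \<inter> turning v w m = {}"
  show "strictly_monotone ((quad w \<circ> quad v) ^^ m) {a..b}"
    unfolding G
  proof (rule alt_comp_strictly_monotone_closed)
    fix i z assume "i < 2 * m" "a < z" "z < b"
    moreover from this ab have "z \<notin> turning v w m" by auto
    ultimately show "alt_comp v w i z \<noteq> 1/2" using ab unfolding turning_def by auto
  qed (use v ab in auto)
qed

text \<open>Dividing \<open>i\<close> by \<open>2 * m\<close> splits the half-steps into whole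
  iterates of \<open>f^m\<close> and a remainder, which is a time allowed in the definition of
  \<open>turning\<close>.\<close>

lemma turning_in_T:
  assumes v: "v \<in> {0<..1}" "w \<in> {0<..1}" and i: "i < 2 * (m * n)" "alt_comp v w i z = 1/2" "z \<in> {0..1}"
  shows "z \<in> piecewise_monotone.T ((quad w \<circ> quad v) ^^ m) (turning v w m) n"
proof -
  interpret piecewise_monotone "(quad w \<circ> quad v) ^^ m" "turning v w m"
    by (rule piecewise_monotone_iterate[OF v])
  have m: "0 < m" using i by (cases m) auto
  define j where "j = i div (2 * m)"
  have ij: "i = i mod (2 * m) + 2 * (m * j)" unfolding j_def by (simp add: mult.assoc[symmetric])
  have j: "j < n" unfolding j_def using i m by (simp add: less_mult_imp_div_less mult.commute mult.left_commute)
  have "alt_comp v w (i mod (2 * m)) (alt_comp v w (2 * (m * j)) z) = 1/2"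
    using i(2) ij alt_comp_add by metis
  hence "alt_comp v w (i mod (2 * m)) ((((quad w \<circ> quad v) ^^ m) ^^ j) z) = 1/2"
    by (simp add: alt_comp_even funpow_mult)
  moreover have "i mod (2 * m) < 2 * m" using m by simp
  ultimately have "(((quad w \<circ> quad v) ^^ m) ^^ j) z \<in> turning v w m"
    using iterate_maps[OF i(3), of j] unfolding turning_def by blast
  thus ?thesis unfolding T_def using i(3) j by blast
qed

text \<open>On a set where all iterates are monotone, the sum of the distances to the leftmost point
  over all times is monotone and increases by at least \<open>\<epsilon>\<close> between separated points.\<close>

lemma card_separated_monotone:
  assumes e: "0 < \<epsilon>" and E: "finite E" "E \<subseteq> {0..1}" "dyn_separated f n \<epsilon> E"
    and mono: "\<And>i x y. i < n \<Longrightarrow> x \<in> E \<Longrightarrow> y \<in> E \<Longrightarrow> x < y \<Longrightarrow> strictly_monotone (f ^^ i) {x..y}"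
    and maps: "\<And>i x. x \<in> {0..1} \<Longrightarrow> (f ^^ i) x \<in> {0..1}"
  shows "real (card E) \<le> real n / \<epsilon> + 1"
proof (cases "E = {}")
  case False
  define a where "a = Min E"
  have a: "a \<in> E" "\<And>x. x \<in> E \<Longrightarrow> a \<le> x" unfolding a_def using E False by auto
  define V where "V x = (\<Sum>i<n. \<bar>(f ^^ i) x - (f ^^ i) a\<bar>)" for x
  have V: "V x + \<epsilon> < V y" if xy: "x \<in> E" "y \<in> E" "x < y" for x y
  proof -
    have d: "\<bar>(f ^^ i) y - (f ^^ i) a\<bar> = \<bar>(f ^^ i) x - (f ^^ i) a\<bar> + \<bar>(f ^^ i) y - (f ^^ i) x\<bar>" if "i < n" for i
    proof (cases "x = a")
      case False
      hence ax: "a < x" using a(2)[OF xy(1)] by simp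
      obtain s where s: "s = 1 \<or> s = -1" "mono_dir s (f ^^ i) {a..y}"
        using mono[OF \<open>i < n\<close> a(1) xy(2)] ax xy unfolding strictly_monotone_def by auto
      have "0 < s * ((f ^^ i) x - (f ^^ i) a)" "0 < s * ((f ^^ i) y - (f ^^ i) x)"
        using s(2) ax xy(3) unfolding mono_dir_def by auto
      thus ?thesis using s(1) by auto
    qed simp
    obtain k where k: "k < n" "dist ((f ^^ k) x) ((f ^^ k) y) > \<epsilon>"
      using E(3) xy unfolding dyn_separated_def by (metis less_irrefl)
    have "\<epsilon> < \<bar>(f ^^ k) y - (f ^^ k) x\<bar>" using k(2) by (simp add: dist_real_def abs_minus_commute)
    also have "\<dots> \<le> (\<Sum>i<n. \<bar>(f ^^ i) y - (f ^^ i) x\<bar>)"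
      using k(1) by (intro member_le_sum) auto
    also have "\<dots> = V y - V x" unfolding V_def using d by (simp add: sum.distrib)
    finally show ?thesis by simp
  qed
  have V0: "0 \<le> V x" for x unfolding V_def by (simp add: sum_nonneg)
  have Vn: "V x \<le> real n" if "x \<in> E" for x
  proof -
    have "V x \<le> (\<Sum>i<n. 1)" unfolding V_def
    proof (intro sum_mono)
      fix i
      show "\<bar>(f ^^ i) x - (f ^^ i) a\<bar> \<le> 1"
        using maps[of x i] maps[of a i] subsetD[OF E(2) that] subsetD[OF E(2) a(1)] by (auto simp: abs_le_iff)
    qed
    thus ?thesis by simp
  qed
  \<comment> \<open>Rounding turns gaps larger than \<open>\<epsilon>\<close> in \<open>V\<close>
    into distinct integers between 0 and \<open>n / \<epsilon>\<close>.\<close>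
  define F where "F x = nat \<lfloor>V x / \<epsilon>\<rfloor>" for x
  have lt: "F x < F y" if xy: "x \<in> E" "y \<in> E" "x < y" for x y
  proof -
    have "(V x + \<epsilon>) / \<epsilon> \<le> V y / \<epsilon>" using V[OF xy] e by (intro divide_right_mono) auto
    hence "V x / \<epsilon> + 1 \<le> V y / \<epsilon>" using e by (simp add: add_divide_distrib)
    hence "\<lfloor>V x / \<epsilon>\<rfloor> + 1 \<le> \<lfloor>V y / \<epsilon>\<rfloor>" by linarith
    moreover have "0 \<le> \<lfloor>V x / \<epsilon>\<rfloor>" using V0[of x] e by simp
    ultimately show ?thesis unfolding F_def by linarith
  qed
  have "inj_on F E" by (rule inj_onI) (metis lt less_irrefl linorder_neqE_linordered_idom)
  moreover have "F ` E \<subseteq> {..nat \<lfloor>real n / \<epsilon>\<rfloor>}"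
    using Vn e unfolding F_def by (auto intro!: nat_mono floor_mono divide_right_mono)
  ultimately have "card E \<le> card {..nat \<lfloor>real n / \<epsilon>\<rfloor>}" by (intro card_inj_on_le) auto
  hence "real (card E) \<le> real (nat \<lfloor>real n / \<epsilon>\<rfloor>) + 1" by simp
  also have "real (nat \<lfloor>real n / \<epsilon>\<rfloor>) \<le> real n / \<epsilon>" using e by simp
  finally show ?thesis by simp
qed (use e in simp)

lemma exp_beats_linear:
  fixes d Q :: real assumes "0 < d"
  shows "\<exists>n0. \<forall>n\<ge>n0. Q * (c * real n + 1) < exp (d * real n)"
proof -
  define P where "P = \<bar>Q\<bar> * (\<bar>c\<bar> + 1)"
  \<comment> \<open>Chosen so that \<open>P * n \<le> (d * n)^2 / 2\<close>, the quadratic Taylor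
    term of \<open>exp (d * n)\<close>.\<close>
  obtain n0 :: nat where n0: "2 * P / d^2 < real n0" using reals_Archimedean2 by blast
  show ?thesis
  proof (intro exI[of _ "max 1 n0"] allI impI)
    fix n assume n: "max 1 n0 \<le> n"
    have "Q * (c * real n + 1) \<le> \<bar>Q * (c * real n + 1)\<bar>" by simp
    also have "\<dots> = \<bar>Q\<bar> * \<bar>c * real n + 1\<bar>" by (rule abs_mult)
    also have "\<dots> \<le> \<bar>Q\<bar> * ((\<bar>c\<bar> + 1) * real n)"
    proof (rule mult_left_mono)
      have "\<bar>c * real n + 1\<bar> \<le> \<bar>c\<bar> * real n + 1" using abs_triangle_ineq[of "c * real n" 1] by (simp add: abs_mult)
      thus "\<bar>c * real n + 1\<bar> \<le> (\<bar>c\<bar> + 1) * real n" using n by (simp add: algebra_simps)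
    qed simp
    also have "\<dots> = P * real n" unfolding P_def by simp
    also have "\<dots> \<le> (d^2 / 2 * real n) * real n"
    proof (rule mult_right_mono)
      have "2 * P / d^2 \<le> real n" using n0 n by linarith
      thus "P \<le> d^2 / 2 * real n" using assms by (simp add: field_simps)
    qed simp
    also have "\<dots> = (d * real n)^2 / 2" by (simp add: power2_eq_square)
    also have "\<dots> < 1 + d * real n + (d * real n)^2 / 2" using assms by (simp add: add_pos_nonneg)
    also have "\<dots> \<le> exp (d * real n)" using assms by (intro exp_lower_Taylor_quadratic) auto
    finally show "Q * (c * real n + 1) < exp (d * real n)" .
  qed
qed

text \<open>\<open>T r\<close> cuts the interval into at most \<open>card (T r) + 1\<close> classes
  on which the first \<open>n\<close> iterates are monotone, and a separated set has at most
  \<open>n / \<epsilon> + 1\<close> points in each. Slow growth of \<open>T\<close> would leave the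
  separated sets smaller than the entropy demands.\<close>

lemma entropy_turning_growth:
  assumes v: "v \<in> {0<..1}" "w \<in> {0<..1}" and m: "1 \<le> m" and b: "0 \<le> b'" "b' < b"
    and h: "ereal b < topological_entropy {0..1} (quad w \<circ> quad v)"
  shows "\<exists>n. Q * exp (b' * real m) ^ n < real (card (piecewise_monotone.T ((quad w \<circ> quad v) ^^ m) (turning v w m) n))"
proof (rule ccontr)
  interpret piecewise_monotone "(quad w \<circ> quad v) ^^ m" "turning v w m"
    by (rule piecewise_monotone_iterate[OF v])
  assume "\<not> ?thesis"
  hence Tn: "real (card (T n)) \<le> Q * exp (b' * real m) ^ n" for n by (simp add: not_less)
  let ?f = "quad w \<circ> quad v"
  obtain \<epsilon> where e: "0 < \<epsilon>" "\<And>n0. \<exists>n\<ge>n0. \<exists>E. finite E \<and> E \<subseteq> {0..1} \<and> dyn_separated ?f n \<epsilon> E \<and> exp (b * real n) < real (card E)"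
    using less_topological_entropy_separated[OF h] b by auto
  \<comment> \<open>Absorbs the rounding of \<open>n\<close> up to a multiple of \<open>m\<close>
    and the one additional class.\<close>
  define Q' where "Q' = \<bar>Q\<bar> * exp (b' * real m) + 1"
  obtain n0 where n0: "\<And>n. n \<ge> n0 \<Longrightarrow> Q' * (1/\<epsilon> * real n + 1) < exp ((b - b') * real n)"
    using exp_beats_linear[of "b - b'" Q' "1/\<epsilon>"] b by auto
  obtain n E where n: "n \<ge> n0" and E: "finite E" "E \<subseteq> {0..1}" "dyn_separated ?f n \<epsilon> E" "exp (b * real n) < real (card E)"
    using e(2) by blast
  define r where "r = n div m + 1"
  have r: "n \<le> m * r" "m * r \<le> n + m"
  proof -
    have "m * (n div m) + n mod m = n" "n mod m < m" using m by simp_all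
    thus "n \<le> m * r" "m * r \<le> n + m" unfolding r_def distrib_left by linarith+
  qed
  \<comment> \<open>Two points with equal \<open>\<rho>\<close> have no point of \<open>T r\<close>
    strictly between them.\<close>
  define \<rho> where "\<rho> x = card (T r \<inter> {..x})" for x
  have cls: "real (card {x \<in> E. \<rho> x = j}) \<le> real n / \<epsilon> + 1" for j
  proof (rule card_separated_monotone[OF e(1)])
    show "dyn_separated ?f n \<epsilon> {x \<in> E. \<rho> x = j}" using E(3) unfolding dyn_separated_def by blast
    show "(?f ^^ i) x \<in> {0..1}" if "x \<in> {0..1}" for i x
      using alt_comp_range[of v w x "2 * i"] v that by (simp add: alt_comp_even)
    fix i x y assume i: "i < n" and xy: "x \<in> {x \<in> E. \<rho> x = j}" "y \<in> {x \<in> E. \<rho> x = j}" "x < y"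
    have "T r \<inter> {..x} = T r \<inter> {..y}"
      using xy finite_T unfolding \<rho>_def by (intro card_subset_eq) auto
    hence noT: "z \<notin> T r" if "x < z" "z < y" for z using that by force
    have "strictly_monotone (alt_comp v w (2 * i)) {x..y}"
    proof (rule alt_comp_strictly_monotone_closed)
      fix l z assume l: "l < 2 * i" and z: "x < z" "z < y"
      have "z \<in> {0..1}" using xy z E(2) by fastforce
      moreover have "l < 2 * (m * r)" using l i r(1) by linarith
      ultimately show "alt_comp v w l z \<noteq> 1/2" using turning_in_T[OF v] noT[OF z] by blast
    qed (use v xy in auto)
    thus "strictly_monotone (?f ^^ i) {x..y}" by (simp add: alt_comp_even[abs_def])
  qed (use E in auto)
  have "\<rho> x \<le> card (T r)" for x unfolding \<rho>_def by (intro card_mono finite_T) auto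
  hence "E = (\<Union>j\<le>card (T r). {x \<in> E. \<rho> x = j})" by auto
  hence "card E \<le> (\<Sum>j\<le>card (T r). card {x \<in> E. \<rho> x = j})"
    using card_UN_le[of "{..card (T r)}" "\<lambda>j. {x \<in> E. \<rho> x = j}"] by simp
  hence "real (card E) \<le> real (\<Sum>j\<le>card (T r). card {x \<in> E. \<rho> x = j})" by (rule of_nat_mono)
  also have "\<dots> = (\<Sum>j\<le>card (T r). real (card {x \<in> E. \<rho> x = j}))" by simp
  also have "\<dots> \<le> (\<Sum>j\<le>card (T r). real n / \<epsilon> + 1)" by (intro sum_mono cls)
  also have "\<dots> = (real (card (T r)) + 1) * (1 / \<epsilon> * real n + 1)" by simp
  also have "\<dots> \<le> (Q' * exp (b' * real n)) * (1 / \<epsilon> * real n + 1)"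
  proof (rule mult_right_mono)
    have "real (card (T r)) \<le> Q * exp (b' * real (m * r))"
      using Tn[of r] by (simp add: exp_of_nat_mult[symmetric] mult.assoc mult.commute mult.left_commute)
    also have "\<dots> \<le> \<bar>Q\<bar> * exp (b' * real (n + m))"
      using r(2) b(1) by (intro mult_mono) (auto intro!: mult_left_mono simp del: of_nat_add of_nat_mult)
    also have "\<dots> = \<bar>Q\<bar> * exp (b' * real m) * exp (b' * real n)" by (simp add: algebra_simps exp_add)
    finally have "real (card (T r)) \<le> \<bar>Q\<bar> * exp (b' * real m) * exp (b' * real n)" .
    moreover have "1 \<le> exp (b' * real n)" using b by simp
    ultimately show "real (card (T r)) + 1 \<le> Q' * exp (b' * real n)" unfolding Q'_def distrib_right by linarith
  qed (use e in simp)
  also have "\<dots> = (Q' * (1 / \<epsilon> * real n + 1)) * exp (b' * real n)" by simp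
  also have "\<dots> \<le> exp ((b - b') * real n) * exp (b' * real n)"
    using n0[OF n] by (intro mult_right_mono) auto
  also have "\<dots> = exp (b * real n)" by (simp add: exp_add[symmetric] algebra_simps)
  finally show False using E(4) by simp
qed

subsection \<open>Orientation-reversing branches\<close>

text \<open>Since the quadratic maps are invariant under \<open>y \<mapsto> 1 - y\<close>, reflecting the image at time \<open>i\<close>
  of a branch gives a branch of the opposite sign, provided that the reflected image can be
  pulled back.\<close>

lemma reflect_branch:
  assumes H: "is_interval H" "strictly_monotone (alt_comp v w i) H" "A \<subseteq> H" and i: "i < n"
    and A: "is_interval A" "mono_dir s (alt_comp v w n) A"
    and refl: "\<And>x. x \<in> A \<Longrightarrow> 1 - alt_comp v w i x \<in> alt_comp v w i ` H"
  shows "\<exists>A'. A' \<subseteq> H \<and> is_interval A' \<and> mono_dir (- s) (alt_comp v w n) A' \<and> alt_comp v w n ` A' = alt_comp v w n ` A"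
proof -
  \<comment> \<open>The reflected image at time \<open>i\<close>; the new branch is its pullback to
    \<open>H\<close>.\<close>
  define I where "I = {y. 1 - y \<in> alt_comp v w i ` A}"
  define A' where "A' = {x \<in> H. alt_comp v w i x \<in> I}"
  have "is_interval (alt_comp v w i ` A)" using A by (intro is_interval_continuous_image continuous_on_alt_comp)
  hence "is_interval I" unfolding I_def is_interval_1 by force
  hence iv: "is_interval A'" unfolding A'_def using H by (intro is_interval_strictly_monotone_vimage)
  \<comment> \<open>Each point of \<open>A'\<close> has a partner in \<open>A\<close> with the
    mirror image at time \<open>i\<close>; the next quadratic map merges the two.\<close>
  have part: "\<exists>x0\<in>A. alt_comp v w i x0 = 1 - alt_comp v w i x \<and> alt_comp v w n x0 = alt_comp v w n x" if "x \<in> A'" for x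
  proof -
    have "1 - alt_comp v w i x \<in> alt_comp v w i ` A" using that unfolding A'_def I_def by simp
    then obtain x0 where x0: "x0 \<in> A" "1 - alt_comp v w i x = alt_comp v w i x0" by blast
    have "alt_comp v w (Suc i) x0 = alt_comp v w (Suc i) x" by (simp add: x0(2)[symmetric] quad_reflect)
    hence "alt_comp v w n x0 = alt_comp v w n x" by (rule alt_comp_split[OF Suc_leI[OF i]])
    thus ?thesis using x0 by auto
  qed
  obtain t where t: "t = 1 \<or> t = -1" "mono_dir t (alt_comp v w i) H" using H(2) unfolding strictly_monotone_def by auto
  have "mono_dir (- s) (alt_comp v w n) A'"
    unfolding mono_dir_def
  proof (intro ballI impI)
    fix x y assume xy: "x \<in> A'" "y \<in> A'" "x < y"
    obtain x0 where x0: "x0 \<in> A" "alt_comp v w i x0 = 1 - alt_comp v w i x" "alt_comp v w n x0 = alt_comp v w n x" using part xy by blast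
    obtain y0 where y0: "y0 \<in> A" "alt_comp v w i y0 = 1 - alt_comp v w i y" "alt_comp v w n y0 = alt_comp v w n y" using part xy by blast
    have p: "0 < t * (alt_comp v w i y - alt_comp v w i x)" using t(2) xy unfolding mono_dir_def A'_def by blast
    have "\<not> x0 < y0"
    proof
      assume "x0 < y0"
      hence "0 < t * (alt_comp v w i y0 - alt_comp v w i x0)" using t(2) x0 y0 H(3) unfolding mono_dir_def by blast
      thus False using p t(1) unfolding x0 y0 by auto
    qed
    moreover have "x0 \<noteq> y0" using p x0(2) y0(2) by auto
    ultimately have "y0 < x0" by simp
    hence "0 < s * (alt_comp v w n x0 - alt_comp v w n y0)" using A(2) x0 y0 unfolding mono_dir_def by blast
    thus "0 < - s * (alt_comp v w n y - alt_comp v w n x)" unfolding x0 y0 by (simp add: algebra_simps)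
  qed
  moreover have "alt_comp v w n ` A' = alt_comp v w n ` A"
  proof
    show "alt_comp v w n ` A' \<subseteq> alt_comp v w n ` A"
    proof
      fix y assume "y \<in> alt_comp v w n ` A'"
      then obtain x where x: "x \<in> A'" "y = alt_comp v w n x" by blast
      then obtain x0 where "x0 \<in> A" "alt_comp v w n x0 = y" using part by blast
      thus "y \<in> alt_comp v w n ` A" by blast
    qed
    show "alt_comp v w n ` A \<subseteq> alt_comp v w n ` A'"
    proof
      fix y assume "y \<in> alt_comp v w n ` A"
      then obtain x0 where x0: "x0 \<in> A" "y = alt_comp v w n x0" by blast
      obtain x where x: "x \<in> H" "1 - alt_comp v w i x0 = alt_comp v w i x" using refl[OF x0(1)] by blast
      have "1 - alt_comp v w i x = alt_comp v w i x0" using x(2) by simp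
      hence "1 - alt_comp v w i x \<in> alt_comp v w i ` A" using x0(1) by (rule image_eqI)
      hence "x \<in> A'" unfolding A'_def I_def using x(1) by simp
      moreover have "alt_comp v w (Suc i) x = alt_comp v w (Suc i) x0" by (simp add: x(2)[symmetric] quad_reflect)
      hence "alt_comp v w n x = alt_comp v w n x0" by (rule alt_comp_split[OF Suc_leI[OF i]])
      hence "alt_comp v w n x = y" using x0(2) by simp
      ultimately show "y \<in> alt_comp v w n ` A'" by blast
    qed
  qed
  moreover have "A' \<subseteq> H" unfolding A'_def by blast
  ultimately show ?thesis using iv by blast
qed

lemma is_intervalD: "is_interval (A :: real set) \<Longrightarrow> x \<in> A \<Longrightarrow> y \<in> A \<Longrightarrow> x \<le> z \<Longrightarrow> z \<le> y \<Longrightarrow> z \<in> A"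
  unfolding is_interval_1 by blast

text \<open>The values halfway between \<open>g z\<close> and the ends of the image are attained, at
  points on either side of \<open>z\<close>.\<close>

lemma mono_branch_open:
  assumes "strictly_monotone g A" "g ` A = {a<..<b}" "z \<in> A"
  shows "\<exists>x\<in>A. \<exists>y\<in>A. x < z \<and> z < y"
proof -
  have gz: "a < g z" "g z < b" using assms by auto
  have surj: "\<exists>x\<in>A. u = g x" if "a < u" "u < b" for u
    using that assms(2) greaterThanLessThan_iff[of u a b] by (metis imageE)
  obtain x where x: "x \<in> A" "g x = (a + g z) / 2" using surj[of "(a + g z) / 2"] gz by auto
  obtain y where y: "y \<in> A" "g y = (g z + b) / 2" using surj[of "(g z + b) / 2"] gz by auto
  have lt: "g x < g z" "g z < g y" using x y gz by auto
  obtain s where s: "s = 1 \<or> s = -1" "mono_dir s g A" using assms(1) unfolding strictly_monotone_def by auto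
  have xz: "x < z \<Longrightarrow> 0 < s * (g z - g x)" "z < x \<Longrightarrow> 0 < s * (g x - g z)"
    and yz: "y < z \<Longrightarrow> 0 < s * (g z - g y)" "z < y \<Longrightarrow> 0 < s * (g y - g z)"
    using s(2) x y assms(3) unfolding mono_dir_def by blast+
  have ne: "x \<noteq> z" "y \<noteq> z" using lt by auto
  show ?thesis
  proof (cases "s = 1")
    case True
    hence "x < z" "z < y" using xz(2) yz(1) ne lt by force+
    thus ?thesis using x y by blast
  next
    case False
    hence "s = -1" using s(1) by simp
    hence "z < x" "y < z" using xz(1) yz(2) ne lt by force+
    thus ?thesis using x y by blast
  qed
qed

text \<open>Consider the first time at which the images of the two branches are on different sides of
  the critical point: the image lying closer to the critical point can be reflected.\<close>

lemma opposite_branch: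
  assumes v: "0 < v" "0 < w" and J: "J = {a<..<b}" "a < b"
    and A1: "A1 \<subseteq> J" "is_interval A1" "mono_dir s (alt_comp v w n) A1" "alt_comp v w n ` A1 = J"
    and A2: "A2 \<subseteq> J" "is_interval A2" "mono_dir s (alt_comp v w n) A2" "alt_comp v w n ` A2 = J"
    and s: "s \<in> {1,-1}" and disj: "A1 \<inter> A2 = {}"
  shows "\<exists>A. A \<subseteq> J \<and> is_interval A \<and> mono_dir (- s) (alt_comp v w n) A \<and> alt_comp v w n ` A = J"
proof -
  \<comment> \<open>The convex hull of the two branches. As they have the same image,
    \<open>alt_comp v w n\<close> is not injective on it, so some half-step before \<open>n\<close>
    hits 1/2 there.\<close>
  define H where "H = {x. \<exists>p\<in>A1 \<union> A2. \<exists>q\<in>A1 \<union> A2. p \<le> x \<and> x \<le> q}"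
  have Hi: "is_interval H" unfolding H_def is_interval_1 by (blast intro: order_trans)
  have AH: "A1 \<subseteq> H" "A2 \<subseteq> H" unfolding H_def by auto
  have HJ: "H \<subseteq> J" using A1(1) A2(1) unfolding H_def J(1) by fastforce
  have sm: "strictly_monotone (alt_comp v w n) A1" "strictly_monotone (alt_comp v w n) A2"
    using A1 A2 s strictly_monotoneI by blast+
  have "\<exists>i<n. \<exists>z\<in>H. alt_comp v w i z = 1/2"
  proof (rule ccontr)
    assume "\<not> ?thesis"
    hence inj: "inj_on (alt_comp v w n) H" using v Hi by (intro strictly_monotone_inj alt_comp_strictly_monotone) auto
    obtain y where "y \<in> J" using J dense by auto
    then obtain x1 x2 where "x1 \<in> A1" "x2 \<in> A2" "alt_comp v w n x1 = alt_comp v w n x2" using A1(4) A2(4) by (metis imageE)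
    thus False using inj AH disj unfolding inj_on_def by blast
  qed
  hence ex: "\<exists>i. i < n \<and> (\<exists>z\<in>H. alt_comp v w i z = 1/2)" by blast
  define i where "i = (LEAST i. i < n \<and> (\<exists>z\<in>H. alt_comp v w i z = 1/2))"
  have i: "i < n" "\<exists>z\<in>H. alt_comp v w i z = 1/2" using LeastI_ex[OF ex] unfolding i_def by auto
  have "alt_comp v w j z \<noteq> 1/2" if "j < i" "z \<in> H" for j z
    using not_less_Least[of j "\<lambda>i. i < n \<and> (\<exists>z\<in>H. alt_comp v w i z = 1/2)"] that i(1) unfolding i_def[symmetric] by auto
  hence smH: "strictly_monotone (alt_comp v w i) H" using v Hi by (intro alt_comp_strictly_monotone) auto
  obtain z where z: "z \<in> H" "alt_comp v w i z = 1/2" using i(2) by blast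
  \<comment> \<open>If a branch itself hit 1/2 at time \<open>i\<close>, its image would contain
    points symmetric about 1/2; the next map merges them, against injectivity. The branch has points
    on both sides of \<open>c\<close> because its final image is open.\<close>
  have half: "1/2 \<notin> alt_comp v w i ` A" if A: "A \<subseteq> H" "is_interval A" "strictly_monotone (alt_comp v w n) A" "alt_comp v w n ` A = J" for A
  proof
    let ?I = "alt_comp v w i ` A"
    assume "1/2 \<in> ?I"
    then obtain c where c: "c \<in> A" "alt_comp v w i c = 1/2" by auto
    have norefl: "y = 1/2" if y: "y \<in> ?I" "1 - y \<in> ?I" for y
    proof -
      obtain x x' where x: "x \<in> A" "y = alt_comp v w i x" "x' \<in> A" "1 - y = alt_comp v w i x'" using y by blast
      have "alt_comp v w (Suc i) x' = alt_comp v w (Suc i) x" by (simp add: x(4)[symmetric] x(2) quad_reflect)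
      hence "alt_comp v w n x' = alt_comp v w n x" by (rule alt_comp_split[OF Suc_leI[OF i(1)]])
      hence "x' = x" using strictly_monotone_inj[OF A(3)] x unfolding inj_on_def by blast
      thus ?thesis using x by simp
    qed
    have iv: "is_interval ?I" using A by (intro is_interval_continuous_image continuous_on_alt_comp)
    have both: "\<exists>u\<in>?I. \<exists>u'\<in>?I. u < 1/2 \<and> 1/2 < u'"
    proof -
      obtain x y where xy: "x \<in> A" "y \<in> A" "x < c" "c < y" using mono_branch_open[OF A(3)] A(4) J(1) c(1) by blast
      obtain t where t: "t = 1 \<or> t = -1" "mono_dir t (alt_comp v w i) H" using smH unfolding strictly_monotone_def by auto
      have "0 < t * (alt_comp v w i c - alt_comp v w i x)" "0 < t * (alt_comp v w i y - alt_comp v w i c)"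
        using t(2) xy c(1) A(1) unfolding mono_dir_def by blast+
      hence "(alt_comp v w i x < 1/2 \<and> 1/2 < alt_comp v w i y) \<or> (alt_comp v w i y < 1/2 \<and> 1/2 < alt_comp v w i x)"
        using t(1) unfolding c(2) by auto
      thus ?thesis using xy by blast
    qed
    then obtain u u' where u: "u \<in> ?I" "u' \<in> ?I" "u < 1/2" "1/2 < u'" by blast
    define e where "e = min (1/2 - u) (u' - 1/2)"
    have e: "0 < e" "u \<le> 1/2 - e" "1/2 + e \<le> u'" unfolding e_def using u by auto
    have "1/2 - e \<in> ?I" "1/2 + e \<in> ?I"
      using e u(3,4) by (auto intro!: is_intervalD[OF iv u(1,2)])
    thus False using norefl[of "1/2 - e"] e(1) by simp
  qed
  define K where "K = alt_comp v w i ` H"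
  have Ki: "is_interval K" unfolding K_def using Hi by (intro is_interval_continuous_image continuous_on_alt_comp)
  have side: "alt_comp v w i ` A \<subseteq> {..<1/2} \<or> alt_comp v w i ` A \<subseteq> {1/2<..}" if "A = A1 \<or> A = A2" for A
  proof (rule is_interval_one_sided)
    show "is_interval (alt_comp v w i ` A)" using that A1 A2 by (intro is_interval_continuous_image continuous_on_alt_comp) auto
    show "1/2 \<notin> alt_comp v w i ` A" using half[of A] that A1 A2 sm AH by auto
  qed
  \<comment> \<open>\<open>z\<close> lies between points of the branches and is sent to 1/2, so the
    images cannot share a side.\<close>
  have not_same: "\<not> alt_comp v w i ` (A1 \<union> A2) \<subseteq> S" if "is_interval S" "1/2 \<notin> S" for S
  proof
    assume S: "alt_comp v w i ` (A1 \<union> A2) \<subseteq> S"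
    obtain p q where pq: "p \<in> A1 \<union> A2" "q \<in> A1 \<union> A2" "p \<le> z" "z \<le> q" using z unfolding H_def by blast
    have "alt_comp v w i z \<in> S"
      using strictly_monotone_between[OF smH _ _ z(1) pq(3,4) that(1)] pq(1,2) AH S by blast
    thus False using z that by simp
  qed
  have step: "\<exists>A. A \<subseteq> J \<and> is_interval A \<and> mono_dir (- s) (alt_comp v w n) A \<and> alt_comp v w n ` A = J"
    if A: "A = A1 \<or> A = A2" and r: "\<And>x. x \<in> A \<Longrightarrow> 1 - alt_comp v w i x \<in> alt_comp v w i ` H" for A
  proof -
    have "A \<subseteq> H" "is_interval A" "mono_dir s (alt_comp v w n) A" "alt_comp v w n ` A = J" using A A1 A2 AH by auto
    from reflect_branch[OF Hi smH this(1) i(1) this(2,3) r] this(4) HJ show ?thesis by auto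
  qed
  \<comment> \<open>Of two values on opposite sides of 1/2, the mirror image of the nearer one lies
    between them and hence in \<open>K\<close>. So the reflections of both branches cannot
    fail.\<close>
  have core: "(\<forall>x\<in>A. 1 - alt_comp v w i x \<in> K) \<or> (\<forall>x\<in>A'. 1 - alt_comp v w i x \<in> K)"
    if "A \<subseteq> H" "A' \<subseteq> H" and l: "alt_comp v w i ` A \<subseteq> {..<1/2}" "alt_comp v w i ` A' \<subseteq> {1/2<..}" for A A'
  proof (rule ccontr)
    assume "\<not> ?thesis"
    then obtain x x' where x: "x \<in> A" "1 - alt_comp v w i x \<notin> K" and x': "x' \<in> A'" "1 - alt_comp v w i x' \<notin> K" by blast
    let ?y = "alt_comp v w i x" and ?y' = "alt_comp v w i x'"
    have y: "?y \<in> K" "?y' \<in> K" "?y < 1/2" "1/2 < ?y'" using x x' that unfolding K_def by auto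
    show False
    proof (cases "1 - ?y \<le> ?y'")
      case True
      hence "1 - ?y \<in> K" using y(3) by (intro is_intervalD[OF Ki y(1,2)]) auto
      thus False using x by simp
    next
      case False
      hence "1 - ?y' \<in> K" using y(4) by (intro is_intervalD[OF Ki y(1,2)]) auto
      thus False using x' by simp
    qed
  qed
  have "(\<forall>x\<in>A1. 1 - alt_comp v w i x \<in> K) \<or> (\<forall>x\<in>A2. 1 - alt_comp v w i x \<in> K)"
  proof (cases "alt_comp v w i ` A1 \<subseteq> {..<1/2}")
    case True
    hence "\<not> alt_comp v w i ` A2 \<subseteq> {..<1/2}"
      using not_same[OF is_interval_io, of "1/2"] unfolding image_Un by simp
    hence "alt_comp v w i ` A2 \<subseteq> {1/2<..}" using side[of A2] by simp
    from core[OF AH True this] show ?thesis .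
  next
    case False
    hence l: "alt_comp v w i ` A1 \<subseteq> {1/2<..}" using side[of A1] by simp
    hence "\<not> alt_comp v w i ` A2 \<subseteq> {1/2<..}"
      using not_same[OF is_interval_oi, of "1/2"] unfolding image_Un by simp
    hence "alt_comp v w i ` A2 \<subseteq> {..<1/2}" using side[of A2] by simp
    from core[OF AH(2,1) this l] show ?thesis by (rule disj_commute[THEN iffD1])
  qed
  thus ?thesis
  proof
    assume "\<forall>x\<in>A1. 1 - alt_comp v w i x \<in> K"
    thus ?thesis using step[of A1] unfolding K_def by simp
  next
    assume "\<forall>x\<in>A2. 1 - alt_comp v w i x \<in> K"
    thus ?thesis using step[of A2] unfolding K_def by simp
  qed
qed

lemma both_signs:
  assumes v: "0 < v" "0 < w" and J: "J = {a<..<b}" "a < b"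
    and br: "branches (alt_comp v w n) J J \<A>" "2 \<le> card \<A>" and s: "s \<in> {1,-1}"
  shows "\<exists>A. A \<subseteq> J \<and> is_interval A \<and> mono_dir s (alt_comp v w n) A \<and> alt_comp v w n ` A = J"
proof -
  obtain A1 A2 where A: "A1 \<in> \<A>" "A2 \<in> \<A>" "A1 \<noteq> A2"
    using br(2) by (metis One_nat_def card_le_Suc0_iff_eq not_less_eq_eq numeral_2_eq_2 br(1) branches_def)
  have b: "branch (alt_comp v w n) J J A1" "branch (alt_comp v w n) J J A2" and d: "A1 \<inter> A2 = {}"
    using A br(1) unfolding branches_def by auto
  obtain s1 where s1: "s1 \<in> {1,-1}" "mono_dir s1 (alt_comp v w n) A1" using b(1) unfolding branch_def strictly_monotone_def by blast
  obtain s2 where s2: "s2 \<in> {1,-1}" "mono_dir s2 (alt_comp v w n) A2" using b(2) unfolding branch_def strictly_monotone_def by blast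
  show ?thesis
  proof (cases "s1 = s \<or> s2 = s")
    case True
    thus ?thesis using b s1 s2 unfolding branch_def by blast
  next
    case False
    hence "s1 = - s" "s2 = - s" using s s1(1) s2(1) by auto
    thus ?thesis using opposite_branch[OF v J, of A1 "- s" n A2] b s1 s2 d unfolding branch_def by auto
  qed
qed

text \<open>Since \<open>g\<close> is decreasing, values close to the two ends of the interval give
  points with \<open>p \<le> g p\<close> and with \<open>g p \<le> p\<close>. An increasing branch
  onto an open interval may have its only fixed point at an excluded end.\<close>

lemma decreasing_branch_fixed_point:
  assumes g: "continuous_on A g" and A: "A \<subseteq> {a<..<b}" "is_interval A" "mono_dir (-1) g A" "g ` A = {a<..<b}" "a < b"
  shows "\<exists>x\<in>A. g x = x"
proof -
  obtain p0 where p0: "p0 \<in> A" using A(4,5) dense[of a b] by (metis equals0I greaterThanLessThan_iff image_empty)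
  have p0': "a < p0" "p0 < b" using A(1) p0 by auto
  have dec: "x < y \<Longrightarrow> g y < g x" if "x \<in> A" "y \<in> A" for x y using A(3) that unfolding mono_dir_def by fastforce
  have surj: "\<exists>x\<in>A. g x = y" if "a < y" "y < b" for y
  proof -
    have "y \<in> g ` A" using A(4) that by simp
    thus ?thesis by blast
  qed
  have "\<exists>p\<in>A. p \<le> g p"
  proof (rule ccontr)
    assume neg: "\<not> ?thesis"
    obtain p where p: "p \<in> A" "g p = (p0 + b) / 2" using surj[of "(p0 + b) / 2"] p0' by auto
    have "g p0 < g p" using neg p0 p p0' by force
    hence "p < p0" using dec[OF p0 p(1)] by (metis less_asym linorder_neqE_linordered_idom less_irrefl)
    thus False using neg p p0' by force
  qed
  moreover have "\<exists>p\<in>A. g p \<le> p"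
  proof (rule ccontr)
    assume neg: "\<not> ?thesis"
    obtain p where p: "p \<in> A" "g p = (a + p0) / 2" using surj[of "(a + p0) / 2"] p0' by auto
    have "g p < g p0" using neg p0 p p0' by force
    hence "p0 < p" using dec[OF p(1) p0] by (metis less_asym linorder_neqE_linordered_idom less_irrefl)
    thus False using neg p p0' by force
  qed
  moreover have "is_interval ((\<lambda>x. g x - x) ` A)"
    using g A(2) by (intro is_interval_continuous_image continuous_intros)
  ultimately have "0 \<in> (\<lambda>x. g x - x) ` A" unfolding is_interval_1 by force
  thus ?thesis by auto
qed

lemma branches_power:
  assumes br: "branches g J J \<A>" and J: "is_interval J" "J \<noteq> {}"
  shows "\<exists>\<B>. branches (g ^^ j) J J \<B> \<and> card \<B> = card \<A> ^ j"
proof (induction j)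
  case 0
  have "strictly_monotone id J" by (rule strictly_monotoneI[of 1]) (auto simp: mono_dir_def)
  hence "branches (g ^^ 0) J J {J}" unfolding branches_def branch_def using J by auto
  moreover have "card {J} = card \<A> ^ 0" by simp
  ultimately show ?case by blast
next
  case (Suc j)
  then obtain \<B> where B: "branches (g ^^ j) J J \<B>" "card \<B> = card \<A> ^ j" by blast
  from branches_comp[OF B(1) br J(2)] B(2) show ?case by (auto simp: mult.commute comp_def)
qed

text \<open>Each branch of the \<open>j\<close>-th power is followed by a branch of one further copy
  of the map, with the sign that makes the total decreasing. This copy only corrects the sign, hence
  \<open>Suc j\<close> in the time but \<open>j\<close> in the count.\<close>

lemma decreasing_branches:
  assumes v: "0 < v" "0 < w" and J: "J = {a<..<b}" "a < b"
    and br: "branches (alt_comp v w (2 * k)) J J \<A>" "2 \<le> card \<A>"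
  shows "\<exists>\<D>. finite \<D> \<and> card \<D> = card \<A> ^ j \<and> (\<forall>A\<in>\<D>. \<forall>A'\<in>\<D>. A \<noteq> A' \<longrightarrow> A \<inter> A' = {}) \<and>
    (\<forall>A\<in>\<D>. A \<subseteq> J \<and> is_interval A \<and> mono_dir (-1) (alt_comp v w (2 * (k * Suc j))) A \<and> alt_comp v w (2 * (k * Suc j)) ` A = J)"
proof -
  let ?g = "alt_comp v w (2 * k)" and ?h = "alt_comp v w (2 * (k * j))"
  have Jne: "is_interval J" "J \<noteq> {}" using J by (auto simp: is_interval_oo)
  have pw: "?g ^^ j = ?h" by (simp add: alt_comp_even[abs_def] funpow_mult)
  obtain \<B> where B: "branches ?h J J \<B>" "card \<B> = card \<A> ^ j"
    using branches_power[OF br(1) Jne, of j] unfolding pw by blast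
  have cf: "alt_comp v w (2 * (k * Suc j)) = (\<lambda>x. ?g (?h x))"
    using alt_comp_add[of v w "2 * k" "k * j"] by (simp add: fun_eq_iff)
  have ex: "\<exists>D\<subseteq>A. is_interval D \<and> mono_dir (-1) (alt_comp v w (2 * (k * Suc j))) D \<and> alt_comp v w (2 * (k * Suc j)) ` D = J"
    if A: "A \<in> \<B>" for A
  proof -
    have bA: "branch ?h J J A" using B(1) A unfolding branches_def by blast
    then obtain s where s: "s \<in> {1,-1}" "mono_dir s ?h A" unfolding branch_def strictly_monotone_def by blast
    hence "- s \<in> {1,-1}" by auto
    from both_signs[OF v J br this] obtain D0 where D0: "D0 \<subseteq> J" "is_interval D0" "mono_dir (- s) ?g D0" "?g ` D0 = J" by blast
    have "branch ?g J J D0" unfolding branch_def using D0 s strictly_monotoneI[OF D0(3)] by auto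
    note bc = branch_comp[OF bA this]
    let ?D = "{x \<in> A. ?h x \<in> D0}"
    have "mono_dir (s * - s) (\<lambda>x. ?g (?h x)) ?D"
      by (rule mono_dir_comp) (use s D0(3) bc(2) mono_dir_subset[OF s(2), of ?D] in auto)
    moreover have "s * - s = -1" using s by auto
    ultimately have "mono_dir (-1) (alt_comp v w (2 * (k * Suc j))) ?D" unfolding cf by simp
    moreover have "alt_comp v w (2 * (k * Suc j)) ` ?D = J" "is_interval ?D"
      using bc(1) unfolding branch_def cf comp_def by simp_all
    moreover have "?D \<subseteq> A" by blast
    ultimately show ?thesis by blast
  qed
  then obtain D where D: "\<And>A. A \<in> \<B> \<Longrightarrow> D A \<subseteq> A" "\<And>A. A \<in> \<B> \<Longrightarrow> is_interval (D A)"
    "\<And>A. A \<in> \<B> \<Longrightarrow> mono_dir (-1) (alt_comp v w (2 * (k * Suc j))) (D A)" "\<And>A. A \<in> \<B> \<Longrightarrow> alt_comp v w (2 * (k * Suc j)) ` D A = J"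
    by metis
  have ne: "D A \<noteq> {}" if "A \<in> \<B>" for A using D(4)[OF that] Jne by auto
  have eq: "A = A'" if "A \<in> \<B>" "A' \<in> \<B>" "D A \<inter> D A' \<noteq> {}" for A A'
    using D(1)[OF that(1)] D(1)[OF that(2)] that B(1) unfolding branches_def by blast
  have "inj_on D \<B>"
  proof (rule inj_onI)
    fix A A' assume "A \<in> \<B>" "A' \<in> \<B>" "D A = D A'"
    thus "A = A'" using eq[of A A'] ne[of A] by simp
  qed
  hence "card (D ` \<B>) = card \<A> ^ j" using B(2) by (simp add: card_image)
  moreover have "D A \<subseteq> J" if A: "A \<in> \<B>" for A
  proof -
    have "branch ?h J J A" using B(1) A unfolding branches_def by (elim conjE) (rule bspec)
    hence "A \<subseteq> J" unfolding branch_def by (elim conjE)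
    thus ?thesis using D(1)[OF A] by (rule subset_trans[rotated])
  qed
  moreover have "finite (D ` \<B>)" using B(1) unfolding branches_def by simp
  moreover have "\<forall>A\<in>D ` \<B>. \<forall>A'\<in>D ` \<B>. A \<noteq> A' \<longrightarrow> A \<inter> A' = {}" using eq by blast
  ultimately show ?thesis using D(2-4)
    by (intro exI[of _ "D ` \<B>"]) (simp del: mult_Suc_right)
qed

subsection \<open>Fixed points on decreasing branches\<close>

text \<open>The chain rule product. At a fixed point and with \<open>n = 2 * k\<close> it is the
  multiplier of \<open>f^k\<close>; for positive parameters it vanishes exactly when some half-step
  before \<open>n\<close> hits 1/2.\<close>

definition alt_deriv :: "real \<Rightarrow> real \<Rightarrow> nat \<Rightarrow> real \<Rightarrow> real" where
  "alt_deriv v w n x = (\<Prod>i<n. 4 * (if even i then v else w) * (1 - 2 * alt_comp v w i x))"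

lemma DERIV_alt_comp: "(alt_comp v w n has_real_derivative alt_deriv v w n x) (at x)"
proof (induction n)
  case 0
  have "alt_comp v w 0 = (\<lambda>x. x)" by (rule ext) simp
  thus ?case by (simp add: alt_deriv_def)
next
  case (Suc n)
  show ?case unfolding alt_comp.simps quad_def alt_deriv_def
    by (rule derivative_eq_intros Suc refl)+ (simp add: alt_deriv_def algebra_simps)
qed

lemma alt_deriv_nonpos:
  assumes A: "is_interval A" "mono_dir (-1) (alt_comp v w n) A" "x \<in> A" "y \<in> A" "x \<noteq> y"
  shows "alt_deriv v w n x \<le> 0"
proof (rule ccontr)
  assume "\<not> ?thesis"
  hence pos: "0 < alt_deriv v w n x" by simp
  obtain d1 where d1: "0 < d1" "\<And>h. 0 < h \<Longrightarrow> h < d1 \<Longrightarrow> alt_comp v w n x < alt_comp v w n (x + h)"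
    using DERIV_pos_inc_right[OF DERIV_alt_comp pos] by blast
  obtain d2 where d2: "0 < d2" "\<And>h. 0 < h \<Longrightarrow> h < d2 \<Longrightarrow> alt_comp v w n (x - h) < alt_comp v w n x"
    using DERIV_pos_inc_left[OF DERIV_alt_comp pos] by blast
  have dec: "alt_comp v w n q < alt_comp v w n p" if "p \<in> A" "q \<in> A" "p < q" for p q
    using A(2) that unfolding mono_dir_def by fastforce
  show False
  proof (cases "x < y")
    case True
    define h where "h = min (d1 / 2) (y - x)"
    have h: "0 < h" "h < d1" "x + h \<le> y" unfolding h_def using d1 True by auto
    have "x + h \<in> A" using h by (intro is_intervalD[OF A(1,3,4)]) auto
    thus False using d1(2)[of h] dec[of x "x + h"] h A(3) by simp
  next
    case False
    define h where "h = min (d2 / 2) (x - y)"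
    have h: "0 < h" "h < d2" "y \<le> x - h" unfolding h_def using d2 False A(5) by auto
    have "x - h \<in> A" using h by (intro is_intervalD[OF A(1,4,3)]) auto
    thus False using d2(2)[of h] dec[of "x - h" x] h A(3) by simp
  qed
qed

lemma entropy_fixed_points_lower:
  assumes v: "v \<in> {0<..1}" "w \<in> {0<..1}" and a: "0 < a"
    and h: "ereal a < topological_entropy {0..1} (quad w \<circ> quad v)"
  shows "\<exists>c>0. \<forall>K. \<exists>k\<ge>K. \<exists>Z. finite Z \<and> Z \<subseteq> {0..1} \<and> c * exp (a * real k) \<le> real (card Z) \<and>
     (\<forall>x\<in>Z. alt_comp v w (2 * k) x = x \<and> alt_deriv v w (2 * k) x \<le> 0)"
proof -
  obtain b where b: "a < b" "ereal b < topological_entropy {0..1} (quad w \<circ> quad v)"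
    using ereal_dense2[OF h] by auto
  \<comment> \<open>Two gaps are used: \<open>a < b'\<close> separates \<open>\<mu>\<close> from
    \<open>\<Lambda>\<close> in the horseshoe lemma, \<open>b' < b\<close> separates the growth of
    turning points from the entropy.\<close>
  obtain b' where b': "a < b'" "b' < b" using b(1) dense by blast
  \<comment> \<open>Makes \<open>\<mu> = exp (a * m)\<close> exceed 2, as the renewal bound
    demands.\<close>
  obtain m :: nat where m: "ln 2 / a < real m" using reals_Archimedean2 by blast
  have m1: "1 \<le> m" using m a by (metis One_nat_def Suc_leI divide_pos_pos gr0I ln_gt_zero of_nat_0 one_less_numeral_iff order_less_asym semiring_norm(76))
  interpret piecewise_monotone "(quad w \<circ> quad v) ^^ m" "turning v w m"
    by (rule piecewise_monotone_iterate[OF v])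
  define \<mu> where "\<mu> = exp (a * real m)"
  have "ln 2 < a * real m" using m a by (simp add: field_simps)
  hence "exp (ln 2) < \<mu>" unfolding \<mu>_def by (rule exp_less_mono)
  hence mu2: "2 < \<mu>" by simp
  have muL: "\<mu> < exp (b' * real m)" unfolding \<mu>_def using b' m1 by simp
  obtain J \<kappa> \<A> where J: "J \<in> laps" and k: "1 \<le> \<kappa>" and br: "branches (((quad w \<circ> quad v) ^^ m) ^^ \<kappa>) J J \<A>"
    and card: "\<mu> ^ \<kappa> \<le> real (card \<A>)"
    using horseshoe_exists[OF mu2 muL entropy_turning_growth[OF v m1 _ b'(2) b(2)]] a b' by force
  obtain p q where pq: "J = {p<..<q}" "p < q" using J unfolding laps_def by blast
  have J01: "J \<subseteq> {0..1}" using lapD[OF J] by blast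
  define k0 where "k0 = m * \<kappa>"
  have k0: "1 \<le> k0" unfolding k0_def using m1 k by simp
  have "((quad w \<circ> quad v) ^^ m) ^^ \<kappa> = alt_comp v w (2 * k0)" by (simp add: alt_comp_even[abs_def] funpow_mult k0_def)
  hence br': "branches (alt_comp v w (2 * k0)) J J \<A>" using br by simp
  have "\<mu> ^ 1 \<le> \<mu> ^ \<kappa>" using mu2 k by (intro power_increasing) auto
  hence c2: "2 \<le> card \<A>" using mu2 card by simp
  show ?thesis
  \<comment> \<open>One block of length \<open>k0\<close> is spent on the sign correction; this
    constant pays for it.\<close>
  proof (intro exI[of _ "exp (- a * real k0)"] conjI allI)
    fix K
    let ?k = "k0 * Suc K"
    obtain \<D> where D: "finite \<D>" "card \<D> = card \<A> ^ K" "\<And>A A'. A \<in> \<D> \<Longrightarrow> A' \<in> \<D> \<Longrightarrow> A \<noteq> A' \<Longrightarrow> A \<inter> A' = {}"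
      "\<And>A. A \<in> \<D> \<Longrightarrow> A \<subseteq> J" "\<And>A. A \<in> \<D> \<Longrightarrow> is_interval A" "\<And>A. A \<in> \<D> \<Longrightarrow> mono_dir (-1) (alt_comp v w (2 * ?k)) A"
      "\<And>A. A \<in> \<D> \<Longrightarrow> alt_comp v w (2 * ?k) ` A = J"
      using decreasing_branches[OF _ _ pq br' c2, of K] v by auto
    have "\<exists>x\<in>A. alt_comp v w (2 * ?k) x = x" if "A \<in> \<D>" for A
      using decreasing_branch_fixed_point[OF continuous_on_alt_comp, of A p q v w "2 * ?k"] D(4-7)[OF that] pq by auto
    then obtain X where X: "\<And>A. A \<in> \<D> \<Longrightarrow> X A \<in> A" "\<And>A. A \<in> \<D> \<Longrightarrow> alt_comp v w (2 * ?k) (X A) = X A" by metis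
    have inj: "inj_on X \<D>" by (rule inj_onI) (metis D(3) X(1) disjoint_iff)
    have neg: "alt_deriv v w (2 * ?k) (X A) \<le> 0" if A: "A \<in> \<D>" for A
    proof -
      have "strictly_monotone (alt_comp v w (2 * ?k)) A" using D(6)[OF A] strictly_monotoneI by blast
      then obtain y where "y \<in> A" "X A < y"
        using mono_branch_open[OF _ _ X(1)[OF A]] D(7)[OF A] pq(1) by blast
      thus ?thesis using alt_deriv_nonpos[OF D(5)[OF A] D(6)[OF A] X(1)[OF A]] by blast
    qed
    have "exp (- a * real k0) * exp (a * real ?k) = (\<mu> ^ \<kappa>) ^ K"
      unfolding \<mu>_def k0_def by (simp add: exp_of_nat_mult[symmetric] exp_add[symmetric] algebra_simps)
    also have "\<dots> \<le> real (card \<A>) ^ K" using card mu2 by (intro power_mono) auto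
    also have "\<dots> = real (card (X ` \<D>))" using D(2) inj by (simp add: card_image)
    finally have c: "exp (- a * real k0) * exp (a * real ?k) \<le> real (card (X ` \<D>))" .
    have "K \<le> ?k" using k0 by (metis Suc_leD mult.commute mult_le_mono2 mult_1_right nat_le_iff_add le_trans order_refl)
    moreover have "X ` \<D> \<subseteq> {0..1}" using X(1) D(4) J01 by blast
    ultimately show "\<exists>k\<ge>K. \<exists>Z. finite Z \<and> Z \<subseteq> {0..1} \<and> exp (- a * real k0) * exp (a * real k) \<le> real (card Z) \<and>
     (\<forall>x\<in>Z. alt_comp v w (2 * k) x = x \<and> alt_deriv v w (2 * k) x \<le> 0)"
      using c D(1) X(2) neg by (intro exI[of _ ?k] conjI exI[of _ "X ` \<D>"]) auto
  qed simp
qed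

section \<open>Upper bound for the number of fixed points with negative multiplier\<close>

lemma finite_min_gap:
  fixes C :: "real set"
  assumes "finite C"
  shows "\<exists>d>0. \<forall>c\<in>C. \<forall>c'\<in>C. c \<noteq> c' \<longrightarrow> d \<le> \<bar>c - c'\<bar>"
proof -
  define S where "S = insert 1 ((\<lambda>(c, c'). \<bar>c - c'\<bar>) ` {p \<in> C \<times> C. fst p \<noteq> snd p})"
  have fin: "finite S" unfolding S_def using assms by simp
  have "S \<noteq> {}" unfolding S_def by simp
  hence "Min S \<in> S" using fin by (intro Min_in)
  hence "0 < Min S" unfolding S_def by auto
  moreover have "Min S \<le> \<bar>c - c'\<bar>" if "c \<in> C" "c' \<in> C" "c \<noteq> c'" for c c'
    using fin that unfolding S_def by (intro Min_le) (auto intro!: rev_image_eqI[of "(c, c')"])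
  ultimately show ?thesis by blast
qed

text \<open>A separated subset of maximal cardinality is spanning, since a point far from all its
  members could be added. With \<open>max \<epsilon> 0\<close> its own members satisfy the bound
  even for negative \<open>\<epsilon>\<close>.\<close>

lemma maximal_separated:
  fixes Z :: "'a::metric_space set"
  assumes "finite Z"
  shows "\<exists>E\<subseteq>Z. dyn_separated f n \<epsilon> E \<and> (\<forall>x\<in>Z. \<exists>e\<in>E. \<forall>i<n. dist ((f ^^ i) x) ((f ^^ i) e) \<le> max \<epsilon> 0)"
proof -
  let ?S = "{E. E \<subseteq> Z \<and> dyn_separated f n \<epsilon> E}"
  have fin: "finite (card ` ?S)" using assms by simp
  have "{} \<in> ?S" by (simp add: dyn_separated_def)
  hence "card ` ?S \<noteq> {}" by blast
  with fin have "Max (card ` ?S) \<in> card ` ?S" by (rule Max_in)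
  then obtain E where E: "E \<in> ?S" "Max (card ` ?S) = card E" by blast
  have max: "card E' \<le> card E" if "E' \<in> ?S" for E'
    using Max_ge[OF fin imageI[OF that]] E(2) by simp
  have "\<exists>e\<in>E. \<forall>i<n. dist ((f ^^ i) x) ((f ^^ i) e) \<le> max \<epsilon> 0" if x: "x \<in> Z" for x
  proof (rule ccontr)
    assume neg: "\<not> ?thesis"
    have "x \<notin> E" using neg by force
    have sep: "\<exists>k<n. dist ((f ^^ k) x) ((f ^^ k) e) > \<epsilon>" if "e \<in> E" for e
      using neg that by (meson le_max_iff_disj not_less)
    hence "dyn_separated f n \<epsilon> (insert x E)"
      using E(1) unfolding dyn_separated_def by (auto simp: dist_commute)
    hence "card (insert x E) \<le> card E" using E x by (intro max) auto
    moreover have "finite E" using E(1) assms finite_subset by auto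
    ultimately show False using \<open>x \<notin> E\<close> by simp
  qed
  thus ?thesis using E(1) by blast
qed

text \<open>Negative slope at \<open>x\<close> pushes values below \<open>x\<close> just to its
  right, while the value at \<open>y\<close> is above \<open>x\<close>. By the intermediate value
  theorem the value \<open>x\<close> is taken again, against injectivity.\<close>

lemma fixed_points_not_monotone:
  assumes "strictly_monotone (alt_comp v w N) {x..y}" "n \<le> N" "x < y"
    and "alt_comp v w n x = x" "alt_comp v w n y = y" "alt_deriv v w n x < 0"
  shows False
proof -
  have inj: "u = u'" if "u \<in> {x..y}" "u' \<in> {x..y}" "alt_comp v w n u = alt_comp v w n u'" for u u'
    using inj_onD[OF strictly_monotone_inj[OF assms(1)] alt_comp_split[OF assms(2) that(3)] that(1,2)] .
  obtain d where d: "0 < d" "\<And>h. 0 < h \<Longrightarrow> h < d \<Longrightarrow> alt_comp v w n (x + h) < alt_comp v w n x"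
    using DERIV_neg_dec_right[OF DERIV_alt_comp assms(6)] by blast
  define h where "h = min (d / 2) (y - x)"
  have h: "0 < h" "h < d" "x + h \<le> y" unfolding h_def using d assms(3) by auto
  have "alt_comp v w n (x + h) \<le> x" "x \<le> alt_comp v w n y" using d(2)[of h] h assms by auto
  then obtain u where u: "x + h \<le> u" "u \<le> y" "alt_comp v w n u = x"
    using IVT'[of "alt_comp v w n" "x + h" x y] h continuous_on_alt_comp by blast
  have "u = x" using inj[of u x] u h assms by auto
  thus False using u h by simp
qed

text \<open>The points near the orbit of a fixed element of a maximal separated set are coded by the side
  of the only nearby turning point on which each iterate of \<open>f\<^sup>m\<close> lies; points with equal codes
  bound an interval of monotonicity.\<close>

lemma entropy_fixed_points_upper:
  assumes v: "v \<in> {0<..1}" "w \<in> {0<..1}" and a: "a < a'"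
    and h: "topological_entropy {0..1} (quad w \<circ> quad v) < ereal a"
  shows "\<exists>Q. \<forall>k Z. finite Z \<longrightarrow> Z \<subseteq> {0..1} \<longrightarrow> (\<forall>x\<in>Z. alt_comp v w (2 * k) x = x \<and> alt_deriv v w (2 * k) x < 0) \<longrightarrow>
     real (card Z) \<le> Q * exp (a' * real k)"
proof -
  let ?f = "quad w \<circ> quad v"
  have "0 < ereal a" using topological_entropy_nonneg h by (rule order.strict_trans1)
  hence a0: "0 < a" by simp
  \<comment> \<open>A factor 2 per \<open>m\<close> steps then costs less than the gap
    \<open>a' - a\<close> in the exponent.\<close>
  obtain m :: nat where m: "ln 2 / (a' - a) < real m" using reals_Archimedean2 by blast
  have m2: "ln 2 < (a' - a) * real m" using m a by (simp add: field_simps)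
  have m1: "1 \<le> m"
  proof (rule ccontr)
    assume "\<not> 1 \<le> m"
    hence "m = 0" by simp
    thus False using m2 by simp
  qed
  let ?G = "?f ^^ m"
  interpret piecewise_monotone ?G "turning v w m"
    by (rule piecewise_monotone_iterate[OF v])
  obtain d where d: "0 < d" "\<And>c c'. c \<in> turning v w m \<Longrightarrow> c' \<in> turning v w m \<Longrightarrow> c \<noteq> c' \<Longrightarrow> d \<le> \<bar>c - c'\<bar>"
    using finite_min_gap[OF finite_C] by blast
  \<comment> \<open>Turning points within \<open>\<epsilon>\<close> of the same point differ by at
    most \<open>2 * \<epsilon> < d\<close>, so there is at most one.\<close>
  define \<epsilon> where "\<epsilon> = d / 3"
  have e: "0 < \<epsilon>" unfolding \<epsilon>_def using d by simp
  obtain n0 where n0: "\<And>n E. n0 \<le> n \<Longrightarrow> finite E \<Longrightarrow> E \<subseteq> {0..1} \<Longrightarrow> dyn_separated ?f n \<epsilon> E \<Longrightarrow> real (card E) \<le> exp (a * real n)"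
    using topological_entropy_less_separated[OF h e] by blast
  have "real (card Z) \<le> exp (a' * real (m * (1 + n0))) * exp (a' * real k)"
    if Z: "finite Z" "Z \<subseteq> {0..1}" "\<And>x. x \<in> Z \<Longrightarrow> alt_comp v w (2 * k) x = x \<and> alt_deriv v w (2 * k) x < 0" for k Z
  proof -
    \<comment> \<open>The quotient, rounded up, makes \<open>m * n\<close> at least
      \<open>k\<close>; the summand \<open>n0\<close> makes it large enough for the entropy
      bound.\<close>
    define n where "n = k div m + 1 + n0"
    have n: "k \<le> m * n" "m * n \<le> k + m * (1 + n0)" "n0 \<le> m * n"
    proof -
      have "m * (k div m) + k mod m = k" "k mod m < m" using m1 by simp_all
      moreover have "n0 \<le> m * n0" using m1 by simp
      ultimately show "k \<le> m * n" "m * n \<le> k + m * (1 + n0)" "n0 \<le> m * n"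
        unfolding n_def distrib_left by linarith+
    qed
    obtain E where E: "E \<subseteq> Z" "dyn_separated ?f (m * n) \<epsilon> E"
      "\<And>x. x \<in> Z \<Longrightarrow> \<exists>e\<in>E. \<forall>i<m * n. dist ((?f ^^ i) x) ((?f ^^ i) e) \<le> \<epsilon>"
      using maximal_separated[OF Z(1), of ?f "m * n" \<epsilon>] e by auto
    define B where "B e = {x \<in> Z. \<forall>i<m * n. dist ((?f ^^ i) x) ((?f ^^ i) e) \<le> \<epsilon>}" for e
    have cB: "card (B e) \<le> 2 ^ n" for e
    proof -
      \<comment> \<open>The only turning point near the \<open>j\<close>-th iterate of
        \<open>e\<close> under \<open>?G\<close>; if there is none, the value is arbitrary and
        harmless.\<close>
      define c where "c j = (SOME c. c \<in> turning v w m \<and> \<bar>c - (?G ^^ j) e\<bar> \<le> \<epsilon>)" for j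
      have c_eq: "c' = c j" if "c' \<in> turning v w m" "\<bar>c' - (?G ^^ j) e\<bar> \<le> \<epsilon>" for c' j
      proof -
        have "c j \<in> turning v w m \<and> \<bar>c j - (?G ^^ j) e\<bar> \<le> \<epsilon>"
          unfolding c_def by (rule someI[where x = c']) (intro conjI that)
        moreover from this that(2) have "\<bar>c' - c j\<bar> \<le> \<epsilon> + \<epsilon>" by linarith
        ultimately show ?thesis using d(2)[OF that(1), of "c j"] d(1) unfolding \<epsilon>_def by fastforce
      qed
      define code where "code x = {j \<in> {..<n}. c j < (?G ^^ j) x}" for x
      have near: "\<bar>(?G ^^ j) x - (?G ^^ j) e\<bar> \<le> \<epsilon>" if "x \<in> B e" "j < n" for x j
      proof -
        have "m * j < m * n" using that(2) m1 by simp
        hence "dist ((?f ^^ (m * j)) x) ((?f ^^ (m * j)) e) \<le> \<epsilon>" using that(1) unfolding B_def by blast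
        thus ?thesis by (simp only: funpow_mult dist_real_def)
      qed
      have "False" if xy: "x \<in> B e" "y \<in> B e" "x < y" "code x = code y" for x y
      proof -
        have x01: "0 \<le> x" "y \<le> 1" using xy Z(2) unfolding B_def by auto
        have "strictly_monotone (?G ^^ j) {x..y}" if "j \<le> n" for j
          using that
        proof (induction j)
          case 0
          show ?case by (rule strictly_monotoneI[of 1]) (auto simp: mono_dir_def)
        next
          case (Suc j)
          hence j: "j < n" by simp
          hence IH: "strictly_monotone (?G ^^ j) {x..y}" by (intro Suc.IH less_imp_le)
          let ?x = "(?G ^^ j) x" and ?y = "(?G ^^ j) y"
          define lo hi where "lo = min ?x ?y" and "hi = max ?x ?y"
          have "?x \<noteq> ?y" using inj_onD[OF strictly_monotone_inj[OF IH], of x y] xy(3) by auto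
          hence lohi: "lo < hi" unfolding lo_def hi_def by auto
          have "?x \<in> {0..1}" "?y \<in> {0..1}" using iterate_maps[of x j] iterate_maps[of y j] x01 xy(3) by auto
          hence lh01: "0 \<le> lo" "hi \<le> 1" unfolding lo_def hi_def by auto
          \<comment> \<open>A turning point between the two iterates would be within
            \<open>\<epsilon>\<close> of the iterate of \<open>e\<close>, hence be
            \<open>c j\<close>, and the codes would differ at \<open>j\<close>.\<close>
          have "c' \<notin> {lo<..<hi}" if "c' \<in> turning v w m" for c'
          proof
            assume c': "c' \<in> {lo<..<hi}"
            hence "\<bar>c' - (?G ^^ j) e\<bar> \<le> \<epsilon>"
              using near[OF xy(1) j] near[OF xy(2) j] unfolding lo_def hi_def by (auto simp: abs_le_iff min_def max_def split: if_splits)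
            hence "c' = c j" using c_eq that by blast
            hence "(j \<in> code x) \<noteq> (j \<in> code y)"
              using c' j unfolding code_def lo_def hi_def by (auto simp: min_def max_def split: if_splits)
            thus False using xy(4) by simp
          qed
          hence "{lo<..<hi} \<inter> turning v w m = {}" by blast
          from mono[OF lh01(1) lohi lh01(2) this] have "strictly_monotone ?G {lo..hi}" .
          moreover have "(?G ^^ j) ` {x..y} \<subseteq> {lo..hi}"
          proof
            fix u assume "u \<in> (?G ^^ j) ` {x..y}"
            then obtain z where z: "z \<in> {x..y}" "u = (?G ^^ j) z" by blast
            show "u \<in> {lo..hi}" unfolding z(2)
              by (rule strictly_monotone_between[OF IH, of x y]) (use z xy(3) in \<open>auto simp: lo_def hi_def is_interval_cc\<close>)
          qed
          ultimately have "strictly_monotone (\<lambda>z. ?G ((?G ^^ j) z)) {x..y}"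
            by (intro strictly_monotone_comp[OF IH]) (rule strictly_monotone_subset)
          thus ?case by (simp add: comp_def)
        qed
        hence "strictly_monotone (alt_comp v w (2 * (m * n))) {x..y}"
          by (metis alt_comp_even[abs_def] funpow_mult order_refl)
        moreover have "2 * k \<le> 2 * (m * n)" using n by simp
        ultimately show False
          using fixed_points_not_monotone[OF _ _ xy(3)] Z(3)[of x] Z(3)[of y] xy(1,2) unfolding B_def by blast
      qed
      hence "inj_on code (B e)" by (intro inj_onI) (metis linorder_neqE_linordered_idom)
      moreover have "code ` B e \<subseteq> Pow {..<n}" unfolding code_def by auto
      ultimately have "card (B e) \<le> card (Pow {..<n})" by (intro card_inj_on_le) auto
      thus ?thesis by (simp add: card_Pow)
    qed
    have fE: "finite E" using E(1) Z(1) finite_subset by blast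
    have "Z \<subseteq> (\<Union>e\<in>E. B e)" using E(3) unfolding B_def by blast
    hence "card Z \<le> card (\<Union>e\<in>E. B e)" using fE Z(1) by (intro card_mono) (auto simp: B_def)
    also have "\<dots> \<le> (\<Sum>e\<in>E. card (B e))" using fE by (rule card_UN_le)
    also have "\<dots> \<le> (\<Sum>e\<in>E. 2 ^ n)" by (intro sum_mono cB)
    finally have "real (card Z) \<le> real (card E * 2 ^ n)" by (intro of_nat_mono) simp
    also have "\<dots> = real (card E) * 2 ^ n" by simp
    also have "\<dots> \<le> exp (a * real (m * n)) * 2 ^ n"
      using n0[OF n(3) fE _ E(2)] E(1) Z(2) by (intro mult_right_mono) auto
    also have "(2::real) ^ n = exp (real n * ln 2)" by (simp add: exp_of_nat_mult)
    also have "exp (a * real (m * n)) * exp (real n * ln 2) = exp (real n * (a * real m + ln 2))"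
      by (simp add: exp_add[symmetric] algebra_simps)
    also have "\<dots> \<le> exp (real n * (a' * real m))"
    proof -
      have "a * real m + ln 2 \<le> a' * real m" using m2 by (simp add: algebra_simps)
      thus ?thesis unfolding exp_le_cancel_iff by (rule mult_left_mono) simp
    qed
    also have "real n * (a' * real m) = a' * real (m * n)" by simp
    also have "exp (a' * real (m * n)) \<le> exp (a' * real (k + m * (1 + n0)))"
      using n(2) a a0 by (auto intro!: mult_left_mono simp del: of_nat_add of_nat_mult)
    also have "\<dots> = exp (a' * real (m * (1 + n0))) * exp (a' * real k)"
      by (simp add: exp_add[symmetric] algebra_simps)
    finally show ?thesis .
  qed
  thus ?thesis by (intro exI[of _ "exp (a' * real (m * (1 + n0)))"] allI impI) (simp only:)
qed

subsection \<open>Persistence of decreasing fixed points\<close>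

lemma continuous_on_alt_comp_joint:
  "continuous_on S (\<lambda>q::(real \<times> real) \<times> real. alt_comp (fst (fst q)) (snd (fst q)) n (snd q))"
proof (induction n)
  case (Suc n)
  show ?case
  proof (cases "even n")
    case True
    thus ?thesis unfolding alt_comp.simps quad_def using Suc by (auto intro!: continuous_intros)
  next
    case False
    thus ?thesis unfolding alt_comp.simps quad_def using Suc by (auto intro!: continuous_intros)
  qed
qed (auto intro!: continuous_intros)

lemma continuous_on_alt_deriv_joint:
  "continuous_on S (\<lambda>q::(real \<times> real) \<times> real. alt_deriv (fst (fst q)) (snd (fst q)) n (snd q))"
proof -
  have "continuous_on S (\<lambda>q::(real \<times> real) \<times> real. 4 * (if even i then fst (fst q) else snd (fst q)) * (1 - 2 * alt_comp (fst (fst q)) (snd (fst q)) i (snd q)))" for i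
    by (cases "even i") (auto intro!: continuous_intros continuous_on_alt_comp_joint)
  thus ?thesis unfolding alt_deriv_def by (intro continuous_on_prod)
qed

lemma alt_deriv_add: "alt_deriv v w (n + 2 * j) x = alt_deriv v w n (alt_comp v w (2 * j) x) * alt_deriv v w (2 * j) x"
proof (induction n)
  case 0
  show ?case by (simp add: alt_deriv_def)
next
  case (Suc n)
  have S: "alt_deriv v w (Suc i) y = alt_deriv v w i y * (4 * (if even i then v else w) * (1 - 2 * alt_comp v w i y))" for i y
    by (simp add: alt_deriv_def)
  show ?case unfolding add_Suc S Suc alt_comp_add by simp
qed

lemma alt_comp_fixed_mult: "alt_comp v w (2 * j) x = x \<Longrightarrow> alt_comp v w (2 * (j * l)) x = x"
proof (induction l)
  case (Suc l)
  thus ?case using alt_comp_add[of v w "2 * (j * l)" j x] by (simp add: algebra_simps)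
qed simp

lemma alt_deriv_fixed_mult: "alt_comp v w (2 * j) x = x \<Longrightarrow> alt_deriv v w (2 * (j * l)) x = alt_deriv v w (2 * j) x ^ l"
proof (induction l)
  case (Suc l)
  thus ?case using alt_deriv_add[of v w "2 * (j * l)" j x] by (simp add: algebra_simps)
qed (simp add: alt_deriv_def)

text \<open>\<open>f^k - id\<close> is a polynomial, nonzero because \<open>f^k\<close> sends 1 to
  0. Unlike a degree count, this also covers vanishing parameters.\<close>

lemma finite_fixed_points:
  assumes "1 \<le> k" shows "finite {x. alt_comp v w (2 * k) x = x}"
proof -
  have "\<exists>p. \<forall>x. poly p x = alt_comp v w n x" for n
  proof (induction n)
    case 0
    show ?case by (intro exI[of _ "[:0, 1:]"]) simp
  next
    case (Suc n)
    then obtain p where p: "\<And>x. poly p x = alt_comp v w n x" by blast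
    show ?case by (intro exI[of _ "smult (4 * (if even n then v else w)) (p * (1 - p))"]) (simp add: p quad_def)
  qed
  then obtain p where p: "\<And>x. poly p x = alt_comp v w (2 * k) x" by blast
  have z: "quad u 0 = 0" "quad u 1 = 0" for u by (simp_all add: quad_def)
  have "alt_comp v w (Suc n) 1 = 0" for n by (induction n) (simp_all add: z)
  from this[of "2 * k - 1"] have "alt_comp v w (2 * k) 1 = 0" using assms by simp
  hence "poly (p - [:0, 1:]) 1 \<noteq> 0" by (simp add: p)
  hence "p - [:0, 1:] \<noteq> 0" by (metis poly_0)
  hence "finite {x. poly (p - [:0, 1:]) x = 0}" by (rule poly_roots_finite)
  thus ?thesis by (simp add: p)
qed

text \<open>A derivative below 1 makes the map minus the identity strictly decreasing near
  \<open>x0\<close>, for all nearby parameters. Its signs at \<open>x0 - e\<close> and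
  \<open>x0 + e\<close> persist and give existence; monotonicity gives uniqueness.\<close>

lemma persistent_fixed_point:
  assumes fix0: "alt_comp (fst p0) (snd p0) n x0 = x0" and d: "alt_deriv (fst p0) (snd p0) n x0 < 1"
  shows "\<exists>e0>0. \<forall>e. 0 < e \<and> e \<le> e0 \<longrightarrow> (\<exists>d>0. \<forall>p. dist p p0 < d \<longrightarrow>
     (\<exists>!x. \<bar>x - x0\<bar> < e \<and> alt_comp (fst p) (snd p) n x = x))"
proof -
  let ?D = "\<lambda>q::(real \<times> real) \<times> real. alt_deriv (fst (fst q)) (snd (fst q)) n (snd q)"
  have "open {q. ?D q < 1}"
    using continuous_on_alt_deriv_joint[of UNIV n] by (intro open_Collect_less) auto
  then obtain r where r: "0 < r" "ball (p0, x0) r \<subseteq> {q. ?D q < 1}"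
    using d open_contains_ball[of "{q. ?D q < 1}"] by force
  have D1: "alt_deriv (fst p) (snd p) n x < 1" if "dist p p0 < r / 2" "\<bar>x - x0\<bar> < r / 2" for p x
  proof -
    have "dist (p0, x0) (p, x) \<le> dist p0 p + dist x0 x"
      unfolding dist_Pair_Pair by (rule sqrt_sum_squares_le_sum) simp_all
    also have "\<dots> < r" using that unfolding dist_commute[of p0 p] dist_real_def by linarith
    finally show ?thesis using r(2) by auto
  qed
  have dec: "alt_comp (fst p) (snd p) n y - y < alt_comp (fst p) (snd p) n x - x"
    if "dist p p0 < r / 2" "x < y" "x0 - r / 2 < x" "y < x0 + r / 2" for p x y
  proof (rule DERIV_neg_imp_decreasing[OF that(2)])
    fix z assume z: "x \<le> z" "z \<le> y"
    have "((\<lambda>x. alt_comp (fst p) (snd p) n x - x) has_real_derivative alt_deriv (fst p) (snd p) n z - 1) (at z)"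
      by (intro derivative_intros DERIV_alt_comp)
    moreover have "\<bar>z - x0\<bar> < r / 2" using that z unfolding abs_less_iff by linarith
    hence "alt_deriv (fst p) (snd p) n z - 1 < 0" using D1[OF that(1)] by simp
    ultimately show "\<exists>y. DERIV (\<lambda>x. alt_comp (fst p) (snd p) n x - x) z :> y \<and> y < 0" by blast
  qed
  show ?thesis
  proof (rule exI[of _ "r / 4"], intro conjI allI impI)
    fix e assume e: "0 < e \<and> e \<le> r / 4"
    have cp: "continuous_on UNIV (\<lambda>p::real\<times>real. alt_comp (fst p) (snd p) n y)" for y
      using continuous_on_compose2[OF continuous_on_alt_comp_joint[of UNIV n], of UNIV "\<lambda>p. (p, y)"]
      by (simp add: continuous_on_Pair continuous_on_id)
    have "alt_comp (fst p0) (snd p0) n (x0 + e) < x0 + e" "x0 - e < alt_comp (fst p0) (snd p0) n (x0 - e)"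
      using dec[of p0 x0 "x0 + e"] dec[of p0 "x0 - e" x0] e r(1) fix0 by auto
    hence mem: "p0 \<in> {p. alt_comp (fst p) (snd p) n (x0 + e) < x0 + e} \<inter> {p. x0 - e < alt_comp (fst p) (snd p) n (x0 - e)}" by simp
    have op: "open ({p::real\<times>real. alt_comp (fst p) (snd p) n (x0 + e) < x0 + e} \<inter> {p. x0 - e < alt_comp (fst p) (snd p) n (x0 - e)})"
      by (intro open_Int open_Collect_less cp continuous_on_const)
    obtain d where d: "0 < d" "ball p0 d \<subseteq> {p. alt_comp (fst p) (snd p) n (x0 + e) < x0 + e} \<inter> {p. x0 - e < alt_comp (fst p) (snd p) n (x0 - e)}"
      by (rule openE[OF op mem])
    show "\<exists>d>0. \<forall>p. dist p p0 < d \<longrightarrow> (\<exists>!x. \<bar>x - x0\<bar> < e \<and> alt_comp (fst p) (snd p) n x = x)"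
    proof (intro exI[of _ "min d (r / 2)"] conjI allI impI)
      fix p assume p: "dist p p0 < min d (r / 2)"
      have s: "alt_comp (fst p) (snd p) n (x0 + e) < x0 + e" "x0 - e < alt_comp (fst p) (snd p) n (x0 - e)"
        using d(2) p by (auto simp: dist_commute)
      have "continuous_on {x0 - e..x0 + e} (\<lambda>x. alt_comp (fst p) (snd p) n x - x)"
        by (intro continuous_intros continuous_on_alt_comp)
      then obtain x where x: "x0 - e \<le> x" "x \<le> x0 + e" "alt_comp (fst p) (snd p) n x - x = 0"
        using IVT2'[of "\<lambda>x. alt_comp (fst p) (snd p) n x - x" "x0 + e" 0 "x0 - e"] s e by auto
      have "x \<noteq> x0 - e" "x \<noteq> x0 + e" using x(3) s by auto
      hence x': "\<bar>x - x0\<bar> < e \<and> alt_comp (fst p) (snd p) n x = x" using x by auto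
      have uniq: "x = y" if "\<bar>y - x0\<bar> < e \<and> alt_comp (fst p) (snd p) n y = y" for y
      proof -
        have "dist p p0 < r / 2" "x0 - r / 2 < x" "x < x0 + r / 2" "x0 - r / 2 < y" "y < x0 + r / 2"
          using p e r(1) that x' by linarith+
        thus ?thesis using dec[of p x y] dec[of p y x] that x' by (cases x y rule: linorder_cases) simp_all
      qed
      show "\<exists>!x. \<bar>x - x0\<bar> < e \<and> alt_comp (fst p) (snd p) n x = x"
        using x' uniq by blast
    qed (use d r in auto)
  qed (use r in auto)
qed

text \<open>The nonstrict sign condition is closed and thus inherited by limits; strictness is
  supplied by \<open>dec_fixed_hyperbolic\<close>. Restricting to divisors of \<open>k\<close> keeps
  the exclusions finite in number, and points fixed by an excluded \<open>f^j\<close> are fixed by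
  \<open>f^k\<close>.\<close>

definition dec_fixed :: "nat set \<Rightarrow> nat \<Rightarrow> real \<times> real \<Rightarrow> real set" where
  "dec_fixed P k p = {x \<in> {0..1}. alt_comp (fst p) (snd p) (2 * k) x = x \<and> alt_deriv (fst p) (snd p) (2 * k) x \<le> 0 \<and>
     (\<forall>j\<in>P. j dvd k \<longrightarrow> alt_comp (fst p) (snd p) (2 * j) x \<noteq> x)}"

lemma finite_dec_fixed: "1 \<le> k \<Longrightarrow> finite (dec_fixed P k p)"
  using finite_subset[OF _ finite_fixed_points[of k "fst p" "snd p"], of "dec_fixed P k p"]
  unfolding dec_fixed_def by blast

text \<open>At a negative multiplier all conditions other than the fixed point equation hold on a
  neighbourhood, so membership reduces to that equation. \<open>1 \<in> P\<close> keeps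
  \<open>x0\<close> away from the fixed point 0, so that nearby points stay in the unit
  interval.\<close>

lemma dec_fixed_local:
  assumes P: "1 \<in> P" and k: "1 \<le> k"
    and x0: "x0 \<in> dec_fixed P k p0" and D: "alt_deriv (fst p0) (snd p0) (2 * k) x0 < 0"
  shows "\<exists>e0>0. \<forall>e. 0 < e \<and> e \<le> e0 \<longrightarrow> (\<exists>d>0. \<forall>p. dist p p0 < d \<longrightarrow>
     (\<exists>!x. \<bar>x - x0\<bar> < e \<and> x \<in> dec_fixed P k p))"
proof -
  obtain e1 where e1: "0 < e1" "\<And>e. 0 < e \<Longrightarrow> e \<le> e1 \<Longrightarrow> \<exists>d>0. \<forall>p. dist p p0 < d \<longrightarrow>
     (\<exists>!x. \<bar>x - x0\<bar> < e \<and> alt_comp (fst p) (snd p) (2 * k) x = x)"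
    using persistent_fixed_point[of p0 "2 * k" x0] x0 D unfolding dec_fixed_def by auto
  let ?alt_comp = "\<lambda>n. \<lambda>q::(real \<times> real) \<times> real. alt_comp (fst (fst q)) (snd (fst q)) n (snd q)"
  let ?D = "\<lambda>q::(real \<times> real) \<times> real. alt_deriv (fst (fst q)) (snd (fst q)) (2 * k) (snd q)"
  let ?J = "{j \<in> P. j dvd k}"
  let ?U = "{q. ?D q < 0} \<inter> {q. 0 < snd q} \<inter> {q. snd q < 1} \<inter> (\<Inter>j\<in>?J. {q. ?alt_comp (2 * j) q \<noteq> snd q})"
  have fJ: "finite ?J" using k by (intro finite_subset[OF _ finite_divisors_nat[of k]]) auto
  have op: "open ?U"
    by (intro open_Int open_INT fJ ballI open_Collect_less open_Collect_neq continuous_on_alt_deriv_joint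
        continuous_on_alt_comp_joint continuous_on_const continuous_on_snd continuous_on_id)
  have mem: "(p0, x0) \<in> ?U"
  proof -
    have "quad u 0 = 0" "quad u 1 = 0" for u by (simp_all add: quad_def)
    hence "x0 \<noteq> 0" using x0 P unfolding dec_fixed_def by (auto simp: numeral_2_eq_2)
    moreover have "x0 \<noteq> 1"
    proof
      assume "x0 = 1"
      moreover have "alt_comp (fst p0) (snd p0) (Suc n) 1 = 0" for n by (induction n) (simp_all add: quad_def)
      from this[of "2 * k - 1"] have "alt_comp (fst p0) (snd p0) (2 * k) 1 = 0" using k by simp
      ultimately show False using x0 unfolding dec_fixed_def by simp
    qed
    ultimately show ?thesis using x0 D unfolding dec_fixed_def by auto
  qed
  obtain r where r: "0 < r" "ball (p0, x0) r \<subseteq> ?U" by (rule openE[OF op mem])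
  have U: "(p, x) \<in> ?U" if "dist p p0 < r / 2" "\<bar>x - x0\<bar> < r / 2" for p x
  proof -
    have "dist (p0, x0) (p, x) \<le> dist p0 p + dist x0 x"
      unfolding dist_Pair_Pair by (rule sqrt_sum_squares_le_sum) simp_all
    also have "\<dots> < r" using that unfolding dist_commute[of p0 p] dist_real_def by linarith
    finally show ?thesis using r(2) by (meson mem_ball subsetD)
  qed
  have iff: "x \<in> dec_fixed P k p \<longleftrightarrow> alt_comp (fst p) (snd p) (2 * k) x = x" if "dist p p0 < r / 2" "\<bar>x - x0\<bar> < r / 2" for p x
    using U[OF that] unfolding dec_fixed_def by auto
  show ?thesis
  proof (rule exI[of _ "min e1 (r / 2)"], intro conjI allI impI)
    fix e assume e: "0 < e \<and> e \<le> min e1 (r / 2)"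
    obtain d where d: "0 < d" "\<And>p. dist p p0 < d \<Longrightarrow> \<exists>!x. \<bar>x - x0\<bar> < e \<and> alt_comp (fst p) (snd p) (2 * k) x = x"
      using e1(2)[of e] e by auto
    show "\<exists>d>0. \<forall>p. dist p p0 < d \<longrightarrow> (\<exists>!x. \<bar>x - x0\<bar> < e \<and> x \<in> dec_fixed P k p)"
    proof (intro exI[of _ "min d (r / 2)"] conjI allI impI)
      fix p assume p: "dist p p0 < min d (r / 2)"
      have "\<bar>x - x0\<bar> < e \<and> x \<in> dec_fixed P k p \<longleftrightarrow> \<bar>x - x0\<bar> < e \<and> alt_comp (fst p) (snd p) (2 * k) x = x" for x
        using iff[of p x] p e by auto
      thus "\<exists>!x. \<bar>x - x0\<bar> < e \<and> x \<in> dec_fixed P k p" using d(2)[of p] p by simp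
    qed (use d(1) r(1) in simp)
  qed (use e1(1) r(1) in simp)
qed

text \<open>A limit of points of \<open>dec_fixed P k p\<close> that is fixed by \<open>f\<^sup>j\<close> for some excluded \<open>j\<close> has
  nonpositive multiplier for \<open>f\<^sup>j\<close> too, so that nearby fixed points of \<open>f\<^sup>k\<close> are also fixed by
  \<open>f\<^sup>j\<close> and hence excluded.\<close>

lemma dec_fixed_near:
  assumes k: "1 \<le> k" and e: "0 < e"
  shows "\<exists>d>0. \<forall>p. dist p p0 < d \<longrightarrow> (\<forall>x\<in>dec_fixed P k p. \<exists>x0\<in>dec_fixed P k p0. \<bar>x - x0\<bar> < e)"
proof (rule ccontr)
  assume "\<not> ?thesis"
  hence "\<forall>n::nat. \<exists>p x. dist p p0 < 1 / real (Suc n) \<and> x \<in> dec_fixed P k p \<and> (\<forall>x0\<in>dec_fixed P k p0. e \<le> \<bar>x - x0\<bar>)"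
    by (meson not_less of_nat_0_less_iff zero_less_Suc zero_less_divide_1_iff)
  then obtain p x where px: "\<And>n::nat. dist (p n) p0 < 1 / real (Suc n)" "\<And>n. x n \<in> dec_fixed P k (p n)"
    "\<And>n x0. x0 \<in> dec_fixed P k p0 \<Longrightarrow> e \<le> \<bar>x n - x0\<bar>" by metis
  have "\<forall>n. x n \<in> {0..1}" using px(2) unfolding dec_fixed_def by blast
  then obtain y r where y: "y \<in> {0..1}" "strict_mono r" "(x \<circ> r) \<longlonglongrightarrow> y"
    using compact_Icc[of 0 "1::real"] unfolding compact_def by metis
  have "(\<lambda>n. dist (p n) p0) \<longlonglongrightarrow> 0"
  proof (rule tendsto_sandwich[of "\<lambda>n. 0" _ _ "\<lambda>n. 1 / real (Suc n)"])
    show "(\<lambda>n. 1 / real (Suc n)) \<longlonglongrightarrow> 0" using LIMSEQ_inverse_real_of_nat by (simp add: inverse_eq_divide)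
  qed (use px(1) less_imp_le in \<open>auto intro!: always_eventually\<close>)
  hence "p \<longlonglongrightarrow> p0" using tendsto_dist_iff by blast
  hence pr: "(p \<circ> r) \<longlonglongrightarrow> p0" using y(2) LIMSEQ_subseq_LIMSEQ by blast
  hence lim: "(\<lambda>n. ((p \<circ> r) n, (x \<circ> r) n)) \<longlonglongrightarrow> (p0, y)" using y(3) by (intro tendsto_Pair)
  let ?alt_comp = "\<lambda>q::(real \<times> real) \<times> real. alt_comp (fst (fst q)) (snd (fst q)) (2 * k) (snd q)"
  let ?D = "\<lambda>q::(real \<times> real) \<times> real. alt_deriv (fst (fst q)) (snd (fst q)) (2 * k) (snd q)"
  have "(\<lambda>n. ?alt_comp ((p \<circ> r) n, (x \<circ> r) n)) \<longlonglongrightarrow> ?alt_comp (p0, y)"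
    using continuous_on_tendsto_compose[OF continuous_on_alt_comp_joint[of UNIV "2 * k"] lim] by simp
  moreover have "?alt_comp ((p \<circ> r) n, (x \<circ> r) n) = (x \<circ> r) n" for n using px(2)[of "r n"] unfolding dec_fixed_def by simp
  ultimately have "(x \<circ> r) \<longlonglongrightarrow> ?alt_comp (p0, y)" by (simp add: comp_def)
  hence fy: "alt_comp (fst p0) (snd p0) (2 * k) y = y" using y(3) LIMSEQ_unique by fastforce
  have "(\<lambda>n. ?D ((p \<circ> r) n, (x \<circ> r) n)) \<longlonglongrightarrow> ?D (p0, y)"
    using continuous_on_tendsto_compose[OF continuous_on_alt_deriv_joint[of UNIV "2 * k"] lim] by simp
  moreover have "?D ((p \<circ> r) n, (x \<circ> r) n) \<le> 0" for n using px(2)[of "r n"] unfolding dec_fixed_def by simp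
  ultimately have Dy: "alt_deriv (fst p0) (snd p0) (2 * k) y \<le> 0" using LIMSEQ_le_const2 by fastforce
  have "y \<notin> dec_fixed P k p0"
  proof
    assume y': "y \<in> dec_fixed P k p0"
    have "eventually (\<lambda>n. dist ((x \<circ> r) n) y < e) sequentially" using y(3) e by (rule tendstoD)
    from eventually_happens'[OF sequentially_bot this]
    obtain n where "dist ((x \<circ> r) n) y < e" by blast
    thus False using px(3)[OF y', of "r n"] by (simp add: dist_real_def)
  qed
  \<comment> \<open>The closed conditions pass to the limit \<open>y\<close>, so it must violate the
    exclusion.\<close>
  then obtain j where j: "j \<in> P" "j dvd k" "alt_comp (fst p0) (snd p0) (2 * j) y = y"
    using y(1) fy Dy unfolding dec_fixed_def by auto
  obtain l where l: "k = j * l" using j(2) by auto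
  \<comment> \<open>The multiplier for \<open>k = j * l\<close> is the \<open>l\<close>-th power of
    the one for \<open>j\<close>; a positive base would give a positive power.\<close>
  have Dj: "alt_deriv (fst p0) (snd p0) (2 * j) y \<le> 0"
    using Dy alt_deriv_fixed_mult[OF j(3), of l] unfolding l by (metis not_less zero_less_power)
  obtain e1 where e1: "0 < e1" "\<And>e. 0 < e \<Longrightarrow> e \<le> e1 \<Longrightarrow> \<exists>d>0. \<forall>p. dist p p0 < d \<longrightarrow>
     (\<exists>!x. \<bar>x - y\<bar> < e \<and> alt_comp (fst p) (snd p) (2 * k) x = x)"
    using persistent_fixed_point[of p0 "2 * k" y] fy Dy by auto
  obtain e2 where e2: "0 < e2" "\<And>e. 0 < e \<Longrightarrow> e \<le> e2 \<Longrightarrow> \<exists>d>0. \<forall>p. dist p p0 < d \<longrightarrow>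
     (\<exists>!x. \<bar>x - y\<bar> < e \<and> alt_comp (fst p) (snd p) (2 * j) x = x)"
    using persistent_fixed_point[of p0 "2 * j" y] j(3) Dj by auto
  define e' where "e' = min e1 e2"
  have e': "0 < e'" "e' \<le> e1" "e' \<le> e2" unfolding e'_def using e1 e2 by auto
  obtain d1 where d1: "0 < d1" "\<And>p. dist p p0 < d1 \<Longrightarrow> \<exists>!x. \<bar>x - y\<bar> < e' \<and> alt_comp (fst p) (snd p) (2 * k) x = x"
    using e1(2)[OF e'(1,2)] by blast
  obtain d2 where d2: "0 < d2" "\<And>p. dist p p0 < d2 \<Longrightarrow> \<exists>!x. \<bar>x - y\<bar> < e' \<and> alt_comp (fst p) (snd p) (2 * j) x = x"
    using e2(2)[OF e'(1,3)] by blast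
  have "eventually (\<lambda>n. dist ((x \<circ> r) n) y < e' \<and> dist ((p \<circ> r) n) p0 < min d1 d2) sequentially"
    using tendstoD[OF y(3) e'(1)] tendstoD[OF pr, of "min d1 d2"] d1(1) d2(1) by (intro eventually_conj) auto
  from eventually_happens'[OF sequentially_bot this]
  obtain n where n: "dist ((x \<circ> r) n) y < e'" "dist ((p \<circ> r) n) p0 < min d1 d2" by blast
  let ?p = "p (r n)" and ?x = "x (r n)"
  \<comment> \<open>Persistence for \<open>f^j\<close> produces \<open>z\<close>. It is also fixed
    by \<open>f^k\<close>, so uniqueness for \<open>f^k\<close> identifies it with the counted point
    \<open>?x\<close>, which \<open>f^j\<close> must not fix.\<close>
  obtain z where z: "\<bar>z - y\<bar> < e'" "alt_comp (fst ?p) (snd ?p) (2 * j) z = z" using d2(2)[of ?p] n(2) by auto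
  have "alt_comp (fst ?p) (snd ?p) (2 * k) z = z" unfolding l by (rule alt_comp_fixed_mult[OF z(2)])
  moreover have xn: "alt_comp (fst ?p) (snd ?p) (2 * k) ?x = ?x" "\<bar>?x - y\<bar> < e'"
    using px(2)[of "r n"] n(1) unfolding dec_fixed_def by (auto simp: dist_real_def)
  ultimately have "?x = z" using d1(2)[of ?p] n(2) z(1) by auto
  thus False using z(2) px(2)[of "r n"] j unfolding dec_fixed_def by auto
qed

text \<open>Every counted point has exactly one continuation nearby. The gaps make this assignment
  injective, and \<open>dec_fixed_near\<close>, a compactness statement, makes it
  surjective.\<close>

lemma card_dec_fixed_locally_constant:
  assumes P: "1 \<in> P" and k: "1 \<le> k"
    and D: "\<And>x. x \<in> dec_fixed P k p0 \<Longrightarrow> alt_deriv (fst p0) (snd p0) (2 * k) x < 0"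
  shows "\<exists>d>0. \<forall>p. dist p p0 < d \<longrightarrow> card (dec_fixed P k p) = card (dec_fixed P k p0)"
proof -
  let ?Z = "dec_fixed P k p0"
  have fin: "finite ?Z" by (rule finite_dec_fixed[OF k])
  obtain g where g: "0 < g" "\<And>x y. x \<in> ?Z \<Longrightarrow> y \<in> ?Z \<Longrightarrow> x \<noteq> y \<Longrightarrow> g \<le> \<bar>x - y\<bar>"
    using finite_min_gap[OF fin] by blast
  obtain e0 where e0: "\<And>x0. x0 \<in> ?Z \<Longrightarrow> 0 < e0 x0" "\<And>x0 e. x0 \<in> ?Z \<Longrightarrow> 0 < e \<Longrightarrow> e \<le> e0 x0 \<Longrightarrow>
     \<exists>d>0. \<forall>p. dist p p0 < d \<longrightarrow> (\<exists>!x. \<bar>x - x0\<bar> < e \<and> x \<in> dec_fixed P k p)"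
    using dec_fixed_local[OF P k _ D] by metis
  define e where "e = Min (insert (g / 2) (e0 ` ?Z))"
  have e: "0 < e" "\<And>x. x \<in> ?Z \<Longrightarrow> e \<le> e0 x"
    unfolding e_def using fin g(1) e0(1) by auto
  have eg: "e \<le> g / 2" unfolding e_def by (rule Min_le) (use fin in auto)
  obtain d where d: "\<And>x0. x0 \<in> ?Z \<Longrightarrow> 0 < d x0" "\<And>x0 p. x0 \<in> ?Z \<Longrightarrow> dist p p0 < d x0 \<Longrightarrow>
     \<exists>!x. \<bar>x - x0\<bar> < e \<and> x \<in> dec_fixed P k p"
    using e0(2)[OF _ e(1) e(2)] by metis
  obtain d' where d': "0 < d'" "\<And>p x. dist p p0 < d' \<Longrightarrow> x \<in> dec_fixed P k p \<Longrightarrow> \<exists>x0\<in>?Z. \<bar>x - x0\<bar> < e"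
    using dec_fixed_near[OF k e(1), of p0 P] by blast
  define \<delta> where "\<delta> = Min (insert d' (d ` ?Z))"
  have \<delta>: "0 < \<delta>" "\<delta> \<le> d'" "\<And>x. x \<in> ?Z \<Longrightarrow> \<delta> \<le> d x"
    unfolding \<delta>_def using fin d(1) d'(1) by auto
  show ?thesis
  proof (intro exI[of _ \<delta>] conjI allI impI)
    fix p assume p: "dist p p0 < \<delta>"
    have u: "\<exists>!x. \<bar>x - x0\<bar> < e \<and> x \<in> dec_fixed P k p" if "x0 \<in> ?Z" for x0
      using d(2)[OF that] p \<delta>(3)[OF that] by simp
    then obtain X where X: "\<And>x0. x0 \<in> ?Z \<Longrightarrow> \<bar>X x0 - x0\<bar> < e \<and> X x0 \<in> dec_fixed P k p" by metis
    have "bij_betw X ?Z (dec_fixed P k p)"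
      unfolding bij_betw_def
    proof
      show "inj_on X ?Z"
      proof (rule inj_onI, rule ccontr)
        fix x y assume xy: "x \<in> ?Z" "y \<in> ?Z" "X x = X y" "x \<noteq> y"
        have "\<bar>x - y\<bar> < g" using X[OF xy(1)] X[OF xy(2)] xy(3) eg by auto
        thus False using g(2)[OF xy(1,2,4)] by simp
      qed
      show "X ` ?Z = dec_fixed P k p"
      proof
        show "dec_fixed P k p \<subseteq> X ` ?Z"
        proof
          fix x assume x: "x \<in> dec_fixed P k p"
          then obtain x0 where x0: "x0 \<in> ?Z" "\<bar>x - x0\<bar> < e" using d'(2)[of p x] p \<delta>(2) by auto
          hence "x = X x0" using u[OF x0(1)] X[OF x0(1)] x by blast
          thus "x \<in> X ` ?Z" using x0 by blast
        qed
      qed (use X in blast)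
    qed
    thus "card (dec_fixed P k p) = card ?Z" using bij_betw_same_card by metis
  qed (rule \<delta>)
qed

lemma card_dec_fixed_connected:
  assumes P: "1 \<in> P" and k: "1 \<le> k" and S: "connected S" "p \<in> S" "q \<in> S"
    and D: "\<And>p x. p \<in> S \<Longrightarrow> x \<in> dec_fixed P k p \<Longrightarrow> alt_deriv (fst p) (snd p) (2 * k) x < 0"
  shows "card (dec_fixed P k p) = card (dec_fixed P k q)"
proof (rule connected_local_const[OF S])
  show "\<forall>a\<in>S. \<forall>\<^sub>F b in at a within S. card (dec_fixed P k a) = card (dec_fixed P k b)"
  proof
    fix a assume a: "a \<in> S"
    obtain d where "0 < d" "\<And>b. dist b a < d \<Longrightarrow> card (dec_fixed P k b) = card (dec_fixed P k a)"
      using card_dec_fixed_locally_constant[OF P k D[OF a]] by blast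
    thus "\<forall>\<^sub>F b in at a within S. card (dec_fixed P k a) = card (dec_fixed P k b)"
      unfolding eventually_at by metis
  qed
qed

subsection \<open>Periodic critical points and bones\<close>

lemma strict_mono_enumeration:
  fixes X :: "real set"
  assumes "finite X" "card X = n"
  shows "\<exists>x. strict_mono_on {1..n} x \<and> bij_betw x {1..n} X"
proof -
  let ?l = "sorted_list_of_set X"
  define x where "x i = ?l ! (i - 1)" for i
  have len: "length ?l = n" using assms by simp
  have sm: "strict_mono_on {1..n} x"
  proof (rule strict_mono_onI)
    fix r s assume "r \<in> {1..n}" "s \<in> {1..n}" "r < s"
    thus "x r < x s" unfolding x_def
      using sorted_wrt_nth_less[OF strict_sorted_list_of_set[of X], of "r - 1" "s - 1"] len by auto
  qed
  have "x ` {1..n} = set ?l"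
  proof
    show "x ` {1..n} \<subseteq> set ?l" unfolding x_def using len by auto
    show "set ?l \<subseteq> x ` {1..n}"
    proof
      fix y assume "y \<in> set ?l"
      then obtain i where "i < n" "?l ! i = y" using len by (metis in_set_conv_nth)
      thus "y \<in> x ` {1..n}" unfolding x_def by (intro image_eqI[of _ _ "Suc i"]) auto
    qed
  qed
  hence "bij_betw x {1..n} X"
    using strict_mono_on_imp_inj_on[OF sm] assms(1) unfolding bij_betw_def by simp
  thus ?thesis using sm by blast
qed

text \<open>The permutations are \<open>h1\<close> and \<open>h2\<close> read in the increasing
  enumerations of \<open>X\<close> and \<open>Y\<close>.\<close>

lemma order_data_exists:
  assumes X: "finite X" "card X = n" and h1: "bij_betw h1 X Y" and h2: "bij_betw h2 Y X"
  shows "\<exists>\<sigma> \<tau>. order_data h1 h2 n X Y \<sigma> \<tau>"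
proof -
  have Y: "finite Y" "card Y = n" using h1 X bij_betw_finite bij_betw_same_card by metis+
  obtain x where x: "strict_mono_on {1..n} x" "bij_betw x {1..n} X" using strict_mono_enumeration[OF X] by blast
  obtain y where y: "strict_mono_on {1..n} y" "bij_betw y {1..n} Y" using strict_mono_enumeration[OF Y] by blast
  have key: "\<exists>\<sigma>. \<sigma> permutes {1..n} \<and> (\<forall>i\<in>{1..n}. h (a i) = b (\<sigma> i))"
    if a: "bij_betw a {1..n} A" and b: "bij_betw b {1..n} B" and h: "bij_betw h A B" for a b h A B
  proof -
    define \<sigma> where "\<sigma> i = (if i \<in> {1..n} then inv_into {1..n} b (h (a i)) else i)" for i
    have "bij_betw (inv_into {1..n} b \<circ> (h \<circ> a)) {1..n} {1..n}"
      by (rule bij_betw_trans[OF bij_betw_trans[OF a h] bij_betw_inv_into[OF b]])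
    hence "bij_betw \<sigma> {1..n} {1..n}"
      by (subst bij_betw_cong[of _ \<sigma> "inv_into {1..n} b \<circ> (h \<circ> a)"]) (simp_all add: \<sigma>_def)
    hence "\<sigma> permutes {1..n}" by (rule bij_imp_permutes) (auto simp: \<sigma>_def)
    moreover have "h (a i) = b (\<sigma> i)" if "i \<in> {1..n}" for i
    proof -
      have "h (a i) \<in> B" using that a h bij_betwE by metis
      thus ?thesis unfolding \<sigma>_def using that bij_betw_inv_into_right[OF b] by simp
    qed
    ultimately show ?thesis by blast
  qed
  obtain \<sigma> where \<sigma>: "\<sigma> permutes {1..n}" "\<forall>i\<in>{1..n}. h1 (x i) = y (\<sigma> i)" using key[OF x(2) y(2) h1] by blast
  obtain \<tau> where \<tau>: "\<tau> permutes {1..n}" "\<forall>i\<in>{1..n}. h2 (y i) = x (\<tau> i)" using key[OF y(2) x(2) h2] by blast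
  show ?thesis unfolding order_data_def using x y \<sigma> \<tau> bij_betw_imp_surj_on by metis
qed

lemma funpow_funpow_commute: "(F ^^ a) ((F ^^ b) y) = (F ^^ b) ((F ^^ a) y)"
proof -
  have "(F ^^ a) ((F ^^ b) y) = (F ^^ (a + b)) y" "(F ^^ b) ((F ^^ a) y) = (F ^^ (b + a)) y"
    by (simp_all add: funpow_add)
  thus ?thesis by (simp add: add.commute)
qed

lemma least_period_orbit:
  assumes "least_period (h2 \<circ> h1) n x" and X: "X = range (\<lambda>k. ((h2 \<circ> h1) ^^ k) x)"
  shows "finite X" "card X = n" "bij_betw h1 X (h1 ` X)" "bij_betw h2 (h1 ` X) X"
proof -
  let ?F = "h2 \<circ> h1"
  have n: "0 < n" "(?F ^^ n) x = x" "\<And>m. 0 < m \<Longrightarrow> m < n \<Longrightarrow> (?F ^^ m) x \<noteq> x"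
    using assms(1) unfolding least_period_def by auto
  have X': "X = (\<lambda>k. (?F ^^ k) x) ` {..<n}"
  proof
    show "X \<subseteq> (\<lambda>k. (?F ^^ k) x) ` {..<n}"
    proof
      fix a assume "a \<in> X"
      then obtain k where "a = (?F ^^ k) x" unfolding X by blast
      hence "a = (?F ^^ (k mod n)) x" using funpow_mod_eq[OF n(2), of k] by simp
      thus "a \<in> (\<lambda>k. (?F ^^ k) x) ` {..<n}" using n(1) by (intro image_eqI[of _ _ "k mod n"]) simp_all
    qed
  qed (use X in blast)
  thus fin: "finite X" by simp
  have neq: "(?F ^^ i) x \<noteq> (?F ^^ j) x" if "i < j" "j < n" for i j
  proof
    assume "(?F ^^ i) x = (?F ^^ j) x"
    hence "(?F ^^ (n - j)) ((?F ^^ i) x) = (?F ^^ (n - j)) ((?F ^^ j) x)" by simp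
    hence "(?F ^^ (n - j + i)) x = (?F ^^ (n - j + j)) x" by (simp only: funpow_add comp_apply)
    hence fixed: "(?F ^^ (n - j + i)) x = x" using that n(2) by simp
    have "0 < n - j + i" "n - j + i < n" using that by linarith+
    from n(3)[OF this] fixed show False by contradiction
  qed
  have "inj_on (\<lambda>k. (?F ^^ k) x) {..<n}"
  proof (rule inj_onI)
    fix i j assume "i \<in> {..<n}" "j \<in> {..<n}" "(?F ^^ i) x = (?F ^^ j) x"
    thus "i = j" using neq[of i j] neq[of j i] by (cases i j rule: linorder_cases) auto
  qed
  thus card: "card X = n" unfolding X' by (simp add: card_image)
  have Fn: "(?F ^^ n) a = a" if "a \<in> X" for a
  proof -
    obtain k where k: "a = (?F ^^ k) x" using \<open>a \<in> X\<close> X by blast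
    have "(?F ^^ n) ((?F ^^ k) x) = (?F ^^ k) ((?F ^^ n) x)"
      by (rule funpow_funpow_commute)
    thus ?thesis using n(2) k by simp
  qed
  have FX: "?F a \<in> X" if "a \<in> X" for a
  proof -
    obtain k where k: "a = (?F ^^ k) x" using \<open>a \<in> X\<close> X by blast
    have "?F a = (?F ^^ Suc k) x" unfolding k by simp
    thus ?thesis unfolding X by blast
  qed
  \<comment> \<open>On the orbit the power \<open>n - 1\<close> of the map is a left inverse of the
    map, whence injectivity.\<close>
  have pred: "a = (?F ^^ (n - 1)) (?F a)" if "a \<in> X" for a
  proof -
    have "(?F ^^ n) a = (?F ^^ (n - 1)) (?F a)" using n(1) by (metis Suc_diff_1 funpow_Suc_right comp_apply)
    thus ?thesis using Fn[OF that] by simp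
  qed
  have injF: "inj_on ?F X" by (rule inj_onI) (metis pred)
  hence inj1: "inj_on h1 X" by (rule inj_on_imageI2)
  thus "bij_betw h1 X (h1 ` X)" by (simp add: bij_betw_def)
  have "?F ` X \<subseteq> X" using FX by blast
  hence surj: "?F ` X = X" using endo_inj_surj[OF fin _ injF] by blast
  have "inj_on h2 (h1 ` X)" using injF by (metis comp_inj_on_iff inj1)
  moreover have "h2 ` h1 ` X = X" using surj by (simp add: image_comp)
  ultimately show "bij_betw h2 (h1 ` X) X" by (simp add: bij_betw_def)
qed

lemma periodic_in_I1_exists:
  assumes "least_period (h2 \<circ> h1) n x" "x \<in> {0..1}"
  shows "\<exists>\<sigma> \<tau>. periodic_in_I1 h1 h2 n \<sigma> \<tau> x"
proof -
  let ?X = "range (\<lambda>k. ((h2 \<circ> h1) ^^ k) x)"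
  note o = least_period_orbit[OF assms(1) refl]
  have "range (\<lambda>k. h1 (((h2 \<circ> h1) ^^ k) x)) = h1 ` ?X" by blast
  thus ?thesis using order_data_exists[OF o] assms unfolding periodic_in_I1_def by simp
qed

lemma periodic_in_I2_exists:
  assumes "least_period (h1 \<circ> h2) n y" "y \<in> {0..1}"
  shows "\<exists>\<sigma> \<tau>. periodic_in_I2 h1 h2 n \<sigma> \<tau> y"
proof -
  let ?Y = "range (\<lambda>k. ((h1 \<circ> h2) ^^ k) y)"
  note o = least_period_orbit[OF assms(1) refl]
  have e: "range (\<lambda>k. h2 (((h1 \<circ> h2) ^^ k) y)) = h2 ` ?Y" by blast
  have "finite (h2 ` ?Y)" "card (h2 ` ?Y) = n"
    using o bij_betw_same_card[OF o(3)] by simp_all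
  from order_data_exists[OF this o(4,3)] show ?thesis
    using assms unfolding periodic_in_I2_def e by simp
qed

lemma least_period_exists:
  assumes "(F ^^ k) y = y" "1 \<le> k"
  shows "\<exists>m. least_period F m y \<and> m dvd k"
proof -
  define m where "m = (LEAST m. 0 < m \<and> (F ^^ m) y = y)"
  have m: "0 < m" "(F ^^ m) y = y"
    using LeastI[of "\<lambda>m. 0 < m \<and> (F ^^ m) y = y" k] assms unfolding m_def by auto
  have least: "\<not> (0 < l \<and> (F ^^ l) y = y)" if "l < m" for l
    using not_less_Least that unfolding m_def by blast
  have "(F ^^ (k mod m)) y = y" using funpow_mod_eq[OF m(2), of k] assms(1) by simp
  hence "k mod m = 0" using least[of "k mod m"] m(1) by auto
  moreover have "least_period F m y" unfolding least_period_def using m least by blast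
  ultimately show ?thesis by auto
qed

lemma least_period_unique: "least_period F m y \<Longrightarrow> least_period F n y \<Longrightarrow> m = n"
  unfolding least_period_def by (metis linorder_neqE_nat)

lemma unimodal_map_quad:
  assumes v: "v \<in> {0<..1}" shows "unimodal_map (quad v)"
  unfolding unimodal_map_def
proof (intro conjI exI[of _ "1/2::real"])
  show "continuous_on {0..1} (quad v)" unfolding quad_def by (intro continuous_intros)
  show "quad v ` {0..1} \<subseteq> {0..1}" using quad_range[of v] v by (auto simp del: atLeastAtMost_iff) auto
  show "quad v 0 = 0" "quad v 1 = 0" by (simp_all add: quad_def)
  show "strict_mono_on {0<..<1/2} (quad v)"
    using mono_dir_quad_left[of v] v unfolding mono_dir_def monotone_on_def by auto
  show "strict_antimono_on {1/2<..<1} (quad v)"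
    using mono_dir_quad_right[of v] v unfolding mono_dir_def monotone_on_def by auto
qed simp_all

section \<open>Half-periods of the bones that are met\<close>

definition crossed_periods :: "(real \<times> real) set \<Rightarrow> nat set" where
  "crossed_periods S = {n. \<exists>\<sigma> \<tau>. admissible n \<sigma> \<tau> \<and> (left_bone n \<sigma> \<tau> \<inter> S \<noteq> {} \<or> right_bone n \<sigma> \<tau> \<inter> S \<noteq> {})}"

lemma crossed_periods_pos: "n \<in> crossed_periods S \<Longrightarrow> 1 \<le> n"
  unfolding crossed_periods_def left_bone_def right_bone_def periodic_in_I1_def periodic_in_I2_def least_period_def
  by auto

text \<open>Any parameter on a bone determines \<open>n\<close> as the least period of the critical
  point, so choosing a crossed bone for each \<open>n\<close> is injective. Left and right bones are
  treated apart, since the comparison is between periods of the same critical point.\<close>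

lemma finite_crossed_periods:
  assumes "finite {B \<in> bones. B \<inter> S \<noteq> {}}"
  shows "finite (crossed_periods S)"
proof -
  have key: "finite {n. \<exists>\<sigma> \<tau>. admissible n \<sigma> \<tau> \<and> b n \<sigma> \<tau> \<inter> S \<noteq> {}}"
    if b: "\<And>n \<sigma> \<tau>. admissible n \<sigma> \<tau> \<Longrightarrow> b n \<sigma> \<tau> \<in> bones"
      and u: "\<And>n \<sigma> \<tau> n' \<sigma>' \<tau>' p. p \<in> b n \<sigma> \<tau> \<Longrightarrow> p \<in> b n' \<sigma>' \<tau>' \<Longrightarrow> n = n'"
    for b :: "nat \<Rightarrow> (nat \<Rightarrow> nat) \<Rightarrow> (nat \<Rightarrow> nat) \<Rightarrow> (real \<times> real) set"
  proof -
    let ?N = "{n. \<exists>\<sigma> \<tau>. admissible n \<sigma> \<tau> \<and> b n \<sigma> \<tau> \<inter> S \<noteq> {}}"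
    have "\<forall>n\<in>?N. \<exists>B. \<exists>\<sigma> \<tau>. B = b n \<sigma> \<tau> \<and> admissible n \<sigma> \<tau> \<and> B \<inter> S \<noteq> {}" by blast
    from bchoice[OF this] obtain B where
      "\<forall>n\<in>?N. \<exists>\<sigma> \<tau>. B n = b n \<sigma> \<tau> \<and> admissible n \<sigma> \<tau> \<and> B n \<inter> S \<noteq> {}" ..
    note B = bspec[OF this]
    have "inj_on B ?N"
    proof (rule inj_onI)
      fix n n' assume n: "n \<in> ?N" "n' \<in> ?N" and eq: "B n = B n'"
      obtain \<sigma> \<tau> where 1: "B n = b n \<sigma> \<tau>" "B n \<inter> S \<noteq> {}" using B[OF n(1)] by blast
      obtain \<sigma>' \<tau>' where 2: "B n' = b n' \<sigma>' \<tau>'" using B[OF n(2)] by blast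
      obtain p where "p \<in> B n" using 1(2) by blast
      hence "p \<in> b n \<sigma> \<tau>" "p \<in> b n' \<sigma>' \<tau>'" using 1(1) 2 eq by simp_all
      thus "n = n'" by (rule u)
    qed
    moreover have "B ` ?N \<subseteq> {B \<in> bones. B \<inter> S \<noteq> {}}"
    proof (intro image_subsetI CollectI)
      fix n assume "n \<in> ?N"
      then obtain \<sigma> \<tau> where "B n = b n \<sigma> \<tau>" "admissible n \<sigma> \<tau>" "B n \<inter> S \<noteq> {}" using B by blast
      thus "B n \<in> bones \<and> B n \<inter> S \<noteq> {}" using b by simp
    qed
    ultimately show ?thesis using assms by (rule inj_on_finite)
  qed
  have "finite {n. \<exists>\<sigma> \<tau>. admissible n \<sigma> \<tau> \<and> left_bone n \<sigma> \<tau> \<inter> S \<noteq> {}}"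
  proof (rule key)
    show "\<And>n \<sigma> \<tau>. admissible n \<sigma> \<tau> \<Longrightarrow> left_bone n \<sigma> \<tau> \<in> bones" unfolding bones_def by blast
    show "n = n'" if "p \<in> left_bone n \<sigma> \<tau>" "p \<in> left_bone n' \<sigma>' \<tau>'" for n \<sigma> \<tau> n' \<sigma>' \<tau>' p
      using that least_period_unique unfolding left_bone_def periodic_in_I1_def by auto
  qed
  moreover have "finite {n. \<exists>\<sigma> \<tau>. admissible n \<sigma> \<tau> \<and> right_bone n \<sigma> \<tau> \<inter> S \<noteq> {}}"
  proof (rule key)
    show "\<And>n \<sigma> \<tau>. admissible n \<sigma> \<tau> \<Longrightarrow> right_bone n \<sigma> \<tau> \<in> bones" unfolding bones_def by blast
    show "n = n'" if "p \<in> right_bone n \<sigma> \<tau>" "p \<in> right_bone n' \<sigma>' \<tau>'" for n \<sigma> \<tau> n' \<sigma>' \<tau>' p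
      using that least_period_unique unfolding right_bone_def periodic_in_I2_def by auto
  qed
  moreover have "crossed_periods S = {n. \<exists>\<sigma> \<tau>. admissible n \<sigma> \<tau> \<and> left_bone n \<sigma> \<tau> \<inter> S \<noteq> {}} \<union>
      {n. \<exists>\<sigma> \<tau>. admissible n \<sigma> \<tau> \<and> right_bone n \<sigma> \<tau> \<inter> S \<noteq> {}}"
    unfolding crossed_periods_def by blast
  ultimately show ?thesis by simp
qed

text \<open>The quadratic maps themselves witness admissibility; they are unimodal because the
  parameters are positive.\<close>

lemma left_critical_crossed:
  assumes p: "(v, w) \<in> S" "v \<in> {0<..1}" "w \<in> {0<..1}" and m: "least_period (quad w \<circ> quad v) m (1/2)"
  shows "m \<in> crossed_periods S"
proof -
  obtain \<sigma> \<tau> where st: "periodic_in_I1 (quad v) (quad w) m \<sigma> \<tau> (1/2)"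
    using periodic_in_I1_exists[OF m] by auto
  hence "admissible m \<sigma> \<tau>" unfolding admissible_def using unimodal_map_quad p(2,3) by blast
  moreover have "(v, w) \<in> left_bone m \<sigma> \<tau>" unfolding left_bone_def PQ_def using st p(2,3) by auto
  ultimately show ?thesis unfolding crossed_periods_def using p(1) by blast
qed

lemma right_critical_crossed:
  assumes p: "(v, w) \<in> S" "v \<in> {0<..1}" "w \<in> {0<..1}" and m: "least_period (quad v \<circ> quad w) m (1/2)"
  shows "m \<in> crossed_periods S"
proof -
  obtain \<sigma> \<tau> where st: "periodic_in_I2 (quad v) (quad w) m \<sigma> \<tau> (1/2)"
    using periodic_in_I2_exists[OF m] by auto
  hence "admissible m \<sigma> \<tau>" unfolding admissible_def using unimodal_map_quad p(2,3) by blast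
  moreover have "(v, w) \<in> right_bone m \<sigma> \<tau>" unfolding right_bone_def PQ_def using st p(2,3) by auto
  ultimately show ?thesis unfolding crossed_periods_def using p(1) by blast
qed

section \<open>Degenerate parameters and the sign of the multipliers\<close>

lemma alt_comp_degenerate:
  assumes "v = 0 \<or> w = 0" "1 \<le> k" shows "alt_comp v w (2 * k) x = 0"
proof -
  obtain l where "k = Suc l" using assms(2) by (cases k) auto
  thus ?thesis using assms(1) by (auto simp: quad_def)
qed

text \<open>The composition is constantly 0, and its only fixed point 0 is excluded by
  \<open>1 \<in> P\<close>.\<close>

lemma dec_fixed_degenerate:
  assumes "fst p = 0 \<or> snd p = 0" "1 \<le> k" "1 \<in> P" shows "dec_fixed P k p = {}"
proof (rule ccontr)
  assume "\<not> ?thesis"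
  then obtain x where x: "x \<in> dec_fixed P k p" by blast
  hence "x = 0" using alt_comp_degenerate[OF assms(1,2), of x] unfolding dec_fixed_def by simp
  moreover have "alt_comp (fst p) (snd p) (2 * 1) 0 = 0" by (rule alt_comp_degenerate[OF assms(1)]) simp
  moreover have "\<forall>j\<in>P. j dvd k \<longrightarrow> alt_comp (fst p) (snd p) (2 * j) x \<noteq> x" using x unfolding dec_fixed_def by blast
  from bspec[OF this assms(3), THEN mp, OF one_dvd] have "alt_comp (fst p) (snd p) (2 * 1) x \<noteq> x" .
  ultimately show False by blast
qed

text \<open>Multiplier 0 puts a critical point on the cycle of \<open>x\<close>. Its least period
  \<open>m\<close> divides \<open>k\<close>, the parameter lies on a bone of half-period
  \<open>m\<close>, and \<open>x\<close> is fixed by \<open>f^m\<close>: such points are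
  excluded.\<close>

lemma dec_fixed_hyperbolic:
  assumes p: "p \<in> S" "S \<subseteq> PQ" and k: "1 \<le> k" and x: "x \<in> dec_fixed (insert 1 (crossed_periods S)) k p"
  shows "alt_deriv (fst p) (snd p) (2 * k) x < 0"
proof (rule ccontr)
  let ?P = "insert 1 (crossed_periods S)"
  obtain v w where vw: "p = (v, w)" by (cases p)
  assume "\<not> ?thesis"
  hence D0: "alt_deriv v w (2 * k) x = 0" using x unfolding dec_fixed_def vw by simp
  have fx: "alt_comp v w (2 * k) x = x" using x unfolding dec_fixed_def vw by simp
  have "v \<noteq> 0 \<and> w \<noteq> 0" using dec_fixed_degenerate[of p k ?P] x k vw by auto
  moreover have "v \<in> {0..1}" "w \<in> {0..1}" using p unfolding vw PQ_def by auto
  ultimately have v: "v \<in> {0<..1}" "w \<in> {0<..1}" by auto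
  have excl: False if "m \<in> crossed_periods S" "m dvd k" "alt_comp v w (2 * m) x = x" for m
    using x that unfolding dec_fixed_def vw by auto
  obtain i where i: "i < 2 * k" "alt_comp v w i x = 1/2"
    using D0 v unfolding alt_deriv_def by (auto simp: prod_zero_iff split: if_splits)
  let ?f = "quad w \<circ> quad v" and ?g = "quad v \<circ> quad w"
  have fk: "(?f ^^ k) x = x" using fx by (simp add: alt_comp_even)
  note comm = funpow_funpow_commute
  define j where "j = i div 2"
  have j: "j \<le> k" unfolding j_def using i by simp
  define z where "z = (?f ^^ j) x"
  \<comment> \<open>By periodicity \<open>x\<close> is a forward iterate of \<open>z\<close>, so
    being fixed by \<open>f^m\<close> transfers from \<open>z\<close> to \<open>x\<close>.\<close>
  have xz: "x = (?f ^^ (k - j)) z"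
    unfolding z_def using fk j by (metis comp_apply funpow_add le_add_diff_inverse2)
  have fz: "(?f ^^ k) z = z" unfolding z_def comm[of k] fk ..
  have pull: "alt_comp v w (2 * m) x = x" if "(?f ^^ m) z = z" for m
    unfolding alt_comp_even using that xz comm by metis
  show False
  proof (cases "even i")
    case True
    hence "i = 2 * j" unfolding j_def by simp
    hence z: "z = 1/2" using i(2) unfolding z_def by (simp add: alt_comp_even)
    obtain m where m: "least_period ?f m z" "m dvd k" using least_period_exists[OF fz k] by blast
    show False
      using excl[OF left_critical_crossed[OF _ v] m(2) pull] m(1) p(1) unfolding z vw least_period_def by blast
  next
    case False
    hence i': "i = Suc (2 * j)" unfolding j_def by simp
    have y: "quad v z = 1/2" using i(2) unfolding i' z_def by (simp add: alt_comp_even)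
    \<comment> \<open>\<open>quad v\<close> and \<open>quad w\<close> intertwine the two
      compositions; this carries the period of the critical point in the second interval over to
      \<open>z\<close>.\<close>
    have semi: "(?g ^^ a) (quad v u) = quad v ((?f ^^ a) u)" for a u by (induction a) auto
    have semi': "(?f ^^ a) (quad w u) = quad w ((?g ^^ a) u)" for a u by (induction a) auto
    have "(?g ^^ k) (1/2) = 1/2" unfolding y[symmetric] semi fz ..
    from least_period_exists[OF this k] obtain m where m: "least_period ?g m (1/2)" "m dvd k" by blast
    have z': "z = (?f ^^ (k - 1)) (quad w (1/2))"
      unfolding y[symmetric] using fz k by (metis Suc_diff_1 comp_apply funpow_Suc_right less_eq_Suc_le One_nat_def)
    have "(?g ^^ m) (1/2) = 1/2" using m(1) unfolding least_period_def by simp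
    hence "(?f ^^ m) z = z" unfolding z' comm[of m] semi' by (rule arg_cong)
    from excl[OF right_critical_crossed[OF _ v m(1)] m(2) pull[OF this]] show False using p(1) vw by blast
  qed
qed

text \<open>All iterates from the first on are 0, so separation occurs only at time 0 and the size
  of separated sets is bounded independently of \<open>n\<close>.\<close>

lemma entropy_degenerate:
  assumes v: "v \<in> {0..1}" "w \<in> {0..1}" "v = 0 \<or> w = 0" and a: "0 < a"
  shows "topological_entropy {0..1} (quad w \<circ> quad v) \<le> ereal a"
proof (rule ccontr)
  let ?f = "quad w \<circ> quad v"
  assume "\<not> ?thesis"
  hence "ereal a < topological_entropy {0..1} ?f" by simp
  then obtain \<epsilon> where e: "0 < \<epsilon>" "\<And>n0. \<exists>n\<ge>n0. \<exists>E. finite E \<and> E \<subseteq> {0..1} \<and> dyn_separated ?f n \<epsilon> E \<and> exp (a * real n) < real (card E)"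
    using less_topological_entropy_separated[of a "{0..1}" ?f] a by auto
  obtain n0 where n0: "\<And>n. n \<ge> n0 \<Longrightarrow> (1 / \<epsilon> + 1) * (0 * real n + 1) < exp (a * real n)"
    using exp_beats_linear[OF a, of "1 / \<epsilon> + 1" 0] by blast
  obtain n E where n: "n \<ge> n0" and E: "finite E" "E \<subseteq> {0..1}" "dyn_separated ?f n \<epsilon> E" "exp (a * real n) < real (card E)"
    using e(2) by blast
  have "dyn_separated ?f 1 \<epsilon> E"
    unfolding dyn_separated_def
  proof (intro ballI impI)
    fix x y assume "x \<in> E" "y \<in> E" "x \<noteq> y"
    then obtain k where k: "k < n" "dist ((?f ^^ k) x) ((?f ^^ k) y) > \<epsilon>"
      using E(3) unfolding dyn_separated_def by blast
    have "k = 0"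
    proof (rule ccontr)
      assume "k \<noteq> 0"
      hence "(?f ^^ k) u = 0" for u using alt_comp_degenerate[OF v(3), of k u] by (simp add: alt_comp_even)
      thus False using k(2) e(1) by simp
    qed
    thus "\<exists>k<1. dist ((?f ^^ k) x) ((?f ^^ k) y) > \<epsilon>" using k(2) by auto
  qed
  hence "real (card E) \<le> real 1 / \<epsilon> + 1"
  proof (rule card_separated_monotone[OF e(1) E(1,2)])
    fix i :: nat and x y :: real assume "i < 1"
    thus "strictly_monotone (?f ^^ i) {x..y}" by (intro strictly_monotoneI[of 1]) (auto simp: mono_dir_def)
  next
    show "(?f ^^ i) x \<in> {0..1}" if "x \<in> {0..1}" for i x
      using alt_comp_range[of v w x "2 * i"] v that by (simp add: alt_comp_even)
  qed
  thus False using n0[OF n] E(4) by simp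
qed

section \<open>Comparison of entropies along a connected set\<close>

lemma entropy_le_of_finitely_many_bones:
  assumes S: "connected S" "S \<subseteq> PQ" and fin: "finite {B \<in> bones. B \<inter> S \<noteq> {}}"
    and p: "(v, w) \<in> S" and q: "(v', w') \<in> S"
  shows "topological_entropy {0..1} (quad w \<circ> quad v) \<le> topological_entropy {0..1} (quad w' \<circ> quad v')"
proof (rule ccontr)
  assume "\<not> ?thesis"
  hence "topological_entropy {0..1} (quad w' \<circ> quad v') < topological_entropy {0..1} (quad w \<circ> quad v)" by simp
  \<comment> \<open>Three rates are used: \<open>a0\<close> above the smaller entropy,
    \<open>a1\<close> for the upper count with room above \<open>a0\<close>, and \<open>a2\<close>
    for the lower count.\<close>
  then obtain a2 where a2: "topological_entropy {0..1} (quad w' \<circ> quad v') < ereal a2"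
    "ereal a2 < topological_entropy {0..1} (quad w \<circ> quad v)" using ereal_dense2 by blast
  obtain a0 where a0: "topological_entropy {0..1} (quad w' \<circ> quad v') < ereal a0" "a0 < a2"
    using ereal_dense2[OF a2(1)] by auto
  obtain a1 where a1: "a0 < a1" "a1 < a2" using dense[OF a0(2)] by blast
  have "0 < ereal a0" using topological_entropy_nonneg a0(1) by (rule order.strict_trans1)
  hence pos: "0 < a0" "0 < a1" "0 < a2" using a0 a1 by auto
  have v01: "v \<in> {0..1}" "w \<in> {0..1}" "v' \<in> {0..1}" "w' \<in> {0..1}" using p q S(2) unfolding PQ_def by auto
  have "v \<noteq> 0 \<and> w \<noteq> 0" using entropy_degenerate[of v w a2] v01 a2(2) pos by (auto simp: not_less)
  hence v: "v \<in> {0<..1}" "w \<in> {0<..1}" using v01 by auto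
  let ?P = "insert 1 (crossed_periods S)"
  have finP: "finite ?P" using finite_crossed_periods[OF fin] by simp
  have P1: "1 \<le> j" if "j \<in> ?P" for j using that crossed_periods_pos by auto
  have card_eq: "card (dec_fixed ?P k (v, w)) = card (dec_fixed ?P k (v', w'))" if "1 \<le> k" for k
    by (rule card_dec_fixed_connected[OF _ that S(1) p q]) (use dec_fixed_hyperbolic[OF _ S(2) that] in auto)
  obtain Q where Q: "\<And>k. 1 \<le> k \<Longrightarrow> real (card (dec_fixed ?P k (v', w'))) \<le> Q * exp (a1 * real k)" "0 \<le> Q"
  proof (cases "v' = 0 \<or> w' = 0")
    case True
    have "real (card (dec_fixed ?P k (v', w'))) \<le> 0 * exp (a1 * real k)" if "1 \<le> k" for k
      using dec_fixed_degenerate[of "(v', w')" k ?P] True that by simp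
    thus ?thesis using that by blast
  next
    case False
    hence v': "v' \<in> {0<..1}" "w' \<in> {0<..1}" using v01 by auto
    obtain Q where Q: "\<And>k Z. finite Z \<Longrightarrow> Z \<subseteq> {0..1} \<Longrightarrow> \<forall>x\<in>Z. alt_comp v' w' (2 * k) x = x \<and> alt_deriv v' w' (2 * k) x < 0 \<Longrightarrow>
       real (card Z) \<le> Q * exp (a1 * real k)"
      using entropy_fixed_points_upper[OF v' a1(1) a0(1)] by blast
    have "real (card (dec_fixed ?P k (v', w'))) \<le> \<bar>Q\<bar> * exp (a1 * real k)" if k: "1 \<le> k" for k
    proof -
      have "real (card (dec_fixed ?P k (v', w'))) \<le> Q * exp (a1 * real k)"
      proof (rule Q[OF finite_dec_fixed[OF k]])
        show "dec_fixed ?P k (v', w') \<subseteq> {0..1}" unfolding dec_fixed_def by blast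
        show "\<forall>x\<in>dec_fixed ?P k (v', w'). alt_comp v' w' (2 * k) x = x \<and> alt_deriv v' w' (2 * k) x < 0"
          using dec_fixed_hyperbolic[OF q S(2) k] unfolding dec_fixed_def by auto
      qed
      also have "\<dots> \<le> \<bar>Q\<bar> * exp (a1 * real k)" by (intro mult_right_mono) auto
      finally show ?thesis .
    qed
    thus ?thesis using that[of "\<bar>Q\<bar>"] by simp
  qed
  \<comment> \<open>Contains everything that the exclusions can remove; its size does not depend on
    \<open>k\<close>, so the growth rate is unaffected.\<close>
  define Bad where "Bad = (\<Union>j\<in>?P. {x. alt_comp v w (2 * j) x = x})"
  have finBad: "finite Bad" unfolding Bad_def using finP P1 by (intro finite_UN_I finite_fixed_points)
  obtain c where c: "0 < c" "\<And>K. \<exists>k\<ge>K. \<exists>Z. finite Z \<and> Z \<subseteq> {0..1} \<and> c * exp (a2 * real k) \<le> real (card Z) \<and>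
     (\<forall>x\<in>Z. alt_comp v w (2 * k) x = x \<and> alt_deriv v w (2 * k) x \<le> 0)"
    using entropy_fixed_points_lower[OF v pos(3) a2(2)] by blast
  \<comment> \<open>The two counts bound the ratio of the exponentials by this constant, which it
    exceeds for large \<open>k\<close>.\<close>
  define Q' where "Q' = (Q + real (card Bad)) / c"
  obtain n0 where n0: "\<And>n. n \<ge> n0 \<Longrightarrow> Q' * (0 * real n + 1) < exp ((a2 - a1) * real n)"
    using exp_beats_linear[of "a2 - a1" Q' 0] a1 by auto
  obtain k Z where k: "max 1 n0 \<le> k" and Z: "finite Z" "Z \<subseteq> {0..1}" "c * exp (a2 * real k) \<le> real (card Z)"
     "\<forall>x\<in>Z. alt_comp v w (2 * k) x = x \<and> alt_deriv v w (2 * k) x \<le> 0"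
    using c(2)[of "max 1 n0"] by (elim exE conjE)
  have k1: "1 \<le> k" "n0 \<le> k" using k by auto
  have "Z \<subseteq> dec_fixed ?P k (v, w) \<union> Bad" using Z unfolding dec_fixed_def Bad_def by auto
  hence "card Z \<le> card (dec_fixed ?P k (v, w) \<union> Bad)"
    using finBad finite_dec_fixed[OF k1(1)] by (intro card_mono) auto
  also have "\<dots> \<le> card (dec_fixed ?P k (v, w)) + card Bad" by (rule card_Un_le)
  finally have "real (card Z) \<le> real (card (dec_fixed ?P k (v, w))) + real (card Bad)" by linarith
  also have "\<dots> \<le> Q * exp (a1 * real k) + real (card Bad) * exp (a1 * real k)"
  proof (rule add_mono)
    show "real (card (dec_fixed ?P k (v, w))) \<le> Q * exp (a1 * real k)" unfolding card_eq[OF k1(1)] by (rule Q(1)[OF k1(1)])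
    have "1 \<le> exp (a1 * real k)" using pos by simp
    thus "real (card Bad) \<le> real (card Bad) * exp (a1 * real k)" by (simp add: mult_le_cancel_left1)
  qed
  finally have "c * exp (a2 * real k) \<le> (Q + real (card Bad)) * exp (a1 * real k)" using Z(3) by (simp add: distrib_right)
  moreover have "exp (a2 * real k) = exp ((a2 - a1) * real k) * exp (a1 * real k)"
    by (simp add: exp_add[symmetric] algebra_simps)
  ultimately have "c * exp ((a2 - a1) * real k) \<le> Q + real (card Bad)" by simp
  hence "exp ((a2 - a1) * real k) \<le> Q'" unfolding Q'_def using c(1) by (simp add: field_simps)
  thus False using n0[OF k1(2)] by simp
qed

theorem lemma5p4:
  fixes v1 w1 v2 w2 :: real and g :: "real \<Rightarrow> real \<times> real"
  assumes "(v1, w1) \<in> PQ" and "(v2, w2) \<in> PQ"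
    and "topological_entropy {0..1} (quad w1 \<circ> quad v1) \<noteq>
         topological_entropy {0..1} (quad w2 \<circ> quad v2)"
    and "path g" and "path_image g \<subseteq> PQ"
    and "pathstart g = (v1, w1)" and "pathfinish g = (v2, w2)"
  shows "infinite {B \<in> bones. B \<inter> path_image g \<noteq> {}}"
proof
  assume fin: "finite {B \<in> bones. B \<inter> path_image g \<noteq> {}}"
  have "(v1, w1) \<in> path_image g" "(v2, w2) \<in> path_image g"
    using pathstart_in_path_image[of g] pathfinish_in_path_image[of g] assms(6,7) by simp_all
  thus False
    using entropy_le_of_finitely_many_bones[OF connected_path_image[OF assms(4)] assms(5) fin]
      assms(3) antisym by metis
qed

end
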